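(* Let $\lambda$ be a Young diagram with $|\lambda|\ge1$ nodes and let $[\nu]_{|\lambda|}$ be a standard Young tableau of shape $\lambda$. Then the Ocneanu trace $\mathrm{qdim}(\lambda):=\mathcal{T}r^{(|\lambda|)}e([\nu]_{|\lambda|})$ of the corresponding primitive idempotent is $$\mathrm{qdim}(\lambda)=q^{-d|\lambda|}\prod_{(n,m)\in\lambda}\frac{[d+m-n]_q}{[h_{n,m}]_q},$$ where the product runs over the nodes of $\lambda$, $n$ being the row and $m$ the column of the node, and $h_{n,m}$ is the hook length of the node $(n,m)$ in $\lambda$.
   Context: Let $q\in\mathbf{C}\setminus\{0\}$ be generic, i.e. $q\neq \exp(2\pi i k/m)$ for all integers $k,m$ with $m\ne 0$ (so $q$ is not a root of unity). Write $[x]_q=\frac{q^x-q^{-x}}{q-q^{-1}}$. The $A$-type Hecke algebra $H_n=H_n(q)$ is the unital associative $\mathbf{C}$-algebra generated by $\sigma_1,\dots,\sigma_{n-1}$ with relations $\sigma_i\sigma_{i+1}\sigma_i=\sigma_{i+1}\sigma_i\sigma_{i+1}$, $\sigma_i\sigma_j=\sigma_j\sigma_i$ for $|i-j|>1$, and $\sigma_i^2-1=(q-q^{-1})\sigma_i$; $H_1=H_0=\mathbf{C}$ and $H_n\subset H_{n+1}$. The Jucys-Murphy elements are $y_1=1$, $y_{i+1}=\sigma_i y_i\sigma_i$; they pairwise commute. A standard Young tableau $[\nu]_n$ is a Young diagram with $n$ nodes filled with $1,\dots,n$, increasing along rows to the right and along columns downwards. The content of the node in row $r$ and column $c$ is $q^{2(c-r)}$,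 and $a_i$ denotes the content of the node filled with $i$. The idempotent $e([\nu]_n)\in H_n$ corresponding to $[\nu]_n$ is the unique primitive idempotent $e$ with $y_ie=ey_i=a_ie$ for $i=1,\dots,n$. Let $d$ be a parameter and $z_d=\frac{1-q^{-2d}}{q-q^{-1}}$. $Tr_{d(m+1)}:H_{m+1}\to H_m$ are linear maps such that for all $X,Y\in H_m$, $Z\in H_{m+1}$: $Tr_{d(m+1)}(X)=z_dX$; $Tr_{d(m+1)}(XZY)=X\,Tr_{d(m+1)}(Z)\,Y$; $Tr_{d(m+1)}(\sigma_m^{\pm1}X\sigma_m^{\mp1})=Tr_{d(m)}(X)$; $Tr_{d(m+1)}(\sigma_m)=1$; $Tr_{d(m)}Tr_{d(m+1)}(\sigma_mZ)=Tr_{d(m)}Tr_{d(m+1)}(Z\sigma_m)$ (relations involving $\sigma_m$ are for $m\ge1$). The Ocneanu trace is $\mathcal{T}r^{(m)}:=Tr_{d(1)}Tr_{d(2)}\cdots Tr_{d(m)}:H_m\to\mathbf{C}$. *)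

theory Defs
  imports "HOL-Analysis.Analysis" "HOL-Library.Poly_Mapping"
begin

section \<open>Unital associative complex algebras\<close>

class complex_algebra_1 = ring_1 +
  fixes scaleC :: "complex \<Rightarrow> 'a \<Rightarrow> 'a"  (infixr "*\<^sub>C" 75)
  assumes scaleC_add_right: "a *\<^sub>C (x + y) = a *\<^sub>C x + a *\<^sub>C y"
    and scaleC_add_left: "(a + b) *\<^sub>C x = a *\<^sub>C x + b *\<^sub>C x"
    and scaleC_scaleC: "a *\<^sub>C b *\<^sub>C x = (a * b) *\<^sub>C x"
    and scaleC_one: "1 *\<^sub>C x = x"
    and mult_scaleC_left: "(a *\<^sub>C x) * y = a *\<^sub>C (x * y)"
    and mult_scaleC_right: "x * (a *\<^sub>C y) = a *\<^sub>C (x * y)"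

lemma vector_space_scaleC: "vector_space ((*\<^sub>C) :: complex \<Rightarrow> 'a::complex_algebra_1 \<Rightarrow> 'a)"
  by (unfold_locales) (simp_all add: scaleC_add_right scaleC_add_left scaleC_scaleC scaleC_one)

section \<open>The free algebra and two-sided ideals\<close>

text \<open>Words form the free monoid on the generators; the monoid is written additively, as
  required by the convolution product of \<^theory>\<open>HOL-Library.Poly_Mapping\<close>.\<close>

datatype word = Word (letters: "nat list")

instantiation word :: monoid_add
begin
definition "0 = Word []"
definition "v + w = Word (letters v @ letters w)"
instance by standard (simp_all add: zero_word_def plus_word_def)
end

type_synonym free_alg = "word \<Rightarrow>\<^sub>0 complex"

definition free_gen :: "nat \<Rightarrow> free_alg" where
  "free_gen i = Poly_Mapping.single (Word [i]) 1"

definition free_const :: "complex \<Rightarrow> free_alg" where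
  "free_const c = Poly_Mapping.single 0 c"

definition free_alg_on :: "nat set \<Rightarrow> free_alg set" where
  "free_alg_on S = {f. \<forall>w\<in>Poly_Mapping.keys f. set (letters w) \<subseteq> S}"

inductive_set two_sided_ideal :: "free_alg set \<Rightarrow> free_alg set \<Rightarrow> free_alg set"
  for F R :: "free_alg set" where
  zero: "0 \<in> two_sided_ideal F R"
| gen: "u \<in> F \<Longrightarrow> r \<in> R \<Longrightarrow> v \<in> F \<Longrightarrow> u * r * v \<in> two_sided_ideal F R"
| add: "f \<in> two_sided_ideal F R \<Longrightarrow> g \<in> two_sided_ideal F R \<Longrightarrow> f + g \<in> two_sided_ideal F R"

text \<open>Substitution of \<open>\<sigma> i\<close> for the \<open>i\<close>-th generator.\<close>

definition free_eval :: "(nat \<Rightarrow> 'a::complex_algebra_1) \<Rightarrow> free_alg \<Rightarrow> 'a" where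
  "free_eval \<sigma> f =
     (\<Sum>w\<in>Poly_Mapping.keys f. Poly_Mapping.lookup f w *\<^sub>C prod_list (map \<sigma> (letters w)))"

section \<open>The tower of Hecke algebras of type A\<close>

definition generic :: "complex \<Rightarrow> bool" where
  "generic q \<longleftrightarrow> q \<noteq> 0 \<and>
     (\<forall>k m :: int. m \<noteq> 0 \<longrightarrow> q \<noteq> exp (2 * of_real pi * \<i> * of_int k / of_int m))"

definition hecke_relators :: "complex \<Rightarrow> nat \<Rightarrow> free_alg set" where
  "hecke_relators q n =
     {free_gen i * free_gen (i+1) * free_gen i - free_gen (i+1) * free_gen i * free_gen (i+1)
        | i. 1 \<le> i \<and> i + 1 < n} \<union>
     {free_gen i * free_gen j - free_gen j * free_gen i
        | i j. i \<in> {1..<n} \<and> j \<in> {1..<n} \<and> \<bar>int i - int j\<bar> > 1} \<union>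
     {free_gen i * free_gen i - 1 - free_const (q - inverse q) * free_gen i | i. i \<in> {1..<n}}"

text \<open>\<open>hecke_alg \<sigma> n\<close> is the unital subalgebra generated by \<open>\<sigma> 1, \<dots>, \<sigma> (n - 1)\<close>.
  The predicate \<open>hecke_tower\<close> says that, for every \<open>n\<close>, this subalgebra is the algebra presented
  by these generators and the Hecke relations: all relations among the generators are
  consequences of the defining ones. Thus \<open>hecke_alg \<sigma> n\<close> is (a copy of) \<open>H\<^sub>n(q)\<close>, and the
  inclusions \<open>H\<^sub>n \<subset> H\<^bsub>n+1\<^esub>\<close> are inclusions of subsets of one ambient algebra. Nothing is
  assumed about elements of the ambient type that lie in no \<open>hecke_alg \<sigma> n\<close>.\<close>

definition hecke_alg :: "(nat \<Rightarrow> 'a::complex_algebra_1) \<Rightarrow> nat \<Rightarrow> 'a set" where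
  "hecke_alg \<sigma> n = free_eval \<sigma> ` free_alg_on {1..<n}"

definition hecke_tower :: "complex \<Rightarrow> (nat \<Rightarrow> 'a::complex_algebra_1) \<Rightarrow> bool" where
  "hecke_tower q \<sigma> \<longleftrightarrow>
     (\<forall>n. \<forall>f\<in>free_alg_on {1..<n}.
        free_eval \<sigma> f = 0 \<longleftrightarrow> f \<in> two_sided_ideal (free_alg_on {1..<n}) (hecke_relators q n))"

definition hecke_gen_inv :: "complex \<Rightarrow> (nat \<Rightarrow> 'a::complex_algebra_1) \<Rightarrow> nat \<Rightarrow> 'a" where
  "hecke_gen_inv q \<sigma> m = \<sigma> m - (q - inverse q) *\<^sub>C 1"

lemma free_eval_superset:
  assumes "finite A" "Poly_Mapping.keys f \<subseteq> A"
  shows "free_eval \<sigma> f = (\<Sum>w\<in>A. Poly_Mapping.lookup f w *\<^sub>C prod_list (map \<sigma> (letters w)))"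
proof -
  interpret vector_space "(*\<^sub>C) :: complex \<Rightarrow> 'a \<Rightarrow> 'a" by (rule vector_space_scaleC)
  show ?thesis
    unfolding free_eval_def using assms
    by (intro sum.mono_neutral_left) (auto simp: in_keys_iff)
qed

lemma free_eval_single:
  "free_eval \<sigma> (Poly_Mapping.single w c) = c *\<^sub>C prod_list (map \<sigma> (letters w))"
proof -
  have "free_eval \<sigma> (Poly_Mapping.single w c) =
      (\<Sum>v\<in>{w}. Poly_Mapping.lookup (Poly_Mapping.single w c) v *\<^sub>C prod_list (map \<sigma> (letters v)))"
    by (rule free_eval_superset) auto
  then show ?thesis by simp
qed

lemma free_eval_add: "free_eval \<sigma> (f + g) = free_eval \<sigma> f + free_eval \<sigma> g"
proof -
  let ?A = "Poly_Mapping.keys f \<union> Poly_Mapping.keys g"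
  have "Poly_Mapping.keys (f + g) \<subseteq> ?A" by (rule keys_add)
  then show ?thesis
    by (simp add: free_eval_superset[where A = ?A] lookup_add scaleC_add_left sum.distrib)
qed

lemma free_eval_diff: "free_eval \<sigma> (f - g) = free_eval \<sigma> f - free_eval \<sigma> g"
  using free_eval_add[of \<sigma> "f - g" g] by simp

lemma free_eval_mult: "free_eval \<sigma> (f * g) = free_eval \<sigma> f * free_eval \<sigma> g"
proof -
  have sum_single: "p = (\<Sum>w\<in>Poly_Mapping.keys p. Poly_Mapping.single w (Poly_Mapping.lookup p w))"
    for p :: free_alg
    by (rule poly_mapping_eqI) (auto simp: lookup_sum lookup_single when_def in_keys_iff sum.delta)
  have eval_sum: "free_eval \<sigma> (sum h A) = (\<Sum>a\<in>A. free_eval \<sigma> (h a))" if "finite A" for h and A :: "word set"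
    using that by (induction A) (simp_all add: free_eval_add, simp add: free_eval_def)
  have "f * g = (\<Sum>v\<in>Poly_Mapping.keys f. Poly_Mapping.single v (Poly_Mapping.lookup f v)) *
        (\<Sum>w\<in>Poly_Mapping.keys g. Poly_Mapping.single w (Poly_Mapping.lookup g w))"
    using sum_single[of f] sum_single[of g] by simp
  also have "free_eval \<sigma> \<dots> = (\<Sum>v\<in>Poly_Mapping.keys f. \<Sum>w\<in>Poly_Mapping.keys g.
        (Poly_Mapping.lookup f v * Poly_Mapping.lookup g w) *\<^sub>C
        (prod_list (map \<sigma> (letters v)) * prod_list (map \<sigma> (letters w))))"
    by (simp add: sum_product eval_sum mult_single free_eval_single plus_word_def)
  also have "\<dots> = free_eval \<sigma> f * free_eval \<sigma> g"
    by (simp add: free_eval_def sum_product mult_scaleC_left mult_scaleC_right scaleC_scaleC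
        mult.commute[where 'a = complex])
  finally show ?thesis .
qed

lemma free_eval_gen [simp]: "free_eval \<sigma> (free_gen i) = \<sigma> i"
  by (simp add: free_gen_def free_eval_single scaleC_one)

lemma free_eval_const [simp]: "free_eval \<sigma> (free_const c) = c *\<^sub>C 1"
  by (simp add: free_const_def free_eval_single zero_word_def)

lemma free_eval_one [simp]: "free_eval \<sigma> 1 = 1"
  using free_eval_const[of \<sigma> 1] by (simp add: free_const_def scaleC_one)

lemma hecke_relator_eval:
  assumes "hecke_tower q \<sigma>" "r \<in> free_alg_on {1..<n}" "r \<in> hecke_relators q n"
  shows "free_eval \<sigma> r = 0"
proof -
  have "1 \<in> free_alg_on {1..<n}" by (auto simp: free_alg_on_def zero_word_def)
  from two_sided_ideal.gen[OF this assms(3) this] assms(1,2) show ?thesis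
    by (simp add: hecke_tower_def)
qed

lemma free_alg_on_gen: "i \<in> S \<Longrightarrow> free_gen i \<in> free_alg_on S"
  by (simp add: free_alg_on_def free_gen_def)

lemma free_alg_on_const: "free_const c \<in> free_alg_on S"
  by (simp add: free_alg_on_def free_const_def zero_word_def)

lemma free_alg_on_one: "1 \<in> free_alg_on S"
  by (simp add: free_alg_on_def zero_word_def)

lemma free_alg_on_diff: "f \<in> free_alg_on S \<Longrightarrow> g \<in> free_alg_on S \<Longrightarrow> f - g \<in> free_alg_on S"
  using keys_diff[of f g] unfolding free_alg_on_def by blast

lemma free_alg_on_mult: "f \<in> free_alg_on S \<Longrightarrow> g \<in> free_alg_on S \<Longrightarrow> f * g \<in> free_alg_on S"
  using keys_mult[of f g] unfolding free_alg_on_def by (fastforce simp: plus_word_def)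

lemmas free_alg_on_intros =
  free_alg_on_gen free_alg_on_const free_alg_on_one free_alg_on_diff free_alg_on_mult

lemma hecke_braid:
  assumes "hecke_tower q \<sigma>" "i \<ge> 1"
  shows "\<sigma> i * \<sigma> (i+1) * \<sigma> i = \<sigma> (i+1) * \<sigma> i * \<sigma> (i+1)"
proof -
  let ?r = "free_gen i * free_gen (i+1) * free_gen i - free_gen (i+1) * free_gen i * free_gen (i+1)"
  have "?r \<in> hecke_relators q (i+2)" using assms(2) by (auto simp: hecke_relators_def)
  moreover have "?r \<in> free_alg_on {1..<i+2}" using assms(2) by (intro free_alg_on_intros) auto
  ultimately have "free_eval \<sigma> ?r = 0" using hecke_relator_eval[OF assms(1)] by blast
  then show ?thesis by (simp add: free_eval_diff free_eval_mult)
qed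

lemma hecke_commute:
  assumes "hecke_tower q \<sigma>" "i \<ge> 1" "j \<ge> 1" "\<bar>int i - int j\<bar> > 1"
  shows "\<sigma> i * \<sigma> j = \<sigma> j * \<sigma> i"
proof -
  let ?r = "free_gen i * free_gen j - free_gen j * free_gen i"
  have "?r \<in> hecke_relators q (i+j+1)" using assms(2-4) unfolding hecke_relators_def by force
  moreover have "?r \<in> free_alg_on {1..<i+j+1}" using assms(2,3) by (intro free_alg_on_intros) auto
  ultimately have "free_eval \<sigma> ?r = 0" using hecke_relator_eval[OF assms(1)] by blast
  then show ?thesis by (simp add: free_eval_diff free_eval_mult)
qed

lemma hecke_quadratic:
  assumes "hecke_tower q \<sigma>" "i \<ge> 1"
  shows "\<sigma> i * \<sigma> i - 1 = (q - inverse q) *\<^sub>C \<sigma> i"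
proof -
  let ?r = "free_gen i * free_gen i - 1 - free_const (q - inverse q) * free_gen i"
  have "?r \<in> hecke_relators q (i+1)" using assms(2) by (auto simp: hecke_relators_def)
  moreover have "?r \<in> free_alg_on {1..<i+1}" using assms(2) by (intro free_alg_on_intros) auto
  ultimately have "free_eval \<sigma> ?r = 0" using hecke_relator_eval[OF assms(1)] by blast
  then show ?thesis by (simp add: free_eval_diff free_eval_mult mult_scaleC_left)
qed

lemma hecke_gen_inv:
  assumes "hecke_tower q \<sigma>" "m \<ge> 1"
  shows "\<sigma> m * hecke_gen_inv q \<sigma> m = 1" "hecke_gen_inv q \<sigma> m * \<sigma> m = 1"
  using hecke_quadratic[OF assms]
  by (simp_all add: hecke_gen_inv_def right_diff_distrib left_diff_distrib
      mult_scaleC_left mult_scaleC_right diff_eq_eq add.commute)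

fun jucys_murphy :: "(nat \<Rightarrow> 'a::complex_algebra_1) \<Rightarrow> nat \<Rightarrow> 'a" where
  "jucys_murphy \<sigma> 0 = 1"  \<comment> \<open>unused: the elements are indexed from 1\<close>
| "jucys_murphy \<sigma> (Suc 0) = 1"
| "jucys_murphy \<sigma> (Suc (Suc i)) = \<sigma> (Suc i) * jucys_murphy \<sigma> (Suc i) * \<sigma> (Suc i)"

section \<open>Young diagrams and standard tableaux\<close>

text \<open>Nodes are pairs (row, column), both counted from 1.\<close>

definition young_diagram :: "(nat \<times> nat) set \<Rightarrow> bool" where
  "young_diagram lam \<longleftrightarrow> finite lam \<and>
     (\<forall>(r, c)\<in>lam. 1 \<le> r \<and> 1 \<le> c) \<and>
     (\<forall>(r, c)\<in>lam. \<forall>r' c'. 1 \<le> r' \<and> r' \<le> r \<and> 1 \<le> c' \<and> c' \<le> c \<longrightarrow> (r', c') \<in> lam)"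

definition hook_length :: "(nat \<times> nat) set \<Rightarrow> nat \<times> nat \<Rightarrow> nat" where
  "hook_length lam = (\<lambda>(r, c).
     card {(r', c'). (r', c') \<in> lam \<and> (r' = r \<and> c \<le> c' \<or> c' = c \<and> r \<le> r')})"

definition standard_tableau :: "(nat \<times> nat) set \<Rightarrow> (nat \<times> nat \<Rightarrow> nat) \<Rightarrow> bool" where
  "standard_tableau lam \<nu> \<longleftrightarrow>
     bij_betw \<nu> lam {1..card lam} \<and>
     (\<forall>r c c'. (r, c) \<in> lam \<and> (r, c') \<in> lam \<and> c < c' \<longrightarrow> \<nu> (r, c) < \<nu> (r, c')) \<and>
     (\<forall>r r' c. (r, c) \<in> lam \<and> (r', c) \<in> lam \<and> r < r' \<longrightarrow> \<nu> (r, c) < \<nu> (r', c))"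

definition node_content :: "complex \<Rightarrow> nat \<times> nat \<Rightarrow> complex" where
  "node_content q = (\<lambda>(r, c). q powi (2 * (int c - int r)))"

definition entry_content ::
    "complex \<Rightarrow> (nat \<times> nat) set \<Rightarrow> (nat \<times> nat \<Rightarrow> nat) \<Rightarrow> nat \<Rightarrow> complex" where
  "entry_content q lam \<nu> i = node_content q (inv_into lam \<nu> i)"

section \<open>Primitive idempotents\<close>

definition primitive_idempotent :: "'a::ring_1 set \<Rightarrow> 'a \<Rightarrow> bool" where
  "primitive_idempotent H e \<longleftrightarrow> e \<in> H \<and> e \<noteq> 0 \<and> e * e = e \<and>
     \<not> (\<exists>f\<in>H. \<exists>g\<in>H. f \<noteq> 0 \<and> g \<noteq> 0 \<and> f * f = f \<and> g * g = g \<and>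
          f * g = 0 \<and> g * f = 0 \<and> e = f + g)"

definition tableau_idempotent ::
    "complex \<Rightarrow> (nat \<Rightarrow> 'a::complex_algebra_1) \<Rightarrow> (nat \<times> nat) set \<Rightarrow> (nat \<times> nat \<Rightarrow> nat) \<Rightarrow> 'a \<Rightarrow> bool"
  where
  "tableau_idempotent q \<sigma> lam \<nu> e \<longleftrightarrow>
     primitive_idempotent (hecke_alg \<sigma> (card lam)) e \<and>
     (\<forall>i\<in>{1..card lam}.
        jucys_murphy \<sigma> i * e = entry_content q lam \<nu> i *\<^sub>C e \<and>
        e * jucys_murphy \<sigma> i = entry_content q lam \<nu> i *\<^sub>C e)"

section \<open>Ocneanu traces\<close>

text \<open>Powers \<open>q\<^sup>x\<close> with complex exponent use the principal logarithm of \<open>q\<close>. As \<open>q \<noteq> 1\<close>,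
  \<open>q powr d\<close> takes every nonzero value when \<open>d\<close> ranges over the complex numbers, so the choice
  of branch is only a choice of parametrisation.\<close>

definition qnum :: "complex \<Rightarrow> complex \<Rightarrow> complex" where
  "qnum q x = (q powr x - q powr (- x)) / (q - inverse q)"

definition z_param :: "complex \<Rightarrow> complex \<Rightarrow> complex" where
  "z_param q d = (1 - q powr (- 2 * d)) / (q - inverse q)"

text \<open>\<open>Tr m\<close> is the map from \<open>H\<^sub>m\<close> to \<open>H\<^bsub>m-1\<^esub>\<close> for \<open>m \<ge> 1\<close>; its values outside
  \<open>hecke_alg \<sigma> m\<close>, as well as \<open>Tr 0\<close>, are irrelevant.\<close>

definition ocneanu_maps ::
    "complex \<Rightarrow> complex \<Rightarrow> (nat \<Rightarrow> 'a::complex_algebra_1) \<Rightarrow> (nat \<Rightarrow> 'a \<Rightarrow> 'a) \<Rightarrow> bool" where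
  "ocneanu_maps q d \<sigma> Tr \<longleftrightarrow>
    (\<forall>m.
      (\<forall>Z\<in>hecke_alg \<sigma> (m+1). Tr (m+1) Z \<in> hecke_alg \<sigma> m) \<and>
      (\<forall>Z\<in>hecke_alg \<sigma> (m+1). \<forall>Z'\<in>hecke_alg \<sigma> (m+1). Tr (m+1) (Z + Z') = Tr (m+1) Z + Tr (m+1) Z') \<and>
      (\<forall>a. \<forall>Z\<in>hecke_alg \<sigma> (m+1). Tr (m+1) (a *\<^sub>C Z) = a *\<^sub>C Tr (m+1) Z) \<and>
      (\<forall>X\<in>hecke_alg \<sigma> m. Tr (m+1) X = z_param q d *\<^sub>C X) \<and>
      (\<forall>X\<in>hecke_alg \<sigma> m. \<forall>Y\<in>hecke_alg \<sigma> m. \<forall>Z\<in>hecke_alg \<sigma> (m+1).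
         Tr (m+1) (X * Z * Y) = X * Tr (m+1) Z * Y)) \<and>
    (\<forall>m\<ge>1.
      (\<forall>X\<in>hecke_alg \<sigma> m.
         Tr (m+1) (\<sigma> m * X * hecke_gen_inv q \<sigma> m) = Tr m X \<and>
         Tr (m+1) (hecke_gen_inv q \<sigma> m * X * \<sigma> m) = Tr m X) \<and>
      Tr (m+1) (\<sigma> m) = 1 \<and>
      (\<forall>Z\<in>hecke_alg \<sigma> (m+1). Tr m (Tr (m+1) (\<sigma> m * Z)) = Tr m (Tr (m+1) (Z * \<sigma> m))))"

text \<open>The composite \<open>Tr 1 \<circ> \<dots> \<circ> Tr m\<close>. Its values on \<open>H\<^sub>m\<close> lie in \<open>H\<^sub>0\<close>, which consists
  of the scalar multiples of \<open>1\<close>.\<close>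

primrec ocneanu_trace :: "(nat \<Rightarrow> 'a \<Rightarrow> 'a) \<Rightarrow> nat \<Rightarrow> 'a \<Rightarrow> 'a" where
  "ocneanu_trace Tr 0 X = X"
| "ocneanu_trace Tr (Suc m) X = ocneanu_trace Tr m (Tr (Suc m) X)"

end

theory Submission
  imports Defs
begin

text \<open>A vector \<open>w\<close> with \<open>y\<^sub>i w = a\<^sub>i w\<close> for the contents \<open>a\<^sub>i\<close> of a tableau of shape \<open>\<lambda>\<close> is
  annihilated by \<open>\<Prod>\<^sub>\<mu> (y\<^bsub>n+1\<^esub> - a\<^sub>\<mu>)\<close>, where \<open>\<mu>\<close> ranges over the addable boxes of \<open>\<lambda>\<close>. Hence Lagrange
  interpolation in \<open>y\<^sub>1, y\<^sub>2, \<dots>\<close> produces idempotents \<open>e\<^sub>T\<close> for all tableaux, which add up to \<open>1\<close>.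
  As \<open>H\<^bsub>n+1\<^esub> = H\<^sub>n + H\<^sub>n \<sigma>\<^sub>n H\<^sub>n\<close> and \<open>e\<^sub>T \<sigma>\<^sub>n e\<^sub>T\<close> is a polynomial in \<open>y\<^bsub>n+1\<^esub>\<close> times \<open>e\<^sub>T\<close>, each
  \<open>e\<^sub>T H\<^sub>n e\<^sub>T\<close> is one-dimensional, so the given idempotent is \<open>e\<^sub>T\<close>, and the partial trace of
  \<open>e\<^bsub>T\<union>\<mu>\<^esub>\<close> is \<open>c\<^sub>\<mu> e\<^sub>T\<close> for a scalar \<open>c\<^sub>\<mu>\<close>. Taking traces of \<open>e\<^sub>T\<close> and of \<open>e\<^sub>S \<sigma>\<^sub>n e\<^sub>S\<close> for the tableaux \<open>S\<close> of
  shape \<open>\<lambda>\<close> gives one linear equation for the \<open>c\<^sub>\<mu>\<close> and one for every removable box of \<open>\<lambda>\<close>. This is a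
  Cauchy system with as many equations as unknowns, and its solution is the ratio of the two hook
  products.\<close>

text \<open>No representation of the Hecke algebra is constructed, so nothing shows in advance that
  the e_T are nonzero. Spectral information therefore takes the form of annihilation statements,
  which also hold for the zero vector. Nonvanishing comes from the given idempotent alone: it turns
  out to be e_T, and e_T contains the idempotent of every initial part of T as a factor. The
  annihilating polynomial comes from the commutator of \<open>\<sigma> k\<close> and
  \<open>y k\<close>, which exchanges the eigenvalues of \<open>y k\<close> and
  \<open>y (Suc k)\<close> and whose square is a polynomial in the two. This yields surplus roots:
  the content a of the last box, which would create a Jordan block, and q^2 a or q^-2 a, which
  contradict the braid relation whenever the box with that content beside the last one is not
  addable. In the linear system the coefficients are diagonal entries of \<open>\<sigma> n\<close>,
  and the right-hand sides 1 come from the trace of \<open>\<sigma> n\<close>. Solving it by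
  interpolation uses one further fact: addable and removable boxes have the same product of
  contents, which settles the value at 0.\<close>

interpretation scaleC: vector_space "(*\<^sub>C) :: complex \<Rightarrow> 'a \<Rightarrow> 'a::complex_algebra_1"
  by (rule vector_space_scaleC)

section \<open>Polynomials in an algebra element\<close>

text \<open>Horner evaluation at an element of a noncommutative algebra: coefficients enter as
  multiples of 1, and \<open>y\<close> multiplies from the left.\<close>

definition poly_apply :: "complex poly \<Rightarrow> 'a \<Rightarrow> 'a::complex_algebra_1" where
  "poly_apply p y = fold_coeffs (\<lambda>a x. a *\<^sub>C 1 + y * x) p 0"

lemma poly_apply_0 [simp]: "poly_apply 0 y = 0"
  by (simp add: poly_apply_def)

lemma poly_apply_pCons [simp]: "poly_apply (pCons a p) y = a *\<^sub>C 1 + y * poly_apply p y"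
  by (cases "p = 0 \<and> a = 0") (auto simp: poly_apply_def)

lemma poly_apply_1 [simp]: "poly_apply 1 y = 1"
  by (simp add: one_pCons)

lemma poly_apply_add: "poly_apply (p + r) y = poly_apply p y + poly_apply r y"
  by (induction p r rule: poly_induct2) (auto simp: scaleC_add_left algebra_simps)

lemma poly_apply_smult: "poly_apply (smult a p) y = a *\<^sub>C poly_apply p y"
  by (induction p) (auto simp: scaleC_add_right scaleC_scaleC mult_scaleC_right)

lemma poly_apply_mult: "poly_apply (p * r) y = poly_apply p y * poly_apply r y"
  by (induction p) (auto simp: poly_apply_add poly_apply_smult mult_scaleC_left algebra_simps)

lemma poly_apply_sum: "poly_apply (sum f A) y = (\<Sum>x\<in>A. poly_apply (f x) y)"
  by (induction A rule: infinite_finite_induct) (auto simp: poly_apply_add)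

text \<open>Used in two ways: with \<open>y' = y\<close> it is plain commutation, and with an
  intertwiner as \<open>x\<close> it trades polynomials in one Jucys-Murphy element for polynomials
  in its neighbour.\<close>

lemma poly_apply_intertwine:
  assumes "y * x = x * y'"
  shows "poly_apply p y * x = x * poly_apply p y'"
proof (induction p)
  case (pCons a p)
  have "poly_apply (pCons a p) y * x = a *\<^sub>C x + y * (poly_apply p y * x)"
    by (simp add: algebra_simps mult_scaleC_left)
  also have "\<dots> = a *\<^sub>C x + (y * x) * poly_apply p y'"
    by (simp only: pCons.IH mult.assoc)
  also have "\<dots> = x * poly_apply (pCons a p) y'"
    by (simp add: assms algebra_simps mult_scaleC_right)
  finally show ?case .
qed simp

lemma poly_apply_eigen_left:
  assumes "y * w = a *\<^sub>C w"
  shows "poly_apply p y * w = poly p a *\<^sub>C w"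
proof (induction p)
  case (pCons c p)
  then show ?case
    by (simp add: algebra_simps mult_scaleC_left mult_scaleC_right assms scaleC_scaleC scaleC_add_left)
qed simp

lemma poly_apply_eigen_right:
  assumes "w * y = a *\<^sub>C w"
  shows "w * poly_apply p y = poly p a *\<^sub>C w"
proof (induction p)
  case (pCons c p)
  have "w * poly_apply (pCons c p) y = c *\<^sub>C w + (w * y) * poly_apply p y"
    by (simp add: algebra_simps mult_scaleC_right)
  also have "\<dots> = poly (pCons c p) a *\<^sub>C w"
    by (simp add: assms mult_scaleC_left pCons.IH scaleC_scaleC scaleC_add_left)
  finally show ?case .
qed simp

lemma poly_apply_linear [simp]: "poly_apply [:- a, 1:] y = y - a *\<^sub>C 1"
  by (simp add: scaleC.scale_minus_left)

section \<open>The subalgebras\<close>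

lemma free_alg_on_add: "f \<in> free_alg_on S \<Longrightarrow> g \<in> free_alg_on S \<Longrightarrow> f + g \<in> free_alg_on S"
  using keys_add[of f g] unfolding free_alg_on_def by blast

lemma hecke_alg_one [simp]: "1 \<in> hecke_alg \<sigma> n"
  unfolding hecke_alg_def using free_alg_on_one free_eval_one by (metis image_eqI)

lemma hecke_alg_add [intro]: "x \<in> hecke_alg \<sigma> n \<Longrightarrow> y \<in> hecke_alg \<sigma> n \<Longrightarrow> x + y \<in> hecke_alg \<sigma> n"
  unfolding hecke_alg_def by (auto simp: free_eval_add[symmetric] intro!: imageI free_alg_on_add)

lemma hecke_alg_mult [intro]: "x \<in> hecke_alg \<sigma> n \<Longrightarrow> y \<in> hecke_alg \<sigma> n \<Longrightarrow> x * y \<in> hecke_alg \<sigma> n"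
  unfolding hecke_alg_def by (auto simp: free_eval_mult[symmetric] intro!: imageI free_alg_on_mult)

lemma hecke_alg_scaleC [intro]: "x \<in> hecke_alg \<sigma> n \<Longrightarrow> a *\<^sub>C x \<in> hecke_alg \<sigma> n"
proof -
  assume "x \<in> hecke_alg \<sigma> n"
  then obtain f where f: "f \<in> free_alg_on {1..<n}" "x = free_eval \<sigma> f"
    by (auto simp: hecke_alg_def)
  have "a *\<^sub>C x = free_eval \<sigma> (free_const a * f)"
    by (simp add: free_eval_mult f mult_scaleC_left)
  then show ?thesis
    unfolding hecke_alg_def using f(1) free_alg_on_const free_alg_on_mult by blast
qed

lemma hecke_alg_zero [simp]: "0 \<in> hecke_alg \<sigma> n"
  using hecke_alg_scaleC[OF hecke_alg_one, of 0] by simp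

lemma hecke_alg_diff [intro]:
  assumes "x \<in> hecke_alg \<sigma> n" "y \<in> hecke_alg \<sigma> n"
  shows "x - y \<in> hecke_alg \<sigma> n"
  using hecke_alg_add[OF assms(1) hecke_alg_scaleC[OF assms(2), of "-1"]]
  by (simp add: scaleC.scale_minus_left scaleC_one)

lemma hecke_alg_sum: "(\<And>i. i \<in> A \<Longrightarrow> f i \<in> hecke_alg \<sigma> n) \<Longrightarrow> sum f A \<in> hecke_alg \<sigma> n"
  by (induction A rule: infinite_finite_induct) auto

lemma hecke_alg_gen: "1 \<le> i \<Longrightarrow> i < n \<Longrightarrow> \<sigma> i \<in> hecke_alg \<sigma> n"
  unfolding hecke_alg_def using free_alg_on_gen[of i "{1..<n}"] free_eval_gen[of \<sigma> i]
  by (metis atLeastLessThan_iff image_eqI)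

lemma hecke_alg_mono: "m \<le> n \<Longrightarrow> hecke_alg \<sigma> m \<subseteq> hecke_alg \<sigma> n"
  unfolding hecke_alg_def free_alg_on_def by (intro image_mono) force

lemma hecke_alg_poly_apply: "y \<in> hecke_alg \<sigma> n \<Longrightarrow> poly_apply p y \<in> hecke_alg \<sigma> n"
  by (induction p) (simp_all add: hecke_alg_add hecke_alg_scaleC hecke_alg_mult)

text \<open>Elements are linear combinations of words, and each word is built from 1 by multiplying
  generators on the left.\<close>

lemma hecke_alg_induct [consumes 1, case_names one add scale gen]:
  assumes "x \<in> hecke_alg \<sigma> n"
    and one: "P 1"
    and add: "\<And>x y. P x \<Longrightarrow> P y \<Longrightarrow> P (x + y)"
    and scale: "\<And>a x. P x \<Longrightarrow> P (a *\<^sub>C x)"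
    and gen: "\<And>i x. 1 \<le> i \<Longrightarrow> i < n \<Longrightarrow> P x \<Longrightarrow> P (\<sigma> i * x)"
  shows "P x"
proof -
  obtain f where f: "f \<in> free_alg_on {1..<n}" "x = free_eval \<sigma> f"
    using assms(1) by (auto simp: hecke_alg_def)
  have word: "P (prod_list (map \<sigma> l))" if "set l \<subseteq> {1..<n}" for l
    using that by (induction l) (auto intro: one gen)
  have "P 0" using scale[OF one, of 0] by simp
  then have "P (sum g A)" if "\<And>w. w \<in> A \<Longrightarrow> P (g w)" for g and A :: "word set"
    using that by (induction A rule: infinite_finite_induct) (auto intro: add)
  from this[where A = "Poly_Mapping.keys f"] show ?thesis
    unfolding f(2) free_eval_def using f(1) by (simp add: free_alg_on_def scale word)
qed

lemma hecke_alg_commute: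
  assumes "x \<in> hecke_alg \<sigma> n" and "\<And>i. 1 \<le> i \<Longrightarrow> i < n \<Longrightarrow> \<sigma> i * y = y * \<sigma> i"
  shows "x * y = y * x"
  using assms(1)
proof (induction rule: hecke_alg_induct)
  case (gen i x)
  have "\<sigma> i * x * y = (\<sigma> i * y) * x" by (simp add: mult.assoc gen)
  also have "\<dots> = y * (\<sigma> i * x)" using assms(2)[OF gen(1,2)] by (simp add: mult.assoc)
  finally show ?case .
qed (auto simp: algebra_simps mult_scaleC_left mult_scaleC_right)

lemma jucys_murphy_in_hecke_alg: "jucys_murphy \<sigma> i \<in> hecke_alg \<sigma> i"
proof (induction \<sigma> i rule: jucys_murphy.induct)
  case (3 \<sigma> i)
  then show ?case
    using hecke_alg_mono[of "Suc i" "Suc (Suc i)" \<sigma>]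
    by (auto intro!: hecke_alg_mult hecke_alg_gen)
qed auto

text \<open>For fixed m > 0 the numbers excluded by \<open>generic\<close> are exactly the m-th
  roots of unity; negative exponents reduce to positive ones by inversion.\<close>

lemma generic_powi_eq_1:
  assumes "generic q"
  shows "q powi k = 1 \<longleftrightarrow> k = 0"
proof -
  have q0: "q \<noteq> 0" using assms by (simp add: generic_def)
  have *: "q ^ m \<noteq> 1" if m: "m > 0" for m :: nat
  proof
    assume "q ^ m = 1"
    then have "q \<in> {z. z ^ m = 1}" by simp
    also have "{z. z ^ m = 1} = (\<lambda>k. exp (2 * of_real pi * \<i> * of_nat k / of_nat m)) ` {..<m}"
      using m complex_roots_unity[of m] by (auto simp: image_def)
    finally obtain k where "q = exp (2 * of_real pi * \<i> * of_int (int k) / of_int (int m))"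
      by auto
    then show False using assms m unfolding generic_def by (metis of_nat_0_less_iff less_irrefl)
  qed
  show ?thesis
  proof (cases "k \<ge> 0")
    case True
    then show ?thesis using *[of "nat k"] by (cases "k = 0") (auto simp: power_int_def)
  next
    case False
    then show ?thesis using *[of "nat (-k)"] by (auto simp: power_int_def field_simps q0)
  qed
qed

lemma generic_powi_inj:
  assumes "generic q"
  shows "q powi k = q powi l \<longleftrightarrow> k = l"
proof -
  have "q \<noteq> 0" using assms by (simp add: generic_def)
  then have "q powi k = q powi l \<longleftrightarrow> q powi (k - l) = 1"
    by (auto simp: power_int_diff)
  then show ?thesis using generic_powi_eq_1[OF assms] by simp
qed

section \<open>Jucys-Murphy elements and intertwiners\<close>

text \<open>\<open>L\<close> stands for \<open>\<kappa> *\<^sub>C 1\<close>, treated as a ring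
  element commuting with the others so that everything is a ring computation. By the equation for
  \<open>y * s\<close> in the proof, \<open>\<phi>\<close> is the commutator
  \<open>s * y - y * s\<close>, written with \<open>s\<close> on the left.\<close>

lemma ring_intertwiner:
  fixes s y Y L :: "'a::ring_1"
  assumes "s * s = 1 + L * s" "L * s = s * L" "L * y = y * L" "L * Y = Y * L"
    and "Y = s * y * s" "y * Y = Y * y"
  defines "\<phi> \<equiv> s * (y - Y) + L * Y"
  shows "y * \<phi> = \<phi> * Y" "Y * \<phi> = \<phi> * y" "\<phi> * \<phi> = L * L * (Y * y) - (Y - y) * (Y - y)"
proof -
  have L: "s * (L * x) = L * (s * x)" "y * (L * x) = L * (y * x)" "Y * (L * x) = L * (Y * x)" for x
    using assms(2-4) by (metis mult.assoc)+
  have L': "s * L = L * s" "y * L = L * y" "Y * L = L * Y"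
    using assms by auto
  have ss: "s * s = 1 + L * s" "s * (s * x) = x + L * (s * x)" for x
    using assms(1) by (simp, metis mult.assoc mult_1 distrib_right)
  have Ys: "Y * s = s * y + L * Y"
    by (simp add: assms(5) mult.assoc ss L distrib_left)
  have ys: "y * s = s * Y - L * Y"
    by (simp add: assms(5) mult.assoc ss L distrib_left)
  have comm: "y * Y = Y * y" "y * (Y * x) = Y * (y * x)" for x
    using assms(6) by (metis mult.assoc)+
  have R: "Y * (s * x) = s * (y * x) + L * (Y * x)" "y * (s * x) = s * (Y * x) - L * (Y * x)" for x
    using Ys ys by (metis (no_types, lifting) mult.assoc distrib_right left_diff_distrib)+
  \<comment> \<open>Normal form of words: powers of \<open>L\<close>, then at most one
    \<open>s\<close>, then powers of \<open>Y\<close>, then powers of \<open>y\<close>.\<close>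
  note rules = L L' ss Ys ys comm R mult.assoc distrib_left distrib_right left_diff_distrib
    right_diff_distrib
  show "y * \<phi> = \<phi> * Y"
    by (simp add: \<phi>_def rules)
  show "Y * \<phi> = \<phi> * y"
    by (simp add: \<phi>_def rules)
  show "\<phi> * \<phi> = L * L * (Y * y) - (Y - y) * (Y - y)"
    by (simp add: \<phi>_def rules)
qed

locale hecke =
  fixes q :: complex and \<sigma> :: "nat \<Rightarrow> 'a::complex_algebra_1"
  assumes generic: "generic q" and tower: "hecke_tower q \<sigma>"
begin

abbreviation "H \<equiv> hecke_alg \<sigma>"
abbreviation "y \<equiv> jucys_murphy \<sigma>"
abbreviation "\<kappa> \<equiv> q - inverse q"
abbreviation "ct \<equiv> node_content q"

lemma q_nonzero [simp]: "q \<noteq> 0"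
  using generic by (simp add: generic_def)

lemma gen_square: "i \<ge> 1 \<Longrightarrow> \<sigma> i * \<sigma> i = 1 + \<kappa> *\<^sub>C \<sigma> i"
  using hecke_quadratic[OF tower, of i] by (simp add: algebra_simps)

lemma gen_commute_alg:
  assumes "x \<in> H i" "i < k"
  shows "x * \<sigma> k = \<sigma> k * x"
  using assms(1)
proof (rule hecke_alg_commute)
  fix j assume "1 \<le> j" "j < i"
  then show "\<sigma> j * \<sigma> k = \<sigma> k * \<sigma> j"
    using assms(2) by (intro hecke_commute[OF tower]) auto
qed

lemma jm_Suc: "n \<ge> 1 \<Longrightarrow> y (Suc n) = \<sigma> n * y n * \<sigma> n"
  by (cases n) auto

lemma jm_commute_gen:
  assumes "1 \<le> i" "i < n"
  shows "\<sigma> i * y (Suc n) = y (Suc n) * \<sigma> i"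
  using assms
proof (induction n)
  case (Suc n)
  show ?case
  proof (cases "i < n")
    case True
    then have c: "\<sigma> i * \<sigma> (Suc n) = \<sigma> (Suc n) * \<sigma> i"
      using Suc.prems by (intro hecke_commute[OF tower]) auto
    have IH: "\<sigma> i * y (Suc n) = y (Suc n) * \<sigma> i" using Suc True by simp
    have "\<sigma> i * y (Suc (Suc n)) = (\<sigma> i * \<sigma> (Suc n)) * y (Suc n) * \<sigma> (Suc n)"
      by (simp add: mult.assoc)
    also have "\<dots> = \<sigma> (Suc n) * (\<sigma> i * y (Suc n)) * \<sigma> (Suc n)" by (simp add: c mult.assoc)
    also have "\<dots> = \<sigma> (Suc n) * y (Suc n) * (\<sigma> i * \<sigma> (Suc n))" by (simp add: IH mult.assoc)
    also have "\<dots> = y (Suc (Suc n)) * \<sigma> i" by (simp add: c mult.assoc)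
    finally show ?thesis .
  next
    case False
    then have i: "i = n" "n \<ge> 1" using Suc.prems by auto
    let ?s = "\<sigma> n" and ?t = "\<sigma> (Suc n)"
    have b: "?s * ?t * ?s = ?t * ?s * ?t" using hecke_braid[OF tower, of n] i by simp
    have c: "y n * ?t = ?t * y n"
      using gen_commute_alg[OF jucys_murphy_in_hecke_alg, of n "Suc n"] by simp
    have Y: "y (Suc (Suc n)) = ?t * ?s * y n * ?s * ?t"
      using jm_Suc[of n] i by (simp add: mult.assoc)
    have "?s * y (Suc (Suc n)) = (?s * ?t * ?s) * y n * ?s * ?t" by (simp only: Y mult.assoc)
    also have "\<dots> = ?t * ?s * (?t * y n) * ?s * ?t"
      unfolding b by (simp only: mult.assoc)
    also have "\<dots> = ?t * ?s * y n * (?t * ?s * ?t)"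
      unfolding c[symmetric] by (simp only: mult.assoc)
    also have "\<dots> = y (Suc (Suc n)) * ?s"
      unfolding b[symmetric] by (simp only: Y mult.assoc)
    finally show ?thesis using i by simp
  qed
qed simp

lemma jm_commute_alg: "x \<in> H n \<Longrightarrow> x * y (Suc n) = y (Suc n) * x"
  by (erule hecke_alg_commute) (rule jm_commute_gen)

lemma jm_commute:
  assumes "1 \<le> i" "1 \<le> j"
  shows "y i * y j = y j * y i"
proof -
  have *: "y i * y j = y j * y i" if "1 \<le> i" "i < j" for i j
  proof -
    from \<open>i < j\<close> obtain n where "j = Suc n" by (cases j) auto
    with that have n: "j = Suc n" "i \<le> n" by auto
    then have "y i \<in> H n"
      using jucys_murphy_in_hecke_alg[of \<sigma> i] hecke_alg_mono[of i n \<sigma>] by auto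
    then show ?thesis using jm_commute_alg n by simp
  qed
  show ?thesis using *[of i j] *[of j i] assms by (cases i j rule: linorder_cases) auto
qed

definition intertwiner :: "nat \<Rightarrow> 'a" where
  "intertwiner k = \<sigma> k * (y k - y (Suc k)) + \<kappa> *\<^sub>C y (Suc k)"

lemma intertwiner_props:
  assumes "k \<ge> 1"
  shows "y k * intertwiner k = intertwiner k * y (Suc k)"
    and "y (Suc k) * intertwiner k = intertwiner k * y k"
    and "intertwiner k * intertwiner k =
      (\<kappa> * \<kappa>) *\<^sub>C (y (Suc k) * y k) - (y (Suc k) - y k) * (y (Suc k) - y k)"
proof -
  let ?L = "\<kappa> *\<^sub>C (1::'a)"
  have L: "?L * x = \<kappa> *\<^sub>C x" "x * ?L = \<kappa> *\<^sub>C x" for x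
    by (simp_all add: mult_scaleC_left mult_scaleC_right)
  have i: "intertwiner k = \<sigma> k * (y k - y (Suc k)) + ?L * y (Suc k)"
    by (simp add: intertwiner_def L)
  note r = ring_intertwiner[of "\<sigma> k" ?L "y k" "y (Suc k)", folded i]
  have p: "\<sigma> k * \<sigma> k = 1 + ?L * \<sigma> k" "?L * \<sigma> k = \<sigma> k * ?L" "?L * y k = y k * ?L"
    "?L * y (Suc k) = y (Suc k) * ?L" "y (Suc k) = \<sigma> k * y k * \<sigma> k" "y k * y (Suc k) = y (Suc k) * y k"
    using gen_square[OF assms] jm_Suc[OF assms] jm_commute[of k "Suc k"] assms by (simp_all add: L)
  show "y k * intertwiner k = intertwiner k * y (Suc k)"
    using r(1)[OF p] .
  show "y (Suc k) * intertwiner k = intertwiner k * y k"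
    using r(2)[OF p] .
  show "intertwiner k * intertwiner k =
      (\<kappa> * \<kappa>) *\<^sub>C (y (Suc k) * y k) - (y (Suc k) - y k) * (y (Suc k) - y k)"
    using r(3)[OF p] by (simp add: L mult_scaleC_left scaleC_scaleC)
qed

lemma jm_in_alg: "i \<le> n \<Longrightarrow> y i \<in> H n"
  using jucys_murphy_in_hecke_alg[of \<sigma> i] hecke_alg_mono[of i n \<sigma>] by auto

lemma intertwiner_in_alg: "1 \<le> k \<Longrightarrow> k < n \<Longrightarrow> intertwiner k \<in> H n"
  unfolding intertwiner_def
  by (intro hecke_alg_add hecke_alg_mult hecke_alg_diff hecke_alg_scaleC jm_in_alg hecke_alg_gen) auto

lemma intertwiner_eigen:
  assumes "y k * w = a *\<^sub>C w" "y (Suc k) * w = b *\<^sub>C w"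
  shows "intertwiner k * w = (a - b) *\<^sub>C (\<sigma> k * w) + (\<kappa> * b) *\<^sub>C w"
proof -
  have "intertwiner k * w = \<sigma> k * (y k * w - y (Suc k) * w) + \<kappa> *\<^sub>C (y (Suc k) * w)"
    by (simp add: intertwiner_def algebra_simps mult_scaleC_left)
  then show ?thesis
    by (simp add: assms scaleC_scaleC mult_scaleC_right scaleC.scale_left_diff_distrib right_diff_distrib)
qed

text \<open>The scalar \<open>\<kappa> * \<kappa> * (a * b)\<close> minus the square of b - a
  factors. It vanishes exactly when b is q^2 a or q^-2 a, that is, for contents on neighbouring
  diagonals; otherwise the intertwiner is invertible on \<open>w\<close>.\<close>

lemma intertwiner_square_eigen:
  assumes "k \<ge> 1" "y k * w = a *\<^sub>C w" "y (Suc k) * w = b *\<^sub>C w"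
  shows "intertwiner k * (intertwiner k * w) = (- ((b - q^2 * a) * (b - inverse q ^ 2 * a))) *\<^sub>C w"
proof -
  have "intertwiner k * (intertwiner k * w) =
     ((\<kappa> * \<kappa>) *\<^sub>C (y (Suc k) * y k) - (y (Suc k) - y k) * (y (Suc k) - y k)) * w"
    by (simp add: mult.assoc[symmetric] intertwiner_props(3)[OF assms(1)])
  also have "\<dots> = (\<kappa> * \<kappa>) *\<^sub>C (y (Suc k) * (y k * w)) - y (Suc k) * (y (Suc k) * w)
      + y (Suc k) * (y k * w) + y k * (y (Suc k) * w) - y k * (y k * w)"
    by (simp add: algebra_simps mult_scaleC_left)
  also have "\<dots> = (\<kappa> * \<kappa> * (a * b)) *\<^sub>C w - (b * b) *\<^sub>C w + (a * b) *\<^sub>C w + (b * a) *\<^sub>C w - (a * a) *\<^sub>C w"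
    by (simp only: assms mult_scaleC_right scaleC_scaleC)
  also have "\<dots> = (\<kappa> * \<kappa> * (a * b) - b * b + a * b + b * a - a * a) *\<^sub>C w"
    by (simp only: scaleC.scale_left_diff_distrib scaleC_add_left)
  also have "\<kappa> * \<kappa> * (a * b) - b * b + a * b + b * a - a * a = - ((b - q^2 * a) * (b - inverse q ^ 2 * a))"
    by (simp add: field_simps power2_eq_square)
  finally show ?thesis .
qed

text \<open>\<open>H\<^bsub>n+1\<^esub> = H\<^sub>n + H\<^sub>n \<sigma>\<^sub>n H\<^sub>n\<close> as an induction principle.\<close>

inductive_set bimod :: "nat \<Rightarrow> 'a set" for n where
  base: "x \<in> H n \<Longrightarrow> x \<in> bimod n"
| sandwich: "n \<ge> 1 \<Longrightarrow> x \<in> H n \<Longrightarrow> x' \<in> H n \<Longrightarrow> x * \<sigma> n * x' \<in> bimod n"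
| add: "x \<in> bimod n \<Longrightarrow> x' \<in> bimod n \<Longrightarrow> x + x' \<in> bimod n"

lemma bimod_scaleC: "x \<in> bimod n \<Longrightarrow> a *\<^sub>C x \<in> bimod n"
proof (induction rule: bimod.induct)
  case (sandwich x x')
  then have "(a *\<^sub>C x) * \<sigma> n * x' \<in> bimod n" by (intro bimod.sandwich) auto
  then show ?case by (simp add: mult_scaleC_left)
qed (auto intro: bimod.intros simp: scaleC_add_right)

lemma bimod_mult:
  assumes "x \<in> bimod n" "u \<in> H n" "v \<in> H n"
  shows "u * x * v \<in> bimod n"
  using assms(1)
proof (induction rule: bimod.induct)
  case (base x)
  then show ?case using assms by (intro bimod.base) auto
next
  case (sandwich x x')
  have "(u * x) * \<sigma> n * (x' * v) \<in> bimod n"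
    using sandwich assms by (intro bimod.sandwich) auto
  then show ?case by (simp add: mult.assoc)
next
  case (add x x')
  then show ?case using bimod.add by (auto simp: algebra_simps)
qed

text \<open>It suffices that the right-hand side is stable under left multiplication by generators.
  For the newest generator t the critical products are \<open>t * x * t\<close> with
  \<open>x\<close> in \<open>H (Suc n)\<close>. The induction hypothesis splits \<open>x\<close>, t
  commutes with \<open>H n\<close>, and the quadratic or the braid relation leaves at most one t in
  each term.\<close>

lemma alg_Suc_subset_bimod: "H (Suc n) \<subseteq> bimod n"
proof (induction n)
  case 0
  have "x \<in> bimod 0" if "x \<in> H (Suc 0)" for x
    using that by (induction rule: hecke_alg_induct) (auto intro: bimod.intros bimod_scaleC)
  then show ?case by blast
next
  case (Suc n)
  let ?s = "\<sigma> n" and ?t = "\<sigma> (Suc n)"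
  have sub: "H n \<subseteq> H (Suc n)" by (rule hecke_alg_mono) simp
  have core: "?t * x * ?t \<in> bimod (Suc n)" if "x \<in> bimod n" for x
    using that
  proof (induction rule: bimod.induct)
    case (base x)
    have "?t * x * ?t = x * (?t * ?t)"
      using gen_commute_alg[OF base, of "Suc n"] by (simp add: mult.assoc[symmetric])
    also have "\<dots> = x + \<kappa> *\<^sub>C (x * ?t * 1)"
      by (simp add: gen_square distrib_left mult_scaleC_right)
    also have "\<dots> \<in> bimod (Suc n)"
      using base sub by (intro bimod.add bimod_scaleC bimod.sandwich bimod.base) auto
    finally show ?case .
  next
    case (sandwich x x')
    have b: "?s * ?t * ?s = ?t * ?s * ?t" using hecke_braid[OF tower, of n] sandwich by simp
    have "?t * (x * ?s * x') * ?t = (?t * x) * ?s * (x' * ?t)" by (simp add: mult.assoc)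
    also have "\<dots> = x * (?t * ?s * ?t) * x'"
      using gen_commute_alg[OF sandwich(2), of "Suc n"] gen_commute_alg[OF sandwich(3), of "Suc n"]
      by (metis lessI mult.assoc)
    also have "\<dots> = (x * ?s) * ?t * (?s * x')"
      unfolding b[symmetric] by (simp only: mult.assoc)
    also have "\<dots> \<in> bimod (Suc n)"
      using sandwich sub by (intro bimod.sandwich hecke_alg_mult hecke_alg_gen) auto
    finally show ?case .
  next
    case (add x x')
    then show ?case using bimod.add by (auto simp: algebra_simps)
  qed
  have left: "?t * x \<in> bimod (Suc n)" if "x \<in> bimod (Suc n)" for x
    using that
  proof (induction rule: bimod.induct)
    case (base x)
    then show ?case using bimod.sandwich[of "Suc n" 1 x] by simp
  next
    case (sandwich x x')
    then have "?t * x * ?t \<in> bimod (Suc n)" using Suc core by blast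
    from bimod_mult[OF this hecke_alg_one sandwich(3)] show ?case by (simp add: mult.assoc)
  next
    case (add x x')
    then show ?case using bimod.add by (auto simp: algebra_simps)
  qed
  have "x \<in> bimod (Suc n)" if "x \<in> H (Suc (Suc n))" for x
    using that
  proof (induction rule: hecke_alg_induct)
    case (gen i x)
    show ?case
    proof (cases "i = Suc n")
      case True
      then show ?thesis using left gen by simp
    next
      case False
      then have "\<sigma> i \<in> H (Suc n)" using gen by (intro hecke_alg_gen) auto
      from bimod_mult[OF gen(3) this hecke_alg_one] show ?thesis by simp
    qed
  qed (auto intro: bimod.intros bimod_scaleC)
  then show ?case by blast
qed

end

section \<open>Addable and removable boxes\<close>

definition addable :: "(nat \<times> nat) set \<Rightarrow> (nat \<times> nat) set" where
  "addable lam = {m. m \<notin> lam \<and> young_diagram (insert m lam)}"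

definition removable :: "(nat \<times> nat) set \<Rightarrow> (nat \<times> nat) set" where
  "removable lam = {m \<in> lam. young_diagram (lam - {m})}"

definition diag :: "nat \<times> nat \<Rightarrow> int" where
  "diag m = int (snd m) - int (fst m)"

lemma diag_pair [simp]: "diag (r, c) = int c - int r"
  by (simp add: diag_def)

lemma node_content_diag: "node_content q m = q powi (2 * diag m)"
  by (cases m) (simp add: node_content_def)

lemma young_empty [simp]: "young_diagram {}"
  by (simp add: young_diagram_def)

lemma young_finite: "young_diagram lam \<Longrightarrow> finite lam"
  by (simp add: young_diagram_def)

lemma young_pos: "young_diagram lam \<Longrightarrow> (r, c) \<in> lam \<Longrightarrow> 1 \<le> r \<and> 1 \<le> c"
  by (auto simp: young_diagram_def)

lemma young_down:
  "young_diagram lam \<Longrightarrow> (r, c) \<in> lam \<Longrightarrow> 1 \<le> r' \<Longrightarrow> r' \<le> r \<Longrightarrow> 1 \<le> c' \<Longrightarrow> c' \<le> c \<Longrightarrow> (r', c') \<in> lam"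
  unfolding young_diagram_def by fast

lemma addable_young: "m \<in> addable lam \<Longrightarrow> young_diagram (insert m lam)"
  by (simp add: addable_def)

lemma removable_young: "m \<in> removable lam \<Longrightarrow> young_diagram (lam - {m})"
  by (simp add: removable_def)

lemma addable_iff:
  assumes "young_diagram lam"
  shows "(r, c) \<in> addable lam \<longleftrightarrow>
    (r, c) \<notin> lam \<and> r \<ge> 1 \<and> c \<ge> 1 \<and> (r = 1 \<or> (r - 1, c) \<in> lam) \<and> (c = 1 \<or> (r, c - 1) \<in> lam)"
    (is "?L \<longleftrightarrow> ?R")
proof
  assume ?L
  then have n: "(r, c) \<notin> lam" and y: "young_diagram (insert (r, c) lam)"
    by (auto simp: addable_def)
  have "r \<ge> 1" "c \<ge> 1" using young_pos[OF y] by auto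
  moreover have "(r - 1, c) \<in> lam" if "r \<noteq> 1"
  proof -
    have "1 \<le> r - 1" "r - 1 \<le> r" "r - 1 \<noteq> r" using that \<open>r \<ge> 1\<close> by auto
    then show ?thesis using young_down[OF y, of r c "r - 1" c] \<open>c \<ge> 1\<close> by simp
  qed
  moreover have "(r, c - 1) \<in> lam" if "c \<noteq> 1"
  proof -
    have "1 \<le> c - 1" "c - 1 \<le> c" "c - 1 \<noteq> c" using that \<open>c \<ge> 1\<close> by auto
    then show ?thesis using young_down[OF y, of r c r "c - 1"] \<open>r \<ge> 1\<close> by simp
  qed
  ultimately show ?R using n by blast
next
  assume R: ?R
  have "(r', c') \<in> insert (r, c) lam"
    if b: "1 \<le> r'" "r' \<le> r" "1 \<le> c'" "c' \<le> c" for r' c'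
  proof (cases "r' = r")
    case True
    show ?thesis
    proof (cases "c' = c")
      case False
      then have "(r, c - 1) \<in> lam" using R b by auto
      from young_down[OF assms this, of r' c'] show ?thesis using b False True by auto
    qed (simp add: True)
  next
    case False
    then have "(r - 1, c) \<in> lam" using R b by auto
    from young_down[OF assms this, of r' c'] show ?thesis using b False by auto
  qed
  then have "young_diagram (insert (r, c) lam)"
    using assms R unfolding young_diagram_def by auto
  then show ?L using R by (simp add: addable_def)
qed

lemma removable_iff:
  assumes "young_diagram lam"
  shows "(r, c) \<in> removable lam \<longleftrightarrow> (r, c) \<in> lam \<and> (r + 1, c) \<notin> lam \<and> (r, c + 1) \<notin> lam"
    (is "?L \<longleftrightarrow> ?R")
proof
  assume ?L
  then have n: "(r, c) \<in> lam" and y: "young_diagram (lam - {(r, c)})"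
    by (auto simp: removable_def)
  have "1 \<le> r" "1 \<le> c" using young_pos[OF assms n] by auto
  then show ?R using n young_down[OF y, of "r + 1" c r c] young_down[OF y, of r "c + 1" r c] by auto
next
  assume R: ?R
  have "(r', c') \<in> lam - {(r, c)}"
    if m: "(i, j) \<in> lam" "(i, j) \<noteq> (r, c)" and b: "1 \<le> r'" "r' \<le> i" "1 \<le> c'" "c' \<le> j" for i j r' c'
  proof -
    have "(r', c') \<noteq> (r, c)"
    proof
      assume e: "(r', c') = (r, c)"
      then have "r + 1 \<le> i \<or> c + 1 \<le> j" using m(2) b by auto
      then show False
        using young_down[OF assms m(1), of "r + 1" c] young_down[OF assms m(1), of r "c + 1"] R e b by auto
    qed
    then show ?thesis using young_down[OF assms m(1) b] by simp
  qed
  then have "young_diagram (lam - {(r, c)})"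
    using assms unfolding young_diagram_def by blast
  then show ?L using R by (simp add: removable_def)
qed

lemma finite_addable:
  assumes "young_diagram lam"
  shows "finite (addable lam)"
proof (rule finite_subset)
  show "addable lam \<subseteq> insert (1, 1) ((\<lambda>(r, c). (r + 1, c)) ` lam \<union> (\<lambda>(r, c). (r, c + 1)) ` lam)"
  proof
    fix m assume "m \<in> addable lam"
    moreover obtain r c where m: "m = (r, c)" by (cases m)
    ultimately have R: "r \<ge> 1" "c \<ge> 1" "r = 1 \<or> (r - 1, c) \<in> lam" "c = 1 \<or> (r, c - 1) \<in> lam"
      by (auto simp: addable_iff[OF assms])
    consider "r = 1" "c = 1" | "(r - 1, c) \<in> lam" | "(r, c - 1) \<in> lam" using R by auto
    then show "m \<in> insert (1, 1) ((\<lambda>(r, c). (r + 1, c)) ` lam \<union> (\<lambda>(r, c). (r, c + 1)) ` lam)"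
    proof cases
      case 2
      then have "m \<in> (\<lambda>(r, c). (r + 1, c)) ` lam" using R m by (intro image_eqI[of _ _ "(r - 1, c)"]) auto
      then show ?thesis by blast
    next
      case 3
      then have "m \<in> (\<lambda>(r, c). (r, c + 1)) ` lam" using R m by (intro image_eqI[of _ _ "(r, c - 1)"]) auto
      then show ?thesis by blast
    qed (simp add: m)
  qed
  show "finite (insert (1, 1) ((\<lambda>(r, c). (r + 1, c)) ` lam \<union> (\<lambda>(r, c). (r, c + 1)) ` lam))"
    using young_finite[OF assms] by simp
qed

lemma finite_removable: "young_diagram lam \<Longrightarrow> finite (removable lam)"
  using young_finite by (auto simp: removable_def)

text \<open>A box weakly above and to the left of an addable box, and different from it, already
  belongs to the diagram.\<close>

lemma addable_order:
  assumes "young_diagram lam" "(r, c) \<in> addable lam" "(r', c') \<in> addable lam" "(r, c) \<noteq> (r', c')"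
  shows "r < r' \<and> c' < c \<or> r' < r \<and> c < c'"
proof -
  have *: False if "(r, c) \<in> addable lam" "(r', c') \<in> addable lam" "(r, c) \<noteq> (r', c')" "r \<le> r'" "c \<le> c'"
    for r c r' c'
    using young_down[OF addable_young[OF that(2)], of r' c' r c] that
    by (auto simp: addable_iff[OF assms(1)])
  show ?thesis using *[of r c r' c'] *[of r' c' r c] assms(2-4)
    by (metis le_cases not_le_imp_less prod.inject order.order_iff_strict)
qed

text \<open>Row and column change strictly and in opposite directions. The gap of two is what makes
  the intertwiner exchanging two addable boxes invertible.\<close>

lemma addable_diag_gap:
  assumes "young_diagram lam" "m \<in> addable lam" "m' \<in> addable lam" "m \<noteq> m'"
  shows "\<bar>diag m - diag m'\<bar> \<ge> 2"
  using addable_order[OF assms(1), of "fst m" "snd m" "fst m'" "snd m'"] assms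
  by (auto simp: diag_def prod_eq_iff)

lemma addable_diag_inj: "young_diagram lam \<Longrightarrow> inj_on diag (addable lam)"
  using addable_diag_gap by (fastforce intro: inj_onI)

text \<open>On a common diagonal the addable box would lie up-left of the removable one and so in
  the diagram, or down-right of it, and then the right neighbour of the removable box would be in
  the diagram.\<close>

lemma removable_addable_diag:
  assumes "young_diagram lam" "m \<in> removable lam" "m' \<in> addable lam"
  shows "diag m \<noteq> diag m'"
proof
  assume e: "diag m = diag m'"
  obtain r c r' c' where m: "m = (r, c)" "m' = (r', c')" by (cases m, cases m')
  have R: "(r, c) \<in> lam" "(r + 1, c) \<notin> lam" "(r, c + 1) \<notin> lam"
    using assms(2) by (auto simp: m removable_iff[OF assms(1)])
  have A: "(r', c') \<notin> lam" "r' \<ge> 1" "c' \<ge> 1" "r' = 1 \<or> (r' - 1, c') \<in> lam"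
    using assms(3) by (auto simp: m addable_iff[OF assms(1)])
  have p: "1 \<le> r" "1 \<le> c" using young_pos[OF assms(1) R(1)] by auto
  show False
  proof (cases "r' \<le> r")
    case True
    then have "c' \<le> c" using e m by auto
    then show False using young_down[OF assms(1) R(1), of r' c'] A True by auto
  next
    case False
    then have "c + 1 \<le> c'" "r \<le> r' - 1" "(r' - 1, c') \<in> lam" using e m A p by auto
    then show False using young_down[OF assms(1), of "r' - 1" c' r "c + 1"] R p by auto
  qed
qed

lemma removable_as_addable:
  "young_diagram lam \<Longrightarrow> m \<in> removable lam \<Longrightarrow> m \<in> addable (lam - {m})"
  by (auto simp: removable_def addable_def insert_absorb)

lemma addable_as_removable:
  "young_diagram lam \<Longrightarrow> m \<in> addable lam \<Longrightarrow> m \<in> removable (insert m lam)"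
  by (auto simp: removable_def addable_def)

lemma youngI:
  assumes "finite lam" "\<And>r c. (r, c) \<in> lam \<Longrightarrow> 1 \<le> r \<and> 1 \<le> c"
    and "\<And>r c r' c'. (r, c) \<in> lam \<Longrightarrow> 1 \<le> r' \<Longrightarrow> r' \<le> r \<Longrightarrow> 1 \<le> c' \<Longrightarrow> c' \<le> c \<Longrightarrow> (r', c') \<in> lam"
  shows "young_diagram lam"
  unfolding young_diagram_def
proof (intro conjI ballI)
  show "finite lam" by fact
  show "case m of (r, c) \<Rightarrow> 1 \<le> r \<and> 1 \<le> c" if "m \<in> lam" for m
    using that assms(2)[of "fst m" "snd m"] by (cases m) simp
  show "case m of (r, c) \<Rightarrow> \<forall>r' c'. 1 \<le> r' \<and> r' \<le> r \<and> 1 \<le> c' \<and> c' \<le> c \<longrightarrow> (r', c') \<in> lam" if "m \<in> lam" for m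
    using that assms(3)[of "fst m" "snd m"] by (cases m) simp
qed

lemma young_inter: "young_diagram A \<Longrightarrow> young_diagram B \<Longrightarrow> young_diagram (A \<inter> B)"
  by (rule youngI) (auto simp: young_finite dest: young_pos intro: young_down[of A] young_down[of B])

lemma young_Un: "young_diagram A \<Longrightarrow> young_diagram B \<Longrightarrow> young_diagram (A \<union> B)"
  by (rule youngI) (auto simp: young_finite dest: young_pos intro: young_down[of A] young_down[of B])

lemma addable_insert:
  assumes "m \<in> addable lam" "m' \<in> addable lam" "m \<noteq> m'"
  shows "m \<in> addable (insert m' lam)"
  using young_Un[OF addable_young[OF assms(1)] addable_young[OF assms(2)]] assms
  by (auto simp: addable_def insert_commute)

text \<open>The box above the new box and the box to its right share a diagonal, and exactly one of
  two things happens there: the former was removable before, or the latter becomes addable. The same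
  holds for the box to the left and the box below.\<close>

lemma addable_insert_sets:
  assumes y: "young_diagram lam" and k: "(r, c) \<in> addable lam"
  shows "addable (insert (r, c) lam) = (addable lam - {(r, c)})
      \<union> {m. m = (r, c + 1) \<and> (r = 1 \<or> (r - 1, c + 1) \<in> lam)}
      \<union> {m. m = (r + 1, c) \<and> (c = 1 \<or> (r + 1, c - 1) \<in> lam)}"
    and "removable (insert (r, c) lam) = insert (r, c) (removable lam - {(r - 1, c), (r, c - 1)})"
    and "(r - 1, c) \<in> removable lam \<longleftrightarrow> \<not> (r = 1 \<or> (r - 1, c + 1) \<in> lam)"
    and "(r, c - 1) \<in> removable lam \<longleftrightarrow> \<not> (c = 1 \<or> (r + 1, c - 1) \<in> lam)"
    and "(r, c + 1) \<notin> addable lam" "(r + 1, c) \<notin> addable lam" "(r, c + 1) \<notin> lam" "(r + 1, c) \<notin> lam"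
proof -
  have K: "(r, c) \<notin> lam" "r \<ge> 1" "c \<ge> 1" "r = 1 \<or> (r - 1, c) \<in> lam" "c = 1 \<or> (r, c - 1) \<in> lam"
    using k by (auto simp: addable_iff[OF y])
  note y' = addable_young[OF k]
  have R: "(r, c + 1) \<notin> lam" using young_down[OF y, of r "c + 1" r c] K by auto
  have B: "(r + 1, c) \<notin> lam" using young_down[OF y, of "r + 1" c r c] K by auto
  show "(r, c + 1) \<notin> lam" "(r + 1, c) \<notin> lam" by fact+
  show "(r, c + 1) \<notin> addable lam" "(r + 1, c) \<notin> addable lam"
    using addable_order[OF y k, of r "c + 1"] addable_order[OF y k, of "r + 1" c] by auto
  have iff: "(i, j) \<in> addable (insert (r, c) lam) \<longleftrightarrow>
     (i, j) \<in> addable lam - {(r, c)} \<or> (i, j) = (r, c + 1) \<and> (r = 1 \<or> (r - 1, c + 1) \<in> lam)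
     \<or> (i, j) = (r + 1, c) \<and> (c = 1 \<or> (r + 1, c - 1) \<in> lam)" for i j
  proof -
    consider "(i, j) = (r, c + 1)" | "(i, j) = (r + 1, c)"
      | "(i, j) \<noteq> (r, c + 1)" "(i, j) \<noteq> (r + 1, c)" by blast
    then show ?thesis
    proof cases
      case 3
      then have "i \<ge> 1 \<Longrightarrow> (i - 1, j) \<noteq> (r, c)" "j \<ge> 1 \<Longrightarrow> (i, j - 1) \<noteq> (r, c)" by auto
      then show ?thesis unfolding addable_iff[OF y'] Diff_iff addable_iff[OF y] using 3 by blast
    next
      case 1
      then have "i = r" "j = c + 1" by auto
      moreover have "(r - 1, c + 1) \<noteq> (r, c)" by auto
      ultimately show ?thesis
        unfolding addable_iff[OF y'] Diff_iff addable_iff[OF y] using R K by auto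
    next
      case 2
      then have "i = r + 1" "j = c" by auto
      moreover have "(r + 1, c - 1) \<noteq> (r, c)" by auto
      ultimately show ?thesis
        unfolding addable_iff[OF y'] Diff_iff addable_iff[OF y] using B K by auto
    qed
  qed
  then show "addable (insert (r, c) lam) = (addable lam - {(r, c)})
      \<union> {m. m = (r, c + 1) \<and> (r = 1 \<or> (r - 1, c + 1) \<in> lam)}
      \<union> {m. m = (r + 1, c) \<and> (c = 1 \<or> (r + 1, c - 1) \<in> lam)}"
    by (auto simp del: One_nat_def)
  have "(i, j) \<in> removable (insert (r, c) lam) \<longleftrightarrow>
      (i, j) \<in> insert (r, c) (removable lam - {(r - 1, c), (r, c - 1)})" for i j
  proof (cases "(i, j) \<in> lam")
    case True
    then have p: "1 \<le> i" "1 \<le> j" using young_pos[OF y] by blast+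
    have "(i + 1, j) = (r, c) \<longleftrightarrow> (i, j) = (r - 1, c)" "(i, j + 1) = (r, c) \<longleftrightarrow> (i, j) = (r, c - 1)"
      using p K by auto
    moreover have "(i, j) \<noteq> (r, c)" using True K by auto
    ultimately show ?thesis using True by (auto simp: removable_iff[OF y'] removable_iff[OF y])
  next
    case False
    then show ?thesis using R B by (auto simp: removable_iff[OF y'] removable_iff[OF y])
  qed
  then show "removable (insert (r, c) lam) = insert (r, c) (removable lam - {(r - 1, c), (r, c - 1)})"
    by (auto simp del: One_nat_def)
  \<comment> \<open>For \<open>r = 1\<close> or \<open>c = 1\<close> the truncated difference is 0,
    which is not a coordinate of any box.\<close>
  have z: "(0, j) \<notin> lam" "(j, 0) \<notin> lam" for j using young_pos[OF y] by force+
  show "(r - 1, c) \<in> removable lam \<longleftrightarrow> \<not> (r = 1 \<or> (r - 1, c + 1) \<in> lam)"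
    "(r, c - 1) \<in> removable lam \<longleftrightarrow> \<not> (c = 1 \<or> (r + 1, c - 1) \<in> lam)"
    using K z by (auto simp: removable_iff[OF y])
qed

text \<open>With \<open>g\<close> ranging over functions of the diagonal, this says that the multiset of diagonals of
  addable boxes minus that of removable boxes changes by \<open>- 2 [k] + [k + 1] + [k - 1]\<close> when a box
  on the diagonal \<open>k\<close> is added.\<close>

lemma corner_product:
  fixes g :: "int \<Rightarrow> 'b::comm_monoid_mult"
  assumes y: "young_diagram lam" and k: "m \<in> addable lam"
  shows "(\<Prod>x\<in>removable (insert m lam). g (diag x)) * (\<Prod>x\<in>addable lam. g (diag x)) *
           (g (diag m + 1) * g (diag m - 1)) =
         (\<Prod>x\<in>removable lam. g (diag x)) * (\<Prod>x\<in>addable (insert m lam). g (diag x)) *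
           (g (diag m) * g (diag m))"
proof -
  obtain r c where m: "m = (r, c)" by (cases m)
  note k = k[unfolded m]
  have K: "(r, c) \<notin> lam" "r \<ge> 1" "c \<ge> 1" "(r, c) \<notin> removable lam"
    using k by (auto simp: addable_iff[OF y] removable_def)
  define P where "P \<longleftrightarrow> r = 1 \<or> (r - 1, c + 1) \<in> lam"
  define Q where "Q \<longleftrightarrow> c = 1 \<or> (r + 1, c - 1) \<in> lam"
  note S = addable_insert_sets[OF y k, folded P_def Q_def]
  note fin = finite_addable[OF y] finite_removable[OF y]
  let ?A = "\<Prod>x\<in>addable lam - {(r, c)}. g (diag x)"
  let ?R = "\<Prod>x\<in>removable lam - {(r - 1, c), (r, c - 1)}. g (diag x)"
  have A: "(\<Prod>x\<in>addable lam. g (diag x)) = g (diag m) * ?A"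
    using prod.remove[OF fin(1) k, of "\<lambda>x. g (diag x)"] m by simp
  have A': "(\<Prod>x\<in>addable (insert m lam). g (diag x)) =
      ?A * (if P then g (diag m + 1) else 1) * (if Q then g (diag m - 1) else 1)"
    unfolding m S(1) using fin S(5,6) by (simp add: prod.union_disjoint algebra_simps)
  have R': "(\<Prod>x\<in>removable (insert m lam). g (diag x)) = g (diag m) * ?R"
    unfolding m S(2) using fin K by simp
  have R: "(\<Prod>x\<in>removable lam. g (diag x)) =
      ?R * (if P then 1 else g (diag m + 1)) * (if Q then 1 else g (diag m - 1))"
  proof -
    have d: "diag (r - 1, c) = diag m + 1" "diag (r, c - 1) = diag m - 1" using K m by auto
    have "removable lam = (removable lam - {(r - 1, c), (r, c - 1)}) \<union>
        ({x. x = (r - 1, c) \<and> \<not> P} \<union> {x. x = (r, c - 1) \<and> \<not> Q})"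
      using S(3,4) by auto
    then have "(\<Prod>x\<in>removable lam. g (diag x)) =
      (\<Prod>x\<in>(removable lam - {(r - 1, c), (r, c - 1)}) \<union>
        ({x. x = (r - 1, c) \<and> \<not> P} \<union> {x. x = (r, c - 1) \<and> \<not> Q}). g (diag x))"
      by simp
    also have "\<dots> = ?R * ((\<Prod>x\<in>{x. x = (r - 1, c) \<and> \<not> P}. g (diag x)) *
        (\<Prod>x\<in>{x. x = (r, c - 1) \<and> \<not> Q}. g (diag x)))"
      using fin K by (subst prod.union_disjoint; auto)+
    also have "\<dots> = ?R * ((if P then 1 else g (diag m + 1)) * (if Q then 1 else g (diag m - 1)))"
      by (cases P; cases Q) (simp_all add: d del: diag_pair One_nat_def)
    finally show ?thesis by (simp add: mult.assoc)
  qed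
  show ?thesis unfolding A A' R R' by (simp add: ac_simps)
qed

lemma addable_empty: "addable {} = {(1, 1)}"
  using addable_iff[OF young_empty] by auto

section \<open>Paths in Young's lattice\<close>

text \<open>The list of the boxes of a standard tableau, the box with the largest entry first.\<close>

primrec young_path :: "(nat \<times> nat) list \<Rightarrow> bool" where
  "young_path [] \<longleftrightarrow> True"
| "young_path (m # T) \<longleftrightarrow> young_path T \<and> m \<in> addable (set T)"

lemma young_path_young: "young_path T \<Longrightarrow> young_diagram (set T)"
  by (induction T) (auto simp: addable_young)

lemma young_path_card: "young_path T \<Longrightarrow> card (set T) = length T"
  by (induction T) (auto simp: addable_def)

lemma young_diagram_induct [consumes 1, case_names empty insert]:
  assumes "young_diagram lam" "P {}"
    and step: "\<And>lam m. young_diagram lam \<Longrightarrow> m \<in> addable lam \<Longrightarrow> P lam \<Longrightarrow> P (insert m lam)"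
  shows "P lam"
  using assms(1)
proof (induction "card lam" arbitrary: lam)
  case 0
  then show ?case using assms(2) young_finite by force
next
  case (Suc n)
  then have "lam \<noteq> {}" by auto
  \<comment> \<open>A box with the largest coordinate sum is removable, since its right and lower
    neighbours have a larger sum.\<close>
  define f :: "nat \<times> nat \<Rightarrow> nat" where "f = (\<lambda>x. fst x + snd x)"
  have fin: "finite (f ` lam)" "f ` lam \<noteq> {}" using young_finite[OF Suc.prems] \<open>lam \<noteq> {}\<close> by auto
  obtain m where m1: "m \<in> lam" "f m = Max (f ` lam)" using Max_in[OF fin] by (metis imageE)
  have m: "m \<in> lam" "\<And>x. x \<in> lam \<Longrightarrow> fst x + snd x \<le> fst m + snd m"
    using m1 Max_ge[OF fin(1)] by (auto simp: f_def)
  then have "m \<in> removable lam"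
    using m(2)[of "(fst m + 1, snd m)"] m(2)[of "(fst m, snd m + 1)"]
    by (cases m) (auto simp: removable_iff[OF Suc.prems])
  then have *: "m \<in> addable (lam - {m})" "young_diagram (lam - {m})" "insert m (lam - {m}) = lam"
    using removable_as_addable[OF Suc.prems] removable_young m(1) by auto
  have "P (lam - {m})" using Suc *(2) m(1) young_finite[OF Suc.prems] by auto
  from step[OF *(2,1) this] show ?case using *(3) by simp
qed

text \<open>For the constant function 2, \<open>corner_product\<close> is an equation between powers
  of 2, and comparing exponents shows that adding a box changes both counts by the same
  amount.\<close>

lemma corner_counts:
  assumes "young_diagram lam"
  shows "card (addable lam) = card (removable lam) + 1"
  using assms
proof (induction rule: young_diagram_induct)
  case empty
  then show ?case by (simp add: addable_empty removable_def)
next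
  case (insert lam m)
  have "(2::nat) ^ (card (removable (insert m lam)) + card (addable lam) + 2) =
        2 ^ (card (removable lam) + card (addable (insert m lam)) + 2)"
    using corner_product[OF insert(1,2), of "\<lambda>_. 2::nat"] by (simp add: power_add)
  then have "card (removable (insert m lam)) + card (addable lam) + 2 =
        card (removable lam) + card (addable (insert m lam)) + 2"
    by (subst (asm) power_inject_exp) auto
  then show ?case using insert(3) by simp
qed

text \<open>A geometric progression \<open>g\<close> cancels the second difference in
  \<open>corner_product\<close>. For g j = q^(2j), where g 0 = 1, this equates the products of the
  contents of the addable and of the removable boxes.\<close>

lemma corner_product_eq:
  fixes g :: "int \<Rightarrow> 'b::field"
  assumes "young_diagram lam" and g: "\<And>j. g j \<noteq> 0" "\<And>k. g (k + 1) * g (k - 1) = g k * g k"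
  shows "(\<Prod>x\<in>addable lam. g (diag x)) = g 0 * (\<Prod>x\<in>removable lam. g (diag x))"
  using assms(1)
proof (induction rule: young_diagram_induct)
  case empty
  then show ?case by (simp add: addable_empty removable_def)
next
  case (insert lam m)
  let ?A = "\<lambda>l. \<Prod>x\<in>addable l. g (diag x)" and ?R = "\<lambda>l. \<Prod>x\<in>removable l. g (diag x)"
  have R: "?R lam \<noteq> 0"
    using g(1) finite_removable[OF insert(1)] by simp
  have "?R (insert m lam) * ?A lam = ?R lam * ?A (insert m lam)"
    using corner_product[OF insert(1,2), of g] g by simp
  then have "?R lam * ?A (insert m lam) = ?R (insert m lam) * (g 0 * ?R lam)"
    unfolding insert(3) by (rule sym)
  also have "\<dots> = ?R lam * (g 0 * ?R (insert m lam))"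
    by (simp only: mult_ac)
  finally have "?R lam * ?A (insert m lam) = ?R lam * (g 0 * ?R (insert m lam))" .
  with R show ?case by (metis mult_left_cancel)
qed

context hecke
begin

section \<open>The spectrum of the Jucys-Murphy elements\<close>

lemma ct_nonzero [simp]: "ct m \<noteq> 0"
  by (simp add: node_content_diag)

lemma ct_eq_iff: "ct m = ct m' \<longleftrightarrow> diag m = diag m'"
  by (simp add: node_content_diag generic_powi_inj[OF generic])

lemma ct_shift:
  "diag m' = diag m + 1 \<Longrightarrow> ct m' = q\<^sup>2 * ct m"
  "diag m' = diag m - 1 \<Longrightarrow> ct m' = (inverse q)\<^sup>2 * ct m"
proof -
  assume "diag m' = diag m + 1"
  then have "2 * diag m' = 2 + 2 * diag m" by simp
  then show "ct m' = q\<^sup>2 * ct m"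
    using power_int_add[of q 2 "2 * diag m"] by (simp add: node_content_diag)
next
  assume "diag m' = diag m - 1"
  then have "2 * diag m' = - 2 + 2 * diag m" by simp
  then show "ct m' = (inverse q)\<^sup>2 * ct m"
    using power_int_add[of q "- 2" "2 * diag m"]
    by (simp add: node_content_diag power_int_minus power_inverse)
qed

lemma kappa_nonzero [simp]: "\<kappa> \<noteq> 0"
proof
  assume "\<kappa> = 0"
  then have "q powi 2 = 1" by (simp add: field_simps power2_eq_square)
  then show False using generic_powi_eq_1[OF generic, of 2] by simp
qed

lemma inj_on_ct_addable: "young_diagram lam \<Longrightarrow> inj_on ct (addable lam)"
  using addable_diag_inj by (auto simp: inj_on_def ct_eq_iff)

text \<open>The head of the list is the last box, so it goes with the largest index.
  \<open>w\<close> may be zero, which permits statements about all \<open>w\<close> before any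
  eigenvector is known to exist.\<close>

primrec eig :: "(nat \<times> nat) list \<Rightarrow> 'a \<Rightarrow> bool" where
  "eig [] w \<longleftrightarrow> True"
| "eig (m # T) w \<longleftrightarrow> eig T w \<and> y (Suc (length T)) * w = ct m *\<^sub>C w"

lemma eig_commute:
  assumes "eig T w" "\<And>j. 1 \<le> j \<Longrightarrow> j \<le> length T \<Longrightarrow> x * y j = y j * x"
  shows "eig T (x * w)"
  using assms
proof (induction T)
  case (Cons m T)
  have "y (Suc (length T)) * (x * w) = x * (y (Suc (length T)) * w)"
    using Cons.prems(2)[of "Suc (length T)"] by (simp add: mult.assoc[symmetric])
  then show ?case using Cons by (simp add: mult_scaleC_right)
qed simp

lemma eig_mult_right: "eig T w \<Longrightarrow> eig T (w * x)"
  by (induction T) (simp_all add: mult.assoc[symmetric] mult_scaleC_left)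

lemma commute_alg_jm: "x \<in> H n \<Longrightarrow> j > n \<Longrightarrow> x * y j = y j * x"
  using jm_commute_alg[of x "j - 1"] hecke_alg_mono[of n "j - 1" \<sigma>] by (cases j) auto

lemma intertwiner_commute_jm:
  assumes "1 \<le> j" "j < k"
  shows "intertwiner k * y j = y j * intertwiner k"
proof -
  have \<sigma>: "y j * \<sigma> k = \<sigma> k * y j"
    using gen_commute_alg[OF jm_in_alg, of j j k] assms by simp
  have c: "y j * y k = y k * y j" "y j * y (Suc k) = y (Suc k) * y j"
    using jm_commute assms by auto
  have "intertwiner k * y j = \<sigma> k * ((y k - y (Suc k)) * y j) + \<kappa> *\<^sub>C (y (Suc k) * y j)"
    by (simp only: intertwiner_def distrib_right mult_scaleC_left mult.assoc)
  also have "(y k - y (Suc k)) * y j = y j * (y k - y (Suc k))"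
    by (simp only: left_diff_distrib right_diff_distrib c)
  also have "\<sigma> k * (y j * (y k - y (Suc k))) + \<kappa> *\<^sub>C (y (Suc k) * y j) = y j * intertwiner k"
    by (simp only: intertwiner_def distrib_left mult_scaleC_right mult.assoc[symmetric] \<sigma> c)
  finally show ?thesis .
qed

section \<open>Annihilating polynomials and transport between tableaux\<close>

definition add_poly :: "(nat \<times> nat) set \<Rightarrow> complex poly" where
  "add_poly lam = (\<Prod>m\<in>addable lam. [:- ct m, 1:])"

lemma poly_add_poly: "poly (add_poly lam) a = (\<Prod>m\<in>addable lam. a - ct m)"
  by (simp add: add_poly_def poly_prod)

text \<open>Only annihilation is meant: the roots bound the spectrum, and none of them is claimed to
  occur.\<close>

definition minpoly :: "(nat \<times> nat) list \<Rightarrow> bool" where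
  "minpoly T \<longleftrightarrow>
     (\<forall>w. eig T w \<longrightarrow> poly_apply (add_poly (set T)) (y (Suc (length T))) * w = 0)"

text \<open>Transport between eigenspaces, invertible from the left. One pair \<open>x\<close>,
  \<open>x'\<close> serves all \<open>w\<close> and lies in \<open>H (length T)\<close>; hence it
  commutes with the next Jucys-Murphy element, and a link survives adding a common box.\<close>

definition link :: "(nat \<times> nat) list \<Rightarrow> (nat \<times> nat) list \<Rightarrow> bool" where
  "link T S \<longleftrightarrow> length S = length T \<and>
     (\<exists>x\<in>H (length T). \<exists>x'\<in>H (length T). \<forall>w. eig T w \<longrightarrow> eig S (x * w) \<and> x' * (x * w) = w)"

lemma link_refl: "link T T"
  unfolding link_def by (intro conjI bexI[of _ 1] allI) auto

lemma link_trans: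
  assumes "link T S" "link S U"
  shows "link T U"
proof -
  obtain x x' where x: "x \<in> H (length T)" "x' \<in> H (length T)"
    "\<And>w. eig T w \<Longrightarrow> eig S (x * w) \<and> x' * (x * w) = w" and l: "length S = length T"
    using assms(1) by (auto simp: link_def)
  obtain z z' where z: "z \<in> H (length T)" "z' \<in> H (length T)"
    "\<And>w. eig S w \<Longrightarrow> eig U (z * w) \<and> z' * (z * w) = w" and l': "length U = length T"
    using assms(2) l by (auto simp: link_def)
  have "eig U (z * x * w) \<and> x' * z' * (z * x * w) = w" if "eig T w" for w
    using x(3)[OF that] z(3)[of "x * w"] by (simp add: mult.assoc)
  then show ?thesis unfolding link_def using l' x z by blast
qed

lemma link_Cons:
  assumes "link T S"
  shows "link (m # T) (m # S)"
proof -
  obtain x x' where x: "x \<in> H (length T)" "x' \<in> H (length T)"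
    "\<And>w. eig T w \<Longrightarrow> eig S (x * w) \<and> x' * (x * w) = w" and l: "length S = length T"
    using assms(1) by (auto simp: link_def)
  have c: "x * y (Suc (length T)) = y (Suc (length T)) * x" by (rule jm_commute_alg[OF x(1)])
  have "eig (m # S) (x * w) \<and> x' * (x * w) = w" if "eig (m # T) w" for w
  proof -
    have "y (Suc (length T)) * (x * w) = x * (y (Suc (length T)) * w)"
      by (simp add: mult.assoc[symmetric] c)
    then show ?thesis using that x(3)[of w] l by (simp add: mult_scaleC_right)
  qed
  moreover have "x \<in> H (length (m # T))" "x' \<in> H (length (m # T))"
    using x hecke_alg_mono[of "length T" "length (m # T)" \<sigma>] by auto
  ultimately show ?thesis unfolding link_def using l by auto
qed

lemma diag_gap_factor:
  assumes "\<bar>diag m - diag m'\<bar> \<ge> 2"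
  shows "(ct m - q^2 * ct m') * (ct m - inverse q ^ 2 * ct m') \<noteq> 0"
proof -
  have "ct m \<noteq> q\<^sup>2 * ct m'"
    \<comment> \<open>The negative and the positive part of an integer k, taken as row and column,
      form a pair on the diagonal k. The pair only names a content and need not be a box of any
      diagram.\<close>
    using ct_shift(1)[of "(nat (- min 0 (diag m' + 1)), nat (max 0 (diag m' + 1)))" m']
      ct_eq_iff[of m "(nat (- min 0 (diag m' + 1)), nat (max 0 (diag m' + 1)))"] assms by auto
  moreover have "ct m \<noteq> (inverse q)\<^sup>2 * ct m'"
    using ct_shift(2)[of "(nat (- min 0 (diag m' - 1)), nat (max 0 (diag m' - 1)))" m']
      ct_eq_iff[of m "(nat (- min 0 (diag m' - 1)), nat (max 0 (diag m' - 1)))"] assms by auto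
  ultimately show ?thesis by simp
qed

lemma eig_intertwiner:
  assumes "eig T w"
  shows "eig T (intertwiner (Suc (length T)) * w)"
  using assms by (rule eig_commute) (simp add: intertwiner_commute_jm)

lemma link_swap:
  assumes "young_diagram (set T)" "m \<in> addable (set T)" "m' \<in> addable (set T)" "m \<noteq> m'"
  shows "link (m # m' # T) (m' # m # T)"
proof -
  define k where "k = Suc (length T)"
  define s where "s = - ((ct m - q^2 * ct m') * (ct m - inverse q ^ 2 * ct m'))"
  have s: "s \<noteq> 0"
    using diag_gap_factor[OF addable_diag_gap[OF assms]] by (simp only: s_def neg_equal_0_iff_equal not_False_eq_True)
  let ?x = "intertwiner k" and ?x' = "inverse s *\<^sub>C intertwiner k"
  have "eig (m' # m # T) (?x * w) \<and> ?x' * (?x * w) = w" if w: "eig (m # m' # T) w" for w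
  proof -
    have e: "eig T w" "y k * w = ct m' *\<^sub>C w" "y (Suc k) * w = ct m *\<^sub>C w"
      using w by (auto simp: k_def)
    have "y k * (?x * w) = ?x * (y (Suc k) * w)" "y (Suc k) * (?x * w) = ?x * (y k * w)"
      using intertwiner_props(1,2)[of k] by (simp_all add: mult.assoc[symmetric] k_def)
    then have "eig (m' # m # T) (?x * w)"
      using e eig_intertwiner[OF e(1)] by (simp add: k_def mult_scaleC_right)
    moreover have "?x * (?x * w) = s *\<^sub>C w"
      unfolding s_def by (rule intertwiner_square_eigen) (use e in \<open>auto simp: k_def\<close>)
    ultimately show ?thesis using s by (simp add: mult_scaleC_left scaleC_scaleC scaleC_one)
  qed
  moreover have "?x \<in> H (length (m # m' # T))" by (rule intertwiner_in_alg) (auto simp: k_def)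
  ultimately show ?thesis unfolding link_def by (intro conjI bexI[of _ ?x] bexI[of _ ?x']) auto
qed

text \<open>\<open>m\<close> is moved to the head by exchanges. If the last box \<open>k\<close> is
  another one, then \<open>m\<close> is also removable from the diagram without \<open>k\<close>,
  because an intersection of diagrams is a diagram. By induction \<open>m\<close> can be placed next
  to \<open>k\<close>; both are addable to what remains, so \<open>link_swap\<close>
  applies.\<close>

lemma corner_link:
  assumes "young_path T" "m \<in> removable (set T)"
  obtains S where "young_path (m # S)" "set (m # S) = set T" "link T (m # S)"
  using assms
proof (induction T arbitrary: thesis)
  case Nil
  then show ?case by (simp add: removable_def)
next
  case (Cons k T)
  show ?case
  proof (cases "k = m")
    case True
    then show ?thesis using Cons.prems link_refl by blast
  next
    case False
    have yT: "young_diagram (set T)" and k: "k \<in> addable (set T)" and pT: "young_path T"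
      using Cons.prems young_path_young by auto
    have k': "k \<notin> set T" using k by (simp add: addable_def)
    have yk: "young_diagram (insert k (set T))" using addable_young[OF k] .
    have ym: "young_diagram (insert k (set T) - {m})" and m: "m \<in> set T"
      using Cons.prems(3) False by (auto simp: removable_def)
    have "set T - {m} = set T \<inter> (insert k (set T) - {m})" using k' by auto
    then have "young_diagram (set T - {m})" using young_inter[OF yT ym] by simp
    then have "m \<in> removable (set T)" using m by (simp add: removable_def)
    then obtain S where S: "young_path (m # S)" "set (m # S) = set T" "link T (m # S)"
      using Cons.IH pT by blast
    have yS: "young_diagram (set S)" and mS: "m \<in> addable (set S)"
      using S young_path_young by auto
    have mS': "m \<notin> set S" using mS by (simp add: addable_def)
    have "insert k (set S) = insert k (set T) - {m}" "k \<notin> set S" using S(2) mS' False k' by auto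
    then have kS: "k \<in> addable (set S)" using ym by (simp add: addable_def)
    have "young_path (m # k # S)" using S kS mS addable_insert[OF mS kS] False by auto
    moreover have "set (m # k # S) = set (k # T)" using S(2) by auto
    moreover have "link (k # T) (m # k # S)"
      using link_trans[OF link_Cons[OF S(3)] link_swap[OF yS kS mS False]] .
    ultimately show ?thesis using Cons.prems(1)[of "k # S"] by blast
  qed
qed

text \<open>The intertwiner maps \<open>w\<close> to an \<open>R\<close>-eigenvector on which
  \<open>y k\<close> acts by \<open>b\<close>. As \<open>b\<close> is not the content of an addable
  box, that vector is zero; being a combination of \<open>\<sigma> k * w\<close> and
  \<open>w\<close>, it turns \<open>w\<close> into an eigenvector of
  \<open>\<sigma> k\<close>.\<close>

lemma gen_eigen:
  assumes "minpoly R" "young_diagram (set R)" "eig (m # R) w"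
    and b: "y (Suc (Suc (length R))) * w = b *\<^sub>C w" "b \<noteq> ct m"
    and nb: "\<And>m'. m' \<in> addable (set R) \<Longrightarrow> ct m' \<noteq> b"
  shows "\<sigma> (Suc (length R)) * w = (\<kappa> * b / (b - ct m)) *\<^sub>C w"
proof -
  define k where "k = Suc (length R)"
  define u where "u = intertwiner k * w"
  have e: "eig R w" "y k * w = ct m *\<^sub>C w" "y (Suc k) * w = b *\<^sub>C w"
    using assms by (auto simp: k_def)
  have "y k * u = intertwiner k * (y (Suc k) * w)"
    using intertwiner_props(1)[of k] by (simp add: u_def mult.assoc[symmetric] k_def)
  then have yu: "y k * u = b *\<^sub>C u" by (simp add: e mult_scaleC_right u_def)
  have "poly_apply (add_poly (set R)) (y k) * u = 0"
    using assms(1) eig_intertwiner[OF e(1)] by (simp add: minpoly_def u_def k_def)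
  then have "poly (add_poly (set R)) b *\<^sub>C u = 0" using poly_apply_eigen_left[OF yu] by simp
  moreover have "poly (add_poly (set R)) b \<noteq> 0"
    using nb finite_addable[OF assms(2)] by (auto simp: poly_add_poly)
  ultimately have "u = 0" by simp
  then have "(ct m - b) *\<^sub>C (\<sigma> k * w) = - ((\<kappa> * b) *\<^sub>C w)"
    using intertwiner_eigen[OF e(2,3)] by (simp add: u_def eq_neg_iff_add_eq_0)
  then have "(b - ct m) *\<^sub>C (\<sigma> k * w) = (\<kappa> * b) *\<^sub>C w"
    by (metis minus_diff_eq scaleC.scale_minus_left minus_minus)
  then have "inverse (b - ct m) *\<^sub>C (b - ct m) *\<^sub>C (\<sigma> k * w) = inverse (b - ct m) *\<^sub>C (\<kappa> * b) *\<^sub>C w"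
    by simp
  then show ?thesis using b(2) by (simp add: scaleC_scaleC scaleC_one k_def divide_inverse mult.commute)
qed

text \<open>Two boxes of equal content cannot be separated by a single box of neighbouring content:
  \<open>\<sigma>\<^sub>k\<close> and \<open>\<sigma>\<^bsub>k+1\<^esub>\<close> would act by different scalars, against the braid relation.\<close>

lemma forbidden_content:
  assumes T: "young_path (m # R)" and IH: "\<And>S. young_path S \<Longrightarrow> length S \<le> length R \<Longrightarrow> minpoly S"
    and r: "r \<in> removable (set R)" "\<bar>diag r - diag m\<bar> = 1"
    and w: "eig (m # R) w" "y (Suc (Suc (length R))) * w = ct r *\<^sub>C w"
  shows "w = 0"
proof -
  have pR: "young_path R" and yR: "young_diagram (set R)" and mR: "m \<in> addable (set R)"
    using T young_path_young by auto
  obtain Q where Q: "young_path (r # Q)" "set (r # Q) = set R" "link R (r # Q)"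
    using corner_link[OF pR r(1)] .
  have yQ: "young_diagram (set Q)" and rQ: "r \<in> addable (set Q)" and pQ: "young_path Q"
    using Q young_path_young by auto
  have l: "length R = Suc (length Q)" using Q(3) by (simp add: link_def)
  obtain x x' where x: "x \<in> H (length (m # R))" "eig (m # r # Q) (x * w)" "x' * (x * w) = w"
    using link_Cons[OF Q(3), of m] w(1) by (auto simp: link_def)
  define v where "v = x * w"
  define a where "a = ct m" define b where "b = ct r"
  have ab: "a \<noteq> b" using r(2) by (auto simp: a_def b_def ct_eq_iff)
  let ?k = "Suc (length Q)"
  have "y (Suc (Suc ?k)) * v = x * (y (Suc (Suc ?k)) * w)"
    using commute_alg_jm[OF x(1), of "Suc (Suc ?k)"] l by (simp add: v_def mult.assoc[symmetric] del: jucys_murphy.simps)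
  then have yv: "y (Suc (Suc ?k)) * v = b *\<^sub>C v"
    using w(2) l by (simp add: mult_scaleC_right v_def b_def del: jucys_murphy.simps)
  have ev: "eig (m # r # Q) v" using x by (simp add: v_def)
  define \<alpha> where "\<alpha> = \<kappa> * b / (b - a)"
  define \<beta> where "\<beta> = \<kappa> * a / (a - b)"
  have \<alpha>: "\<sigma> (Suc ?k) * v = \<alpha> *\<^sub>C v"
  proof -
    have "\<sigma> (Suc (length (r # Q))) * v = (\<kappa> * b / (b - ct m)) *\<^sub>C v"
    proof (rule gen_eigen)
      show "minpoly (r # Q)" using IH Q(1) l by simp
      show "young_diagram (set (r # Q))" using Q yR by simp
      \<comment> \<open>Such a box would lie on a diagonal adjacent to that of the addable box
        \<open>m\<close>, against the gap of two.\<close>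
      show "ct m' \<noteq> b" if "m' \<in> addable (set (r # Q))" for m'
        using addable_diag_gap[OF yR mR, of m'] that r(2) Q(2)
        by (cases "m' = m") (auto simp: b_def ct_eq_iff)
    qed (use ev yv ab in \<open>simp_all add: a_def del: jucys_murphy.simps\<close>)
    then show ?thesis by (simp add: \<alpha>_def a_def)
  qed
  have \<beta>: "\<sigma> ?k * v = \<beta> *\<^sub>C v"
  proof -
    have "\<sigma> (Suc (length Q)) * v = (\<kappa> * a / (a - ct r)) *\<^sub>C v"
    proof (rule gen_eigen)
      show "minpoly Q" using IH pQ l by simp
      show "young_diagram (set Q)" by fact
      show "ct m' \<noteq> a" if "m' \<in> addable (set Q)" for m'
        using addable_diag_gap[OF yQ rQ, of m'] that r(2)
        by (cases "m' = r") (auto simp: a_def ct_eq_iff)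
    qed (use ev ab in \<open>simp_all add: a_def b_def del: jucys_murphy.simps\<close>)
    then show ?thesis by (simp add: \<beta>_def b_def)
  qed
  have "\<sigma> ?k * \<sigma> (Suc ?k) * \<sigma> ?k * v = \<sigma> (Suc ?k) * \<sigma> ?k * \<sigma> (Suc ?k) * v"
    using hecke_braid[OF tower, of ?k] by simp
  then have "(\<alpha> * \<beta> * \<beta>) *\<^sub>C v = (\<alpha> * \<alpha> * \<beta>) *\<^sub>C v"
    by (simp add: mult.assoc \<alpha> \<beta> mult_scaleC_right scaleC_scaleC mult_ac)
  then have "(\<alpha> * \<beta> * \<beta> - \<alpha> * \<alpha> * \<beta>) *\<^sub>C v = 0"
    by (simp add: scaleC.scale_left_diff_distrib)
  moreover have "\<alpha> * \<beta> * \<beta> - \<alpha> * \<alpha> * \<beta> \<noteq> 0"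
  proof -
    \<comment> \<open>Equality of \<open>\<alpha>\<close> and \<open>\<beta>\<close> would force
      \<open>a + b = 0\<close>. Since b is q^2 a or q^-2 a, this means q^2 = -1, and q would be a
      fourth root of unity.\<close>
    have "q\<^sup>2 \<noteq> -1"
    proof
      assume "q\<^sup>2 = -1"
      then have "q powi 4 = 1"
        by (simp add: power_int_def) (metis (no_types) mult_2 numeral_Bit0 power2_minus power_add power_one power_even_eq mult_minus1_right minus_minus power2_eq_square)
      then show False using generic_powi_eq_1[OF generic, of 4] by simp
    qed
    moreover from this have "(inverse q)\<^sup>2 \<noteq> -1"
      by (metis inverse_inverse_eq inverse_minus_eq inverse_1 power_inverse)
    moreover have "b = q\<^sup>2 * a \<or> b = (inverse q)\<^sup>2 * a"
    proof -
      have "diag r = diag m + 1 \<or> diag r = diag m - 1" using r(2) by linarith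
      then show ?thesis using ct_shift[of r m] by (auto simp: a_def b_def)
    qed
    moreover have "a \<noteq> 0" "b \<noteq> 0" by (simp_all add: a_def b_def)
    ultimately have "a + b \<noteq> 0"
      by (metis add.commute add_eq_0_iff mult_cancel_right mult_minus1)
    moreover have "\<alpha> - \<beta> = \<kappa> * (a + b) / (b - a)"
    proof -
      have "x * a / (a - b) = - (x * a / (b - a))" for x :: complex
        by (metis minus_diff_eq minus_divide_right)
      then show ?thesis by (simp only: \<alpha>_def \<beta>_def) (simp add: add_divide_distrib distrib_left)
    qed
    ultimately have "\<alpha> - \<beta> \<noteq> 0" using ab kappa_nonzero by simp
    moreover have "\<alpha> \<noteq> 0" "\<beta> \<noteq> 0"
      using ab \<open>a \<noteq> 0\<close> \<open>b \<noteq> 0\<close> kappa_nonzero by (simp_all add: \<alpha>_def \<beta>_def)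
    moreover have "\<alpha> * \<beta> * \<beta> - \<alpha> * \<alpha> * \<beta> = - (\<alpha> * \<beta> * (\<alpha> - \<beta>))" by (simp add: algebra_simps)
    ultimately show ?thesis by simp
  qed
  ultimately have "v = 0" by simp
  then show ?thesis using x(3) by (simp add: v_def)
qed

text \<open>A nonzero \<open>w\<close> would make \<open>w\<close> and \<open>\<sigma> k * w\<close>
  a Jordan block of \<open>y k\<close> for the eigenvalue \<open>ct m\<close>, while the
  annihilating polynomial of \<open>R\<close> has simple roots.\<close>

lemma repeated_content:
  assumes "minpoly R" "young_diagram (set R)" "m \<in> addable (set R)" "eig (m # R) w"
    "y (Suc (Suc (length R))) * w = ct m *\<^sub>C w"
  shows "w = 0"
proof -
  define k where "k = Suc (length R)"
  define a where "a = ct m"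
  define P where "P = (\<Prod>m'\<in>addable (set R) - {m}. [:- ct m', 1:])"
  have e: "eig R w" "y k * w = a *\<^sub>C w" "y (Suc k) * w = a *\<^sub>C w"
    using assms by (auto simp: k_def a_def)
  have PP: "add_poly (set R) = P * [:- a, 1:]"
    unfolding add_poly_def P_def a_def
    using prod.remove[OF finite_addable[OF assms(2)] assms(3), of "\<lambda>m. [:- ct m, 1:]"] by simp
  have s: "\<sigma> k * \<sigma> k = 1 + \<kappa> *\<^sub>C \<sigma> k" using gen_square by (simp add: k_def)
  \<comment> \<open>\<open>\<sigma> k - \<kappa> *\<^sub>C 1\<close> is the inverse of
    \<open>\<sigma> k\<close>, so \<open>y k * \<sigma> k\<close> is this inverse times
    \<open>y (Suc k)\<close>.\<close>
  have "y k * (\<sigma> k * w) = (\<sigma> k - \<kappa> *\<^sub>C 1) * (\<sigma> k * y k * \<sigma> k) * w"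
  proof -
    have "(\<sigma> k - \<kappa> *\<^sub>C 1) * \<sigma> k = 1" by (simp add: left_diff_distrib s mult_scaleC_left)
    then have "(\<sigma> k - \<kappa> *\<^sub>C 1) * (\<sigma> k * y k * \<sigma> k) = y k * \<sigma> k"
      by (metis mult.assoc mult_1)
    then show ?thesis by (simp add: mult.assoc)
  qed
  also have "\<dots> = (\<sigma> k - \<kappa> *\<^sub>C 1) * (y (Suc k) * w)"
    using jm_Suc[of k] by (simp add: k_def mult.assoc)
  also have "\<dots> = a *\<^sub>C (\<sigma> k * w) - (\<kappa> * a) *\<^sub>C w"
    by (simp add: e mult_scaleC_right mult_scaleC_left left_diff_distrib scaleC.scale_right_diff_distrib scaleC_scaleC mult.commute)
  finally have v: "(y k - a *\<^sub>C 1) * (\<sigma> k * w) = - ((\<kappa> * a) *\<^sub>C w)"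
    by (simp add: left_diff_distrib mult_scaleC_left)
  have "eig R (\<sigma> k * w)"
    using e(1) gen_commute_alg[OF jm_in_alg, of _ _ k] by (intro eig_commute) (auto simp: k_def)
  then have "poly_apply (P * [:- a, 1:]) (y k) * (\<sigma> k * w) = 0"
    using assms(1) by (simp add: minpoly_def PP k_def)
  then have "poly_apply P (y k) * ((y k - a *\<^sub>C 1) * (\<sigma> k * w)) = 0"
    by (simp only: poly_apply_mult poly_apply_linear mult.assoc)
  then have "(\<kappa> * a) *\<^sub>C (poly P a *\<^sub>C w) = 0"
    using poly_apply_eigen_left[OF e(2), of P] by (simp add: v mult_scaleC_right)
  moreover have "poly P a \<noteq> 0"
    using finite_addable[OF assms(2)] inj_on_ct_addable[OF assms(2)] assms(3)
    by (auto simp: P_def poly_prod a_def inj_on_def)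
  moreover have "\<kappa> * a \<noteq> 0" unfolding a_def using kappa_nonzero ct_nonzero by (metis mult_eq_0_iff)
  ultimately show ?thesis by simp
qed

text \<open>The partial product applied to \<open>w\<close> is again a \<open>T\<close>-eigenvector,
  now with the excluded eigenvalue \<open>r\<close>, and therefore zero.\<close>

lemma strip_root:
  assumes "poly_apply (p * [:- r, 1:]) (y (Suc (length T))) * w = 0" "eig T w"
    and "\<And>v. eig T v \<Longrightarrow> y (Suc (length T)) * v = r *\<^sub>C v \<Longrightarrow> v = 0"
  shows "poly_apply p (y (Suc (length T))) * w = 0"
proof (rule assms(3))
  let ?Y = "y (Suc (length T))"
  have "poly_apply p ?Y * y j = y j * poly_apply p ?Y" if "1 \<le> j" for j
    using that by (intro poly_apply_intertwine jm_commute) auto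
  then show "eig T (poly_apply p ?Y * w)" using assms(2) by (intro eig_commute) auto
  have "poly_apply (p * [:- r, 1:]) ?Y = poly_apply [:- r, 1:] ?Y * poly_apply p ?Y"
    by (simp only: mult.commute[of p] poly_apply_mult)
  then show "?Y * (poly_apply p ?Y * w) = r *\<^sub>C (poly_apply p ?Y * w)"
    using assms(1) by (simp add: mult.assoc left_diff_distrib mult_scaleC_left)
qed

text \<open>Let \<open>T = m # R\<close>, a the content of \<open>m\<close> and Y the next
  Jucys-Murphy element. The intertwiner maps \<open>w\<close> to an \<open>R\<close>-eigenvector,
  which \<open>add_poly (set R)\<close> at \<open>y k\<close> kills. Pulling the polynomial through
  a second intertwiner replaces \<open>y k\<close> by Y, and the squared intertwiner acts on
  \<open>w\<close> as -(Y - q^2 a)(Y - q^-2 a). From the resulting product the root a is struck by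
  \<open>repeated_content\<close>, and q^2 a and q^-2 a by \<open>forbidden_content\<close> unless
  the box beside \<open>m\<close> with that content has become addable.\<close>

theorem minimal_polynomial:
  assumes "young_path T"
  shows "minpoly T"
  using assms
proof (induction T rule: length_induct)
  case (1 T)
  show ?case
  proof (cases T)
    case Nil
    \<comment> \<open>The first Jucys-Murphy element is 1, the content of the only addable box (1,
      1).\<close>
    then show ?thesis by (simp add: minpoly_def add_poly_def addable_empty node_content_def scaleC_one)
  next
    case (Cons m R)
    have pR: "young_path R" and mR: "m \<in> addable (set R)" and yR: "young_diagram (set R)"
      using 1 Cons young_path_young by auto
    have IH: "minpoly S" if "young_path S" "length S \<le> length R" for S
      using 1 Cons that by auto
    have mpR: "minpoly R" using IH pR by simp
    obtain r c where m: "m = (r, c)" by (cases m)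
    note pT = 1(2)[unfolded Cons]
    have rc: "r \<ge> 1" "c \<ge> 1" using mR by (auto simp: m addable_iff[OF yR])
    define k where "k = Suc (length R)"
    define a where "a = ct m"
    define P0 where "P0 = (\<Prod>m'\<in>addable (set R) - {m}. [:- ct m', 1:])"
    define X where "X = [:- (q\<^sup>2 * a), 1:]"
    define X' where "X' = [:- ((inverse q)\<^sup>2 * a), 1:]"
    let ?\<phi> = "intertwiner k" and ?Y = "y (Suc k)"
    have PP: "add_poly (set R) = P0 * [:- a, 1:]"
      unfolding add_poly_def P0_def a_def
      using prod.remove[OF finite_addable[OF yR] mR, of "\<lambda>m. [:- ct m, 1:]"] by simp
    define U where "U \<longleftrightarrow> r = 1 \<or> (r - 1, c + 1) \<in> set R"
    define V where "V \<longleftrightarrow> c = 1 \<or> (r + 1, c - 1) \<in> set R"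
    note S = addable_insert_sets[OF yR mR[unfolded m], folded U_def V_def]
    have "add_poly (set T) = P0 * (\<Prod>m'\<in>{x. x = (r, c + 1) \<and> U}. [:- ct m', 1:]) *
        (\<Prod>m'\<in>{x. x = (r + 1, c) \<and> V}. [:- ct m', 1:])"
      unfolding add_poly_def P0_def Cons list.set m S(1) using S(5,6) finite_addable[OF yR]
      by (subst prod.union_disjoint; auto)+
    also have "\<dots> = P0 * (if U then X else 1) * (if V then X' else 1)"
      using ct_shift[of "(r, c + 1)" m] ct_shift[of "(r + 1, c)" m] m by (simp add: X_def X'_def a_def)
    finally have PT: "add_poly (set T) = P0 * (if U then X else 1) * (if V then X' else 1)" .
    have root_a: "v = 0" if "eig T v" "y (Suc (length T)) * v = a *\<^sub>C v" for v
      using repeated_content[OF mpR yR mR] that Cons by (simp add: a_def del: jucys_murphy.simps)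
    \<comment> \<open>If the box to the right of \<open>m\<close> does not become addable, the box
      above \<open>m\<close> is removable in \<open>R\<close> and has the same content.\<close>
    have root_X: "v = 0" if "eig T v" "y (Suc (length T)) * v = (q\<^sup>2 * a) *\<^sub>C v" "\<not> U" for v
    proof (rule forbidden_content[OF pT IH])
      show "(r - 1, c) \<in> removable (set R)" using S(3) that by blast
      have d: "diag (r - 1, c) = diag m + 1" using m rc by auto
      then show "\<bar>diag (r - 1, c) - diag m\<bar> = 1" by simp
      show "y (Suc (Suc (length R))) * v = ct (r - 1, c) *\<^sub>C v"
        using that(2) ct_shift(1)[OF d] Cons by (simp add: a_def del: jucys_murphy.simps)
    qed (use that Cons in auto)
    have root_X': "v = 0" if "eig T v" "y (Suc (length T)) * v = ((inverse q)\<^sup>2 * a) *\<^sub>C v" "\<not> V" for v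
    proof (rule forbidden_content[OF pT IH])
      show "(r, c - 1) \<in> removable (set R)" using S(4) that by blast
      have d: "diag (r, c - 1) = diag m - 1" using m rc by auto
      then show "\<bar>diag (r, c - 1) - diag m\<bar> = 1" by simp
      show "y (Suc (Suc (length R))) * v = ct (r, c - 1) *\<^sub>C v"
        using that(2) ct_shift(2)[OF d] Cons by (simp add: a_def del: jucys_murphy.simps)
    qed (use that Cons in auto)
    show ?thesis unfolding minpoly_def
    proof (intro allI impI)
      fix w assume w: "eig T w"
      then have e: "eig R w" "y k * w = a *\<^sub>C w" using Cons by (auto simp: k_def a_def)
      have lT: "Suc (length T) = Suc k" using Cons by (simp add: k_def)
      have "?\<phi> * (?\<phi> * w) = - (poly_apply (X * X') ?Y * w)"
      proof -
        have "?\<phi> * (?\<phi> * w) = ((\<kappa> * \<kappa>) *\<^sub>C (?Y * y k) - (?Y - y k) * (?Y - y k)) * w"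
          using intertwiner_props(3)[of k] by (simp add: mult.assoc[symmetric] k_def)
        also have "\<dots> = (\<kappa> * \<kappa>) *\<^sub>C (?Y * (y k * w)) - ?Y * (?Y * w) + ?Y * (y k * w) + (y k * ?Y) * w - y k * (y k * w)"
          by (simp add: algebra_simps mult_scaleC_left)
        also have "y k * ?Y = ?Y * y k" by (rule jm_commute) (auto simp: k_def)
        also have "(\<kappa> * \<kappa>) *\<^sub>C (?Y * (y k * w)) - ?Y * (?Y * w) + ?Y * (y k * w) + ?Y * y k * w - y k * (y k * w)
            = (\<kappa> * \<kappa> * a) *\<^sub>C (?Y * w) - ?Y * (?Y * w) + a *\<^sub>C (?Y * w) + a *\<^sub>C (?Y * w) - (a * a) *\<^sub>C w"
          by (simp only: mult.assoc e mult_scaleC_right scaleC_scaleC)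
        also have "\<dots> = (\<kappa> * \<kappa> * a + a + a) *\<^sub>C (?Y * w) - ?Y * (?Y * w) - (a * a) *\<^sub>C w"
          by (simp only: scaleC_add_left) (simp only: algebra_simps)
        also have "\<kappa> * \<kappa> * a + a + a = q\<^sup>2 * a + (inverse q)\<^sup>2 * a"
          by (simp add: field_simps power2_eq_square)
        also have "a * a = q\<^sup>2 * a * ((inverse q)\<^sup>2 * a)"
          by (simp add: field_simps)
        also have "(q\<^sup>2 * a + (inverse q)\<^sup>2 * a) *\<^sub>C (?Y * w) - ?Y * (?Y * w) - (q\<^sup>2 * a * ((inverse q)\<^sup>2 * a)) *\<^sub>C w
          = - (poly_apply (X * X') ?Y * w)"
          unfolding poly_apply_mult X_def X'_def poly_apply_linear
          by (simp add: mult.assoc left_diff_distrib right_diff_distrib mult_scaleC_left mult_scaleC_right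
             scaleC_scaleC scaleC.scale_right_diff_distrib scaleC_add_left del: jucys_murphy.simps)
        finally show ?thesis .
      qed
      moreover have "poly_apply (add_poly (set R)) ?Y * (?\<phi> * (?\<phi> * w)) = 0"
      proof -
        have "poly_apply (add_poly (set R)) ?Y * ?\<phi> = ?\<phi> * poly_apply (add_poly (set R)) (y k)"
          using intertwiner_props(2)[of k] by (intro poly_apply_intertwine) (simp add: k_def)
        moreover have "poly_apply (add_poly (set R)) (y k) * (?\<phi> * w) = 0"
          using mpR eig_intertwiner[OF e(1)] by (simp add: minpoly_def k_def)
        ultimately show ?thesis by (metis mult.assoc mult_zero_right)
      qed
      ultimately have B: "poly_apply (add_poly (set R) * (X * X')) ?Y * w = 0"
        by (simp add: poly_apply_mult mult.assoc)
      note strip = strip_root[where T = T, unfolded lT]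
      have "add_poly (set R) * (X * X') = P0 * X * X' * [:- a, 1:]"
        unfolding PP by (simp only: mult_ac)
      with B have "poly_apply (P0 * X * X') ?Y * w = 0"
        using strip[OF _ w root_a[unfolded lT]] by metis
      then have "poly_apply (P0 * X * (if V then X' else 1)) ?Y * w = 0"
        using strip[OF _ w root_X'[unfolded lT], of "P0 * X"] by (auto simp: X'_def)
      then have "poly_apply (P0 * (if V then X' else 1) * X) ?Y * w = 0"
        by (simp only: mult_ac)
      then have "poly_apply (P0 * (if V then X' else 1) * (if U then X else 1)) ?Y * w = 0"
        using strip[OF _ w root_X[unfolded lT], of "P0 * (if V then X' else 1)"] by (auto simp: X_def)
      then show "poly_apply (add_poly (set T)) (y (Suc (length T))) * w = 0"
        unfolding PT lT by (simp only: mult_ac)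
    qed
  qed
qed

end

section \<open>A Cauchy system of linear equations\<close>

lemma degree_prod_linear:
  fixes f :: "'b \<Rightarrow> complex"
  assumes "finite A"
  shows "degree (\<Prod>m\<in>A. [:- f m, 1:]) = card A" "coeff (\<Prod>m\<in>A. [:- f m, 1:]) (card A) = 1"
proof -
  show d: "degree (\<Prod>m\<in>A. [:- f m, 1:]) = card A"
    by (subst degree_prod_eq_sum_degree) auto
  show "coeff (\<Prod>m\<in>A. [:- f m, 1:]) (card A) = 1"
    using lead_coeff_prod[of "\<lambda>m. [:- f m, 1:]" A] by (simp add: d)
qed

text \<open>Put all fractions over the common denominator D with roots \<open>f m\<close>. The
  equations say that the monic numerator N + D vanishes at every \<open>g r\<close>, and
  \<open>eq0\<close> with \<open>prods\<close> fixes its value at 0. So it agrees with the monic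
  polynomial G of the same degree, with roots \<open>b\<close> and \<open>g r\<close>, at
  \<open>card R + 1\<close> points, as many as the degree. Evaluating N + D = G at
  \<open>f m\<close> isolates \<open>c m\<close>.\<close>

lemma cauchy_system:
  fixes f c :: "'b \<Rightarrow> complex" and g :: "'c \<Rightarrow> complex"
  assumes fin: "finite A" "finite R" and card: "card A = card R + 1"
    and inj: "inj_on f A" "inj_on g R" and fg: "\<And>m r. m \<in> A \<Longrightarrow> r \<in> R \<Longrightarrow> f m \<noteq> g r"
    and nz: "\<And>m. m \<in> A \<Longrightarrow> f m \<noteq> 0" "\<And>r. r \<in> R \<Longrightarrow> g r \<noteq> 0"
    and prods: "prod f A = prod g R" and k: "k \<noteq> 0"
    and eq0: "k * (\<Sum>m\<in>A. c m) = 1 - b"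
    and eqs: "\<And>r. r \<in> R \<Longrightarrow> (\<Sum>m\<in>A. k * f m / (f m - g r) * c m) = 1"
    and m: "m \<in> A"
  shows "c m = (1 - b / f m) / k * ((\<Prod>r\<in>R. f m - g r) / (\<Prod>m'\<in>A - {m}. f m - f m'))"
proof -
  define D where "D = (\<Prod>m\<in>A. [:- f m, 1:])"
  define N where "N = (\<Sum>m\<in>A. smult (k * c m * f m) (\<Prod>m'\<in>A - {m}. [:- f m', 1:]))"
  define G where "G = [:- b, 1:] * (\<Prod>r\<in>R. [:- g r, 1:])"
  have polyN: "poly N x = (\<Sum>m\<in>A. k * c m * f m * (\<Prod>m'\<in>A - {m}. x - f m'))" for x
    by (simp add: N_def poly_sum poly_prod)
  have polyD: "poly D x = (\<Prod>m\<in>A. x - f m)" for x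
    by (simp add: D_def poly_prod)
  have ND: "poly (N + D) x = poly D x * (1 - (\<Sum>m\<in>A. k * f m / (f m - x) * c m))"
    if "\<And>m. m \<in> A \<Longrightarrow> f m \<noteq> x" for x
  proof -
    have "k * c m * f m * (\<Prod>m'\<in>A - {m}. x - f m') = - poly D x * (k * f m / (f m - x) * c m)"
      if m: "m \<in> A" for m
    proof -
      define P where "P = (\<Prod>m'\<in>A - {m}. x - f m')"
      have "poly D x = (x - f m) * P"
        unfolding polyD P_def by (rule prod.remove[OF fin(1) m])
      moreover have "f m - x \<noteq> 0" using that m \<open>\<And>m. m \<in> A \<Longrightarrow> f m \<noteq> x\<close> by simp
      ultimately show ?thesis unfolding P_def[symmetric] by (simp add: divide_simps) (simp add: algebra_simps)
    qed
    then have "poly N x = - poly D x * (\<Sum>m\<in>A. k * f m / (f m - x) * c m)"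
      unfolding polyN by (simp add: sum_distrib_left)
    then show ?thesis by (simp add: algebra_simps)
  qed
  have "N + D = G"
  proof (rule poly_eqI_degree_lead_coeff[where n = "card A" and A = "insert 0 (g ` R)"])
    have "0 \<notin> g ` R" using nz(2) by force
    then show "card A \<le> card (insert 0 (g ` R))"
      using fin card inj(2) by (simp add: card_image)
    have A0: "card A \<noteq> 0" using card by simp
    have dN: "degree N \<le> card A - 1"
      unfolding N_def using fin
      by (intro degree_sum_le) (auto simp: degree_prod_linear intro!: order_trans[OF degree_smult_le])
    have dR: "degree (\<Prod>r\<in>R. [:- g r, 1:]) = card R" "coeff (\<Prod>r\<in>R. [:- g r, 1:]) (card R) = 1"
      "coeff (\<Prod>r\<in>R. [:- g r, 1:]) (Suc (card R)) = 0"
      using degree_prod_linear[OF fin(2), of g] by (auto intro: coeff_eq_0)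
    have "coeff N (card A) = 0" using dN A0 by (intro coeff_eq_0) linarith
    then show "coeff (N + D) (card A) = coeff G (card A)"
      using degree_prod_linear(2)[OF fin(1), of f] dR by (simp add: D_def G_def card)
    show "degree (N + D) \<le> card A"
      using dN degree_prod_linear(1)[OF fin(1), of f] by (intro degree_add_le) (auto simp: D_def)
    show "degree G \<le> card A"
      unfolding G_def using degree_mult_le[of "[:- b, 1:]" "\<Prod>r\<in>R. [:- g r, 1:]"] dR card by simp
  next
    fix x assume "x \<in> insert 0 (g ` R)"
    then consider "x = 0" | r where "r \<in> R" "x = g r" by auto
    then show "poly (N + D) x = poly G x"
    proof cases
      case 1
      have "(\<Sum>m\<in>A. k * f m / (f m - 0) * c m) = 1 - b"
        using nz(1) eq0 by (simp add: sum_distrib_left)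
      then have "poly (N + D) 0 = (\<Prod>m\<in>A. - f m) * b" using ND[of 0] nz(1) by (simp add: polyD)
      also have "(\<Prod>m\<in>A. - f m) = (-1) ^ card A * prod f A" by (rule prod_uminus)
      also have "\<dots> * b = poly G 0"
        by (simp add: prods card G_def poly_prod prod_uminus)
      finally show ?thesis using 1 by simp
    next
      case 2
      then have "poly G x = 0" using fin(2) by (auto simp: G_def poly_prod)
      moreover have "poly (N + D) x = 0" using ND[of x] eqs[OF 2(1)] fg[OF _ 2(1)] 2 by simp
      ultimately show ?thesis by simp
    qed
  qed
  then have "poly (N + D) (f m) = poly G (f m)" by simp
  moreover have "poly D (f m) = 0" using fin(1) m by (auto simp: polyD)
  moreover have "poly N (f m) = k * c m * f m * (\<Prod>m'\<in>A - {m}. f m - f m')"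
  proof -
    have "k * c m' * f m' * (\<Prod>m''\<in>A - {m'}. f m - f m'') = 0" if "m' \<in> A - {m}" for m'
      using that m fin(1) by auto
    then have "(\<Sum>m'\<in>A - {m}. k * c m' * f m' * (\<Prod>m''\<in>A - {m'}. f m - f m'')) = 0"
      by (intro sum.neutral) blast
    then show ?thesis unfolding polyN by (subst sum.remove[OF fin(1) m]) simp
  qed
  ultimately have "k * c m * f m * (\<Prod>m'\<in>A - {m}. f m - f m') = (f m - b) * (\<Prod>r\<in>R. f m - g r)"
    by (simp add: G_def poly_prod left_diff_distrib)
  moreover have "(\<Prod>m'\<in>A - {m}. f m - f m') \<noteq> 0"
    using inj(1) m fin(1) by (auto simp: inj_on_def)
  ultimately show ?thesis using k nz(1)[OF m] by (simp add: field_simps)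
qed

context hecke
begin

section \<open>The idempotents of standard tableaux\<close>

text \<open>The Lagrange basis polynomial whose nodes are the contents of the addable boxes.\<close>

definition lag :: "(nat \<times> nat) set \<Rightarrow> nat \<times> nat \<Rightarrow> complex poly" where
  "lag lam m = (\<Prod>m'\<in>addable lam - {m}. smult (1 / (ct m - ct m')) [:- ct m', 1:])"

lemma poly_lag:
  assumes "young_diagram lam" "m \<in> addable lam" "m' \<in> addable lam"
  shows "poly (lag lam m) (ct m') = (if m' = m then 1 else 0)"
proof -
  have ne: "ct m \<noteq> ct x" if "x \<in> addable lam - {m}" for x
    using inj_on_ct_addable[OF assms(1)] assms(2) that by (auto simp: inj_on_def)
  show ?thesis
    using ne finite_addable[OF assms(1)] assms(3)
    by (auto simp: lag_def poly_prod divide_simps intro!: prod.neutral bexI[of _ m'])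
qed

text \<open>Both sides have degree below the number of nodes and agree at each node; for the
  constant 1 this uses that some box is always addable.\<close>

lemma sum_lag:
  assumes "young_diagram lam"
  shows "(\<Sum>m\<in>addable lam. lag lam m) = 1"
proof (rule poly_eqI_degree[where A = "ct ` addable lam"])
  note fin = finite_addable[OF assms]
  have card: "card (ct ` addable lam) = card (addable lam)" "card (addable lam) > 0"
    using inj_on_ct_addable[OF assms] corner_counts[OF assms] by (simp_all add: card_image)
  have "degree (lag lam m) \<le> card (addable lam) - 1" if "m \<in> addable lam" for m
  proof -
    have "degree (lag lam m) \<le> (\<Sum>m'\<in>addable lam - {m}. degree (smult (1 / (ct m - ct m')) [:- ct m', 1:]))"
      unfolding lag_def
      using degree_prod_sum_le[of "addable lam - {m}" "\<lambda>m'. smult (1 / (ct m - ct m')) [:- ct m', 1:]"] fin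
      by (simp only: o_def finite_Diff)
    also have "\<dots> \<le> (\<Sum>m'\<in>addable lam - {m}. 1)" by (intro sum_mono) simp
    also have "\<dots> = card (addable lam) - 1" using that fin by simp
    finally show ?thesis .
  qed
  then have "degree (\<Sum>m\<in>addable lam. lag lam m) \<le> card (addable lam) - 1"
    using fin by (intro degree_sum_le) auto
  then show "degree (\<Sum>m\<in>addable lam. lag lam m) < card (ct ` addable lam)" using card by linarith
  show "degree (1 :: complex poly) < card (ct ` addable lam)" using card by simp
  fix x assume "x \<in> ct ` addable lam"
  then obtain m where m: "m \<in> addable lam" "x = ct m" by blast
  have "(\<Sum>k\<in>addable lam. poly (lag lam k) x) = (\<Sum>k\<in>addable lam. if m = k then 1 else 0)"
    using poly_lag[OF assms _ m(1)] m(2) by (intro sum.cong) auto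
  then show "poly (\<Sum>m\<in>addable lam. lag lam m) x = poly 1 x"
    using fin m(1) by (simp add: poly_sum)
qed

lemma lag_mult_root:
  assumes "young_diagram lam" "m \<in> addable lam"
  obtains a where "[:- ct m, 1:] * lag lam m = smult a (add_poly lam)"
proof
  have "lag lam m = smult (\<Prod>m'\<in>addable lam - {m}. 1 / (ct m - ct m')) (\<Prod>m'\<in>addable lam - {m}. [:- ct m', 1:])"
    unfolding lag_def by (rule prod_smult)
  then show "[:- ct m, 1:] * lag lam m = smult (\<Prod>m'\<in>addable lam - {m}. 1 / (ct m - ct m')) (add_poly lam)"
    using prod.remove[OF finite_addable[OF assms(1)] assms(2), of "\<lambda>m. [:- ct m, 1:]"]
    by (simp add: add_poly_def)
qed

primrec idem :: "(nat \<times> nat) list \<Rightarrow> 'a" where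
  "idem [] = 1"
| "idem (m # T) = idem T * poly_apply (lag (set T) m) (y (Suc (length T)))"

lemma idem_in_alg: "idem T \<in> H (length T)"
proof (induction T)
  case (Cons m T)
  then have "idem T \<in> H (Suc (length T))" using hecke_alg_mono[of "length T" "Suc (length T)" \<sigma>] by auto
  then show ?case by (auto intro!: hecke_alg_mult hecke_alg_poly_apply jm_in_alg)
qed simp

lemma jm_commute_idem: "1 \<le> j \<Longrightarrow> y j * idem T = idem T * y j"
proof (induction T)
  case (Cons m T)
  let ?L = "poly_apply (lag (set T) m) (y (Suc (length T)))"
  have "?L * y j = y j * ?L"
    using Cons.prems by (intro poly_apply_intertwine jm_commute) auto
  then show ?case using Cons by (simp add: mult.assoc) (simp add: mult.assoc[symmetric])
qed simp

lemma poly_apply_commute_idem: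
  "1 \<le> j \<Longrightarrow> poly_apply p (y j) * idem T = idem T * poly_apply p (y j)"
  by (rule poly_apply_intertwine) (rule jm_commute_idem)

lemma idem_Cons': "idem (m # T) = poly_apply (lag (set T) m) (y (Suc (length T))) * idem T"
  by (simp add: poly_apply_commute_idem)

text \<open>The Lagrange factor times its missing linear factor is a multiple of
  \<open>add_poly\<close>, which kills \<open>idem T\<close> by
  \<open>minimal_polynomial\<close>.\<close>

lemma eig_idem: "young_path T \<Longrightarrow> eig T (idem T)"
proof (induction T)
  case (Cons m T)
  then have pT: "young_path T" and yT: "young_diagram (set T)" and m: "m \<in> addable (set T)"
    using young_path_young by auto
  let ?Y = "y (Suc (length T))"
  have e: "eig T (idem T)" using Cons.IH pT .
  obtain a where a: "[:- ct m, 1:] * lag (set T) m = smult a (add_poly (set T))"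
    using lag_mult_root[OF yT m] .
  have "(?Y - ct m *\<^sub>C 1) * idem (m # T) = poly_apply ([:- ct m, 1:] * lag (set T) m) ?Y * idem T"
    unfolding idem_Cons' poly_apply_mult poly_apply_linear by (simp only: mult.assoc)
  also have "\<dots> = 0"
    unfolding a poly_apply_smult using minimal_polynomial[OF pT] e
    by (simp add: minpoly_def mult_scaleC_left)
  finally have "?Y * idem (m # T) = ct m *\<^sub>C idem (m # T)"
    by (simp only: left_diff_distrib mult_scaleC_left mult_1_left right_minus_eq)
  then show ?case using eig_mult_right[OF e] by simp
qed simp

lemma idem_mult_eig: "young_path T \<Longrightarrow> eig T w \<Longrightarrow> idem T * w = w"
proof (induction T)
  case (Cons m T)
  then have yT: "young_diagram (set T)" and m: "m \<in> addable (set T)"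
    using young_path_young by auto
  have "poly_apply (lag (set T) m) (y (Suc (length T))) * w = poly (lag (set T) m) (ct m) *\<^sub>C w"
    using Cons.prems by (intro poly_apply_eigen_left) simp
  then show ?case using Cons poly_lag[OF yT m m] by (simp add: mult.assoc scaleC_one)
qed simp

lemma idem_idem: "young_path T \<Longrightarrow> idem T * idem T = idem T"
  using idem_mult_eig eig_idem by blast

text \<open>The mirror image of \<open>idem_mult_eig\<close>. As the head is the last box,
  \<open>rev T ! i\<close> is the box with entry i + 1.\<close>

lemma mult_idem_right_eig:
  assumes "young_path T" "\<And>i. i < length T \<Longrightarrow> w * y (Suc i) = ct (rev T ! i) *\<^sub>C w"
  shows "w * idem T = w"
  using assms
proof (induction T)
  case (Cons m T)
  then have yT: "young_diagram (set T)" and m: "m \<in> addable (set T)"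
    using young_path_young by auto
  have "w * y (Suc i) = ct (rev T ! i) *\<^sub>C w" if "i < length T" for i
    using Cons.prems(2)[of i] that by (simp add: nth_append)
  then have w: "w * idem T = w" using Cons by simp
  have "w * y (Suc (length T)) = ct m *\<^sub>C w"
    using Cons.prems(2)[of "length T"] by (simp add: nth_append)
  then have "w * poly_apply (lag (set T) m) (y (Suc (length T))) = w"
    using poly_apply_eigen_right[of w _ "ct m"] poly_lag[OF yT m m] by (simp add: scaleC_one)
  then show ?case using w by (simp add: mult.assoc[symmetric])
qed simp

lemma idem_kill:
  assumes "young_path (m # T)" "y (Suc (length T)) * w = b *\<^sub>C w" "b \<noteq> ct m"
  shows "idem (m # T) * w = 0"
proof -
  let ?Y = "y (Suc (length T))"
  have "b *\<^sub>C (idem (m # T) * w) = idem (m # T) * (?Y * w)"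
    by (simp only: assms(2) mult_scaleC_right)
  also have "\<dots> = (?Y * idem (m # T)) * w"
    using jm_commute_idem[of "Suc (length T)" "m # T"] by (simp only: mult.assoc)
  also have "\<dots> = ct m *\<^sub>C (idem (m # T) * w)"
    using eig_idem[OF assms(1)] by (simp add: mult_scaleC_left)
  finally have "(b - ct m) *\<^sub>C (idem (m # T) * w) = 0"
    by (simp only: scaleC.scale_left_diff_distrib right_minus_eq)
  then show ?thesis using assms(3) by simp
qed

lemma idem_orthogonal:
  assumes "young_path T" "young_path S" "length S = length T" "eig S w" "S \<noteq> T"
  shows "idem T * w = 0"
  using assms
proof (induction T arbitrary: S)
  case (Cons m T)
  then obtain m' S' where S: "S = m' # S'" by (cases S) auto
  show ?case
  proof (cases "S' = T")
    case False
    then have "idem T * w = 0" using Cons S by auto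
    then show ?thesis unfolding idem_Cons' by (simp add: mult.assoc)
  next
    case True
    have "young_diagram (set T)" using Cons.prems(1) young_path_young by simp
    then have "ct m' \<noteq> ct m"
      using Cons.prems True S inj_on_ct_addable[of "set T"] by (auto simp: inj_on_def)
    then show ?thesis using Cons.prems True S by (intro idem_kill) auto
  qed
qed simp

section \<open>Resolution of the identity and matrix entries of the generators\<close>

definition paths :: "nat \<Rightarrow> (nat \<times> nat) list set" where
  "paths n = {T. young_path T \<and> length T = n}"

lemma idem_sum_Cons:
  assumes "young_path T"
  shows "(\<Sum>m\<in>addable (set T). idem (m # T)) = idem T"
proof -
  have "(\<Sum>m\<in>addable (set T). idem (m # T)) =
      idem T * poly_apply (\<Sum>m\<in>addable (set T). lag (set T) m) (y (Suc (length T)))"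
    by (simp add: poly_apply_sum sum_distrib_left)
  then show ?thesis using sum_lag[OF young_path_young[OF assms]] by simp
qed

lemma idem_sum_paths: "finite (paths n) \<and> (\<Sum>T\<in>paths n. idem T) = 1"
proof (induction n)
  case 0
  have "paths 0 = {[]}" by (auto simp: paths_def)
  then show ?case by simp
next
  case (Suc n)
  have eq: "paths (Suc n) = (\<lambda>(T, m). m # T) ` (SIGMA T:paths n. addable (set T))" (is "_ = ?f ` ?S")
    by (auto simp: paths_def length_Suc_conv image_iff)
  have fin: "\<forall>T\<in>paths n. finite (addable (set T))"
    using finite_addable young_path_young by (auto simp: paths_def)
  have "inj_on ?f ?S" by (auto simp: inj_on_def)
  then have "(\<Sum>T\<in>paths (Suc n). idem T) = (\<Sum>(T, m)\<in>?S. idem (m # T))"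
    unfolding eq by (subst sum.reindex) (auto intro!: sum.cong)
  also have "\<dots> = (\<Sum>T\<in>paths n. \<Sum>m\<in>addable (set T). idem (m # T))"
    using Suc fin by (intro sum.Sigma[symmetric]) auto
  also have "\<dots> = (\<Sum>T\<in>paths n. idem T)"
    by (intro sum.cong refl idem_sum_Cons) (simp add: paths_def)
  finally show ?case using Suc fin eq by simp
qed

text \<open>Young's seminormal form without a basis: \<open>\<sigma> k\<close> acts by a diagonal
  scalar plus a vector \<open>u\<close> with the two eigenvalues exchanged. \<open>u\<close> may
  vanish, and its eigenvalues need not belong to a path. The scalars are defined because a removable
  and an addable box never share a content.\<close>

lemma gen_idem:
  assumes "young_path (m' # r # R)"
  defines "a \<equiv> ct r" and "b \<equiv> ct m'" and "k \<equiv> Suc (length R)"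
  defines "w \<equiv> idem (m' # r # R)" and "u \<equiv> intertwiner k * idem (m' # r # R)"
  shows "a \<noteq> b" "\<sigma> k * w = (\<kappa> * b / (b - a)) *\<^sub>C w + (1 / (a - b)) *\<^sub>C u"
    "eig R u" "y k * u = b *\<^sub>C u" "y (Suc k) * u = a *\<^sub>C u"
proof -
  have pV: "young_path (r # R)" and m': "m' \<in> addable (set (r # R))" and yV: "young_diagram (set (r # R))"
    and r: "r \<in> addable (set R)" and yR: "young_diagram (set R)"
    using assms(1) young_path_young[of "r # R"] young_path_young[of R] by auto
  have "r \<in> removable (set (r # R))" using addable_as_removable[OF yR r] by simp
  then show ab: "a \<noteq> b" using removable_addable_diag[OF yV _ m'] by (simp add: a_def b_def ct_eq_iff)
  have e: "eig R w" "y k * w = a *\<^sub>C w" "y (Suc k) * w = b *\<^sub>C w"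
    using eig_idem[OF assms(1)] by (auto simp: w_def a_def b_def k_def)
  have u: "u = (a - b) *\<^sub>C (\<sigma> k * w) + (\<kappa> * b) *\<^sub>C w"
    unfolding u_def using intertwiner_eigen[OF e(2,3)] by (simp add: w_def)
  have "(1 / (a - b)) *\<^sub>C u = \<sigma> k * w + (\<kappa> * b / (a - b)) *\<^sub>C w"
    unfolding u using ab by (simp add: scaleC_add_right scaleC_scaleC scaleC_one)
  moreover have "\<kappa> * b / (a - b) = - (\<kappa> * b / (b - a))" by (metis minus_diff_eq minus_divide_right)
  ultimately show "\<sigma> k * w = (\<kappa> * b / (b - a)) *\<^sub>C w + (1 / (a - b)) *\<^sub>C u"
    by (simp only: scaleC.scale_minus_left) simp
  show "eig R u" using eig_intertwiner[OF e(1)] by (simp add: u_def w_def k_def)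
  have uw: "u = intertwiner k * w" by (simp only: u_def w_def)
  have "1 \<le> k" by (simp add: k_def)
  note i = intertwiner_props(1,2)[OF this]
  show "y k * u = b *\<^sub>C u"
    unfolding uw mult.assoc[symmetric] i(1) by (simp only: mult.assoc e mult_scaleC_right)
  show "y (Suc k) * u = a *\<^sub>C u"
    unfolding uw mult.assoc[symmetric] i(2) by (simp only: mult.assoc e mult_scaleC_right)
qed

text \<open>The exchanged part has \<open>y k\<close>-eigenvalue \<open>ct m'\<close>, different
  from \<open>ct r\<close>, so the left factor kills it and only the diagonal part survives.\<close>

lemma idem_gen_idem:
  assumes "young_path (m' # r # R)"
  shows "idem (r # R) * \<sigma> (Suc (length R)) * idem (m' # r # R) =
    (\<kappa> * ct m' / (ct m' - ct r)) *\<^sub>C idem (m' # r # R)"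
proof -
  note g = gen_idem[OF assms]
  have p: "young_path (r # R)" using assms by simp
  have "idem (r # R) * (intertwiner (Suc (length R)) * idem (m' # r # R)) = 0"
    by (rule idem_kill[OF p g(4)]) (use g(1) in auto)
  moreover have "idem (r # R) * idem (m' # r # R) = idem (m' # r # R)"
    using eig_idem[OF assms] by (intro idem_mult_eig[OF p]) (simp del: idem.simps)
  ultimately show ?thesis
    by (simp only: mult.assoc g(2) distrib_left mult_scaleC_right scaleC.scale_zero_right add_0_right)
qed

text \<open>For distinct paths the diagonal part is killed by orthogonality. The exchanged part
  survives only if the two paths agree up to the order of the last two boxes.\<close>

lemma idem_gen_idem_nonzero:
  assumes p: "young_path (m' # r' # R)" "young_path (m # r # R')" "length R' = length R"
    and nz: "idem (m # r # R') * \<sigma> (Suc (length R)) * idem (m' # r' # R) \<noteq> 0"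
  shows "m # r # R' = m' # r' # R \<or> R' = R \<and> m = r' \<and> r = m' \<and> r \<noteq> r'"
proof (rule ccontr)
  assume H: "\<not> ?thesis"
  note g = gen_idem[OF p(1)]
  let ?w = "idem (m' # r' # R)" and ?u = "intertwiner (Suc (length R)) * idem (m' # r' # R)"
  have "idem (m # r # R') * ?w = 0"
    using H p eig_idem[OF p(1)] by (intro idem_orthogonal[OF p(2,1)]) (auto simp del: idem.simps)
  then have u: "idem (m # r # R') * ?u \<noteq> 0"
    using nz by (auto simp only: mult.assoc g(2) distrib_left mult_scaleC_right scaleC.scale_zero_right add_0_left)
  have pr: "young_path (r # R')" "young_path R'" "young_path R" and r: "r \<in> addable (set R')"
    and m: "m \<in> addable (insert r (set R'))" and r': "r' \<in> addable (set R)"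
    and m': "m' \<in> addable (insert r' (set R))"
    using p by auto
  note yR = young_path_young[OF pr(3)]
  have u1: "idem (r # R') * ?u \<noteq> 0"
    using u unfolding idem_Cons'[of m] by (auto simp only: mult.assoc mult_zero_right)
  then have "idem R' * ?u \<noteq> 0"
    unfolding idem_Cons'[of r] by (auto simp only: mult.assoc mult_zero_right)
  then have R: "R' = R" using idem_orthogonal[OF pr(2,3) _ g(3)] p(3) by auto
  have "y (Suc (length R')) * ?u = ct m' *\<^sub>C ?u" using g(4) by (simp only: p(3))
  from idem_kill[OF pr(1) this] u1 have "ct r = ct m'" by metis
  moreover have "y (Suc (length (r # R'))) * ?u = ct r' *\<^sub>C ?u" using g(5) by (simp only: p(3) list.size(4) add_Suc_right add_0_right)
  from idem_kill[OF p(2) this] u have "ct m = ct r'" by metis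
  ultimately have c: "ct r = ct m'" "ct m = ct r'" by auto
  have ne: "r \<noteq> r'" using c g(1) by auto
  \<comment> \<open>Contents determine boxes only among the addable boxes of one diagram:
    \<open>r\<close> and \<open>m'\<close> are both addable after \<open>r'\<close>, and
    \<open>m\<close> and \<open>r'\<close> both after \<open>r\<close>.\<close>
  have "r \<in> addable (insert r' (set R))" "r' \<in> addable (insert r (set R))"
    using addable_insert[OF _ _ ne] addable_insert[OF _ _ ne[symmetric]] r r' R by auto
  moreover have "inj_on ct (addable (insert r' (set R)))" "inj_on ct (addable (insert r (set R)))"
    using inj_on_ct_addable addable_young r r' R by auto
  ultimately have "r = m'" "m = r'" using c m m' R by (auto simp: inj_on_def)
  then show False using H R ne by blast
qed

lemma resolve_sandwich:
  "X * h0 * s * h1 * (Z::'a) = (\<Sum>U\<in>paths n. \<Sum>V\<in>paths n. X * h0 * idem U * s * idem V * h1 * Z)"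
proof -
  have "X * h0 * s * h1 * Z = X * h0 * (\<Sum>U\<in>paths n. idem U) * s * (\<Sum>V\<in>paths n. idem V) * h1 * Z"
    using idem_sum_paths[of n] by simp
  also have "\<dots> = (\<Sum>V\<in>paths n. \<Sum>U\<in>paths n. X * h0 * idem U * s * idem V * h1 * Z)"
    by (simp add: sum_distrib_left sum_distrib_right)
  also have "\<dots> = (\<Sum>U\<in>paths n. \<Sum>V\<in>paths n. X * h0 * idem U * s * idem V * h1 * Z)"
    by (rule sum.swap)
  finally show ?thesis .
qed

lemma sum_multiple:
  assumes "\<And>x. x \<in> A \<Longrightarrow> \<exists>c. f x = c *\<^sub>C (w::'a)"
  shows "\<exists>c. sum f A = c *\<^sub>C w"
proof -
  obtain c where "\<And>x. x \<in> A \<Longrightarrow> f x = c x *\<^sub>C w" using assms by metis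
  then have "sum f A = (\<Sum>x\<in>A. c x) *\<^sub>C w" by (simp add: scaleC.scale_sum_left)
  then show ?thesis by blast
qed

text \<open>The two claims need each other in the induction over \<open>bimod\<close>. In a sandwich
  \<open>h0 * \<sigma> n * h1\<close>, insert the resolution of 1 on both sides of
  \<open>\<sigma> n\<close>. Vanishing between different shapes leaves paths \<open>U\<close>,
  \<open>V\<close> with the shapes of \<open>T0\<close> and \<open>S0\<close>; the entry of
  \<open>\<sigma> n\<close> between \<open>m # U\<close> and \<open>m' # V\<close> vanishes unless
  \<open>T\<close> and \<open>S\<close> have equal shapes, and for \<open>T = S\<close> unless
  \<open>U = V\<close>. The remaining diagonal entry is a scalar, which reduces the product to
  one-dimensionality at level n.\<close>

lemma corner_algebra:
  assumes "T \<in> paths n" "S \<in> paths n" "h \<in> H n"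
  shows "(set T \<noteq> set S \<longrightarrow> idem T * h * idem S = 0) \<and> (T = S \<longrightarrow> (\<exists>c. idem T * h * idem S = c *\<^sub>C idem T))"
  using assms
proof (induction n arbitrary: T S h)
  case 0
  from \<open>h \<in> H 0\<close> have "\<exists>c. h = c *\<^sub>C 1"
  proof (induction rule: hecke_alg_induct)
    case one
    show ?case by (rule exI[of _ 1]) (simp add: scaleC_one)
  qed (auto simp: scaleC_scaleC scaleC_add_left[symmetric])
  then show ?case using 0 by (auto simp: paths_def)
next
  case (Suc n)
  obtain m T0 m' S0 where TS: "T = m # T0" "S = m' # S0"
    using Suc.prems by (auto simp: paths_def length_Suc_conv)
  have pT: "young_path (m # T0)" "length T0 = n" and pS: "young_path (m' # S0)" "length S0 = n"
    using Suc.prems TS by (auto simp: paths_def)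
  have pT0: "T0 \<in> paths n" "S0 \<in> paths n" using pT pS by (auto simp: paths_def)
  have mT: "m \<in> addable (set T0)" and mS: "m' \<in> addable (set S0)" using pT pS by auto
  let ?Y = "y (Suc n)"
  let ?L = "poly_apply (lag (set T0) m) ?Y" and ?L' = "poly_apply (lag (set S0) m') ?Y"
  have LT: "idem T = idem T0 * ?L" "idem T = ?L * idem T0"
    using idem_Cons'[of m T0] by (simp_all add: TS pT)
  have LS: "idem S = idem S0 * ?L'" "idem S = ?L' * idem S0"
    using idem_Cons'[of m' S0] by (simp_all add: TS pS)
  have LT2: "?L * idem T = idem T"
    using idem_idem[OF pT(1)] eig_idem[OF pT(1)] poly_apply_eigen_left[of ?Y "idem T" "ct m" "lag (set T0) m"]
      poly_lag[OF young_path_young mT mT] pT TS by (simp add: scaleC_one)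
  have comm: "poly_apply p ?Y * x = x * poly_apply p ?Y" if "x \<in> H n" for x p
    using jm_commute_alg[OF that] by (intro poly_apply_intertwine) simp
  have IH0: "idem T0 * x * idem U = 0" "idem U * x * idem T0 = 0" if "U \<in> paths n" "set U \<noteq> set T0" "x \<in> H n" for x U
    using Suc.IH[OF pT0(1) that(1,3)] Suc.IH[OF that(1) pT0(1) that(3)] that by auto
  have IHS: "idem U * x * idem S0 = 0" if "U \<in> paths n" "set U \<noteq> set S0" "x \<in> H n" for x U
    using Suc.IH[OF that(1) pT0(2) that(3)] that by auto
  have IHd: "\<exists>c. idem T0 * x * idem T0 = c *\<^sub>C idem T0" if "x \<in> H n" for x
    using Suc.IH[OF pT0(1) pT0(1) that] by blast
  have diag: "\<exists>c. idem T * x * idem T = c *\<^sub>C idem T" if x: "x \<in> H n" for x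
  proof -
    obtain c where c: "idem T0 * x * idem T0 = c *\<^sub>C idem T0" using IHd[OF x] by blast
    have "idem T * x * idem T = (?L * idem T0) * x * (idem T0 * ?L)"
      using LT by simp
    also have "\<dots> = ?L * (idem T0 * x * idem T0) * ?L"
      by (simp only: mult.assoc)
    also have "\<dots> = c *\<^sub>C (?L * idem T)"
      unfolding c by (simp only: mult_scaleC_left mult_scaleC_right mult.assoc LT(1))
    finally show ?thesis using LT2 by auto
  qed
  have offdiag: "idem T * x * idem S = 0" if x: "x \<in> H n" and ne: "set T \<noteq> set S" for x
  proof (cases "set T0 = set S0")
    case False
    have "idem T * x * idem S = ?L * (idem T0 * x * idem S0) * ?L'"
      by (simp only: LT(2) LS(1) mult.assoc)
    then show ?thesis using Suc.IH[OF pT0 x] False by simp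
  next
    case True
    then have "m \<noteq> m'" using ne TS by auto
    then have ne: "ct m \<noteq> ct m'"
      using inj_on_ct_addable[OF young_path_young[of T0]] mT mS True pT by (auto simp: inj_on_def)
    let ?X = "idem T * x * idem S"
    have "ct m *\<^sub>C ?X = (?Y * idem T) * x * idem S"
      using eig_idem[OF pT(1)] pT(2) TS by (simp add: mult_scaleC_left)
    also have "?Y * idem T = idem T * ?Y" by (rule jm_commute_idem) simp
    also have "idem T * ?Y * x * idem S = idem T * (x * ?Y) * idem S"
      by (simp only: mult.assoc jm_commute_alg[OF x])
    also have "\<dots> = idem T * x * (?Y * idem S)" by (simp only: mult.assoc)
    also have "\<dots> = ct m' *\<^sub>C ?X"
      using eig_idem[OF pS(1)] pS(2) TS by (simp add: mult_scaleC_right)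
    finally have "(ct m - ct m') *\<^sub>C ?X = 0"
      by (simp only: scaleC.scale_left_diff_distrib right_minus_eq)
    then show ?thesis using ne by simp
  qed
  \<comment> \<open>The last Lagrange factor of \<open>idem T\<close> commutes with
    \<open>H n\<close> and depends on the shape only, so it passes through \<open>x\<close> and
    extends \<open>idem U\<close> by the box \<open>m\<close>.\<close>
  have fold_left: "idem T * x * idem U = idem T0 * x * idem (m # U)"
    if "x \<in> H n" "U \<in> paths n" "set U = set T0" for x U
  proof -
    have "idem T * x * idem U = idem T0 * (?L * x) * idem U" by (simp only: LT(1) mult.assoc)
    also have "\<dots> = idem T0 * x * (?L * idem U)" by (simp only: comm[OF that(1)] mult.assoc)
    also have "?L * idem U = idem (m # U)" using idem_Cons'[of m U] that by (simp add: paths_def)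
    finally show ?thesis .
  qed
  have fold_right: "idem V * x * idem S = idem (m' # V) * x * idem S0"
    if "x \<in> H n" "V \<in> paths n" "set V = set S0" for x V
  proof -
    have "idem V * x * idem S = idem V * (x * ?L') * idem S0" by (simp only: LS(2) mult.assoc)
    also have "\<dots> = idem V * ?L' * x * idem S0" by (simp only: comm[OF that(1), symmetric] mult.assoc)
    also have "idem V * ?L' = idem (m' # V)" using that by (simp add: paths_def)
    finally show ?thesis .
  qed
  have sandwich: "idem T * h0 * idem U * \<sigma> n * idem V * h1 * idem S =
      idem T0 * h0 * (idem (m # U) * \<sigma> n * idem (m' # V)) * h1 * idem S0"
    if "h0 \<in> H n" "h1 \<in> H n" "U \<in> paths n" "set U = set T0" "V \<in> paths n" "set V = set S0" for h0 h1 U V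
  proof -
    have "idem T * h0 * idem U * \<sigma> n * idem V * h1 * idem S =
        (idem T * h0 * idem U) * \<sigma> n * (idem V * h1 * idem S)" by (simp only: mult.assoc)
    also have "\<dots> = (idem T0 * h0 * idem (m # U)) * \<sigma> n * (idem (m' # V) * h1 * idem S0)"
      by (simp only: fold_left[OF that(1,3,4)] fold_right[OF that(2,5,6)])
    also have "\<dots> = idem T0 * h0 * (idem (m # U) * \<sigma> n * idem (m' # V)) * h1 * idem S0"
      by (simp only: mult.assoc)
    finally show ?thesis .
  qed
  have vanish: "idem T * h0 * idem U * \<sigma> n * idem V * h1 * idem S = 0"
    if "h0 \<in> H n" "h1 \<in> H n" "U \<in> paths n" "V \<in> paths n" "set U \<noteq> set T0 \<or> set V \<noteq> set S0" for h0 h1 U V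
    using that(5)
  proof
    assume "set U \<noteq> set T0"
    then have "idem T * h0 * idem U = 0" using IH0(1)[OF that(3) _ that(1)] LT(2) by (simp add: mult.assoc)
    then show ?thesis by simp
  next
    assume "set V \<noteq> set S0"
    then have "idem V * h1 * idem S = 0"
      using IHS[OF that(4) _ that(2)] LS(1) by (simp add: mult.assoc[symmetric] del: idem.simps)
    moreover have "idem T * h0 * idem U * \<sigma> n * idem V * h1 * idem S =
        idem T * h0 * idem U * \<sigma> n * (idem V * h1 * idem S)" by (simp only: mult.assoc)
    ultimately show ?thesis by simp
  qed
  have split_path: "\<exists>r R. U = r # R \<and> length R = n - 1" if "U \<in> paths n" "n \<ge> 1" for U
    using that by (cases U) (auto simp: paths_def)
  have "h \<in> bimod n" using Suc.prems(3) alg_Suc_subset_bimod by blast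
  then show ?case
  proof (induction rule: bimod.induct)
    case (base x)
    then show ?case using diag offdiag TS by auto
  next
    case (add x x')
    then show ?case
      by (auto simp: distrib_left distrib_right scaleC_add_left[symmetric])
  next
    case prems: (sandwich h0 h1)
    note h = prems(2,3)
    \<comment> \<open>An exchange of the last two boxes keeps the shape. If \<open>T = S\<close> it
      would make \<open>m\<close> equal to the last box of \<open>V\<close>, to which
      \<open>m\<close> is addable; so only the diagonal case remains.\<close>
    have K: "idem (m # U) * \<sigma> n * idem (m' # V) = 0 \<or> set T = set S \<and> (T = S \<longrightarrow> U = V)"
      if UV: "U \<in> paths n" "V \<in> paths n" "set U = set T0" "set V = set S0" for U V
    proof -
      obtain r R' r' R where R: "U = r # R'" "V = r' # R" "length R' = n - 1" "length R = n - 1"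
        using split_path UV prems(1) by metis
      have p: "young_path (m' # r' # R)" "young_path (m # r # R')"
        using mT mS UV R by (auto simp: paths_def)
      have "m' \<noteq> r'" using p by (auto simp: addable_def)
      have S: "set S = insert m' (insert r' (set R))" "set T = insert m (insert r (set R'))"
        using TS UV R by auto
      show ?thesis
        using idem_gen_idem_nonzero[OF p] R prems(1) S TS \<open>m' \<noteq> r'\<close> by auto
    qed
    note res = resolve_sandwich[of "idem T" h0 "\<sigma> n" h1 "idem S" n]
    have off: "idem T * (h0 * \<sigma> n * h1) * idem S = 0" if ne: "set T \<noteq> set S"
    proof -
      have "idem T * h0 * idem U * \<sigma> n * idem V * h1 * idem S = 0" if UV: "U \<in> paths n" "V \<in> paths n" for U V
      proof (cases "set U = set T0 \<and> set V = set S0")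
        case True
        then show ?thesis using K[OF UV] ne sandwich[OF h UV(1) _ UV(2)] by auto
      qed (use vanish[OF h UV] in blast)
      then have "idem T * h0 * \<sigma> n * h1 * idem S = 0"
        unfolding res by (intro sum.neutral ballI)
      then show ?thesis by (simp only: mult.assoc)
    qed
    have "\<exists>c. idem T * (h0 * \<sigma> n * h1) * idem S = c *\<^sub>C idem T" if eq: "T = S"
    proof -
      have e: "m' = m" "S0 = T0" using eq TS by auto
      have "\<exists>c. idem T * h0 * idem U * \<sigma> n * idem V * h1 * idem S = c *\<^sub>C idem T"
        if UV: "U \<in> paths n" "V \<in> paths n" for U V
      proof (cases "set U = set T0 \<and> set V = set S0 \<and> idem (m # U) * \<sigma> n * idem (m' # V) \<noteq> 0")
        case True
        then have sets: "set U = set T0" "set V = set S0" and U: "U = V"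
          using K[OF UV] eq by auto
        obtain r R where V: "V = r # R" "length R = n - 1" using split_path[OF UV(2) prems(1)] by auto
        have pV: "young_path (m # r # R)" using UV V sets e mS by (auto simp: paths_def)
        define b where "b = \<kappa> * ct m / (ct m - ct r)"
        let ?LV = "poly_apply (lag (set V) m) (y (Suc (length V)))"
        have "idem (m # V) * \<sigma> n * idem (m # V) = ?LV * (idem V * \<sigma> n * idem (m # V))"
          by (simp only: idem_Cons' mult.assoc)
        also have "idem V * \<sigma> n * idem (m # V) = b *\<^sub>C idem (m # V)"
          using idem_gen_idem[OF pV] V prems(1) by (simp add: b_def del: idem.simps)
        also have "?LV * (b *\<^sub>C idem (m # V)) = b *\<^sub>C (?LV * idem (m # V))"
          by (rule mult_scaleC_right)
        finally have K': "idem (m # V) * \<sigma> n * idem (m # V) = b *\<^sub>C (?LV * idem (m # V))" .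
        have "?LV * idem (m # V) = poly (lag (set V) m) (ct m) *\<^sub>C idem (m # V)"
          using eig_idem[OF pV] V by (intro poly_apply_eigen_left) (simp del: idem.simps)
        then have LV: "?LV * idem (m # V) = idem (m # V)"
          using poly_lag[OF young_path_young, of V m m] pV V by (simp add: scaleC_one del: idem.simps)
        obtain c where c: "idem T0 * (h0 * idem V * h1) * idem T0 = c *\<^sub>C idem T0"
          using IHd[of "h0 * idem V * h1"] h idem_in_alg[of V] UV by (auto simp: paths_def)
        have "idem T * h0 * idem U * \<sigma> n * idem V * h1 * idem S =
            idem T0 * h0 * (b *\<^sub>C idem (m # V)) * h1 * idem T0"
          unfolding sandwich[OF h UV(1) sets(1) UV(2) sets(2)] using K' LV U e by simp
        also have "\<dots> = b *\<^sub>C ((idem T0 * h0 * idem (m # V)) * h1 * idem T0)"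
          by (simp only: mult_scaleC_right mult_scaleC_left)
        also have "idem T0 * h0 * idem (m # V) = idem T * h0 * idem V"
          using fold_left[OF h(1) UV(2)] sets e by simp
        also have "idem T * h0 * idem V * h1 * idem T0 = ?L * (idem T0 * (h0 * idem V * h1) * idem T0)"
          by (simp only: LT(2) mult.assoc)
        also have "\<dots> = c *\<^sub>C idem T" by (simp only: c mult_scaleC_right LT(2))
        finally show ?thesis by (auto simp: scaleC_scaleC)
      next
        case False
        then have "idem T * h0 * idem U * \<sigma> n * idem V * h1 * idem S = 0"
          using vanish[OF h UV] sandwich[OF h UV(1) _ UV(2)] by (cases "set U = set T0 \<and> set V = set S0") auto
        then show ?thesis by (intro exI[of _ 0]) simp
      qed
      then have "\<exists>c. idem T * h0 * \<sigma> n * h1 * idem S = c *\<^sub>C idem T"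
        unfolding res by (intro sum_multiple)
      then show ?thesis by (simp only: mult.assoc)
    qed
    with off show ?case by blast
  qed
qed

text \<open>\<open>e\<close> is fixed by \<open>idem T\<close> from both sides and hence lies in a
  one-dimensional corner; a nonzero idempotent multiple of an idempotent has coefficient 1.\<close>

lemma eigen_idempotent_unique:
  assumes T: "young_path T" and e: "e \<in> H (length T)" "e * e = e" "e \<noteq> 0" "eig T e"
    and right: "\<And>i. i < length T \<Longrightarrow> e * y (Suc i) = ct (rev T ! i) *\<^sub>C e"
  shows "e = idem T"
proof -
  have "T \<in> paths (length T)" using T by (simp add: paths_def)
  then obtain c where c: "idem T * e * idem T = c *\<^sub>C idem T"
    using corner_algebra[OF _ _ e(1)] by blast
  then have e': "e = c *\<^sub>C idem T"
    using idem_mult_eig[OF T e(4)] mult_idem_right_eig[OF T right] by simp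
  have "c *\<^sub>C e = c *\<^sub>C (c *\<^sub>C idem T)" by (simp add: e')
  also have "\<dots> = e * e"
    by (simp add: e' mult_scaleC_left mult_scaleC_right idem_idem[OF T])
  finally have "(c - 1) *\<^sub>C e = 0" using e(2) by (simp add: scaleC.scale_left_diff_distrib scaleC_one)
  then show ?thesis using e(3) e' by (simp add: scaleC_one)
qed

end

section \<open>The Ocneanu trace of the idempotents\<close>

locale ocneanu = hecke +
  fixes d :: complex and Tr :: "nat \<Rightarrow> 'a \<Rightarrow> 'a"
  assumes maps: "ocneanu_maps q d \<sigma> Tr"
begin

lemma Tr_in_alg: "Z \<in> H (Suc n) \<Longrightarrow> Tr (Suc n) Z \<in> H n"
  using maps by (simp add: ocneanu_maps_def)

lemma Tr_add: "Z \<in> H (Suc n) \<Longrightarrow> Z' \<in> H (Suc n) \<Longrightarrow> Tr (Suc n) (Z + Z') = Tr (Suc n) Z + Tr (Suc n) Z'"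
  using maps by (simp add: ocneanu_maps_def)

lemma Tr_scaleC: "Z \<in> H (Suc n) \<Longrightarrow> Tr (Suc n) (a *\<^sub>C Z) = a *\<^sub>C Tr (Suc n) Z"
  using maps by (simp add: ocneanu_maps_def)

lemma Tr_base: "X \<in> H n \<Longrightarrow> Tr (Suc n) X = z_param q d *\<^sub>C X"
  using maps by (simp add: ocneanu_maps_def)

lemma Tr_bimodule:
  "X \<in> H n \<Longrightarrow> Y \<in> H n \<Longrightarrow> Z \<in> H (Suc n) \<Longrightarrow> Tr (Suc n) (X * Z * Y) = X * Tr (Suc n) Z * Y"
  using maps by (simp add: ocneanu_maps_def)

lemma Tr_gen: "n \<ge> 1 \<Longrightarrow> Tr (Suc n) (\<sigma> n) = 1"
  using maps by (simp add: ocneanu_maps_def)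

lemma Tr_left: "X \<in> H n \<Longrightarrow> Z \<in> H (Suc n) \<Longrightarrow> Tr (Suc n) (X * Z) = X * Tr (Suc n) Z"
  using Tr_bimodule[of X n 1 Z] by simp

lemma Tr_right: "X \<in> H n \<Longrightarrow> Z \<in> H (Suc n) \<Longrightarrow> Tr (Suc n) (Z * X) = Tr (Suc n) Z * X"
  using Tr_bimodule[of 1 n X Z] by simp

lemma Tr_sum:
  assumes "\<And>i. i \<in> A \<Longrightarrow> f i \<in> H (Suc n)"
  shows "Tr (Suc n) (sum f A) = (\<Sum>i\<in>A. Tr (Suc n) (f i))"
  using assms
proof (induction A rule: infinite_finite_induct)
  case (insert i A)
  then show ?case by (simp add: Tr_add hecke_alg_sum)
qed (use Tr_scaleC[of 0 n 0] in simp_all)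

lemma idem_Cons_in_alg: "idem (m # T) \<in> H (Suc (length T))"
  using idem_in_alg[of "m # T"] by simp

text \<open>\<open>idem (m # T)\<close> is a polynomial in the next Jucys-Murphy element between two
  copies of \<open>idem T\<close>, so the bimodule property places its partial trace in the
  one-dimensional corner of \<open>idem T\<close>.\<close>

lemma Tr_idem_multiple:
  assumes "young_path (m # T)"
  shows "\<exists>c. Tr (Suc (length T)) (idem (m # T)) = c *\<^sub>C idem T"
proof -
  let ?n = "length T" let ?L = "poly_apply (lag (set T) m) (y (Suc ?n))"
  have T: "young_path T" using assms by simp
  have L: "?L \<in> H (Suc ?n)" by (intro hecke_alg_poly_apply jm_in_alg) simp
  have "idem T * ?L = ?L * idem T" by (simp only: poly_apply_commute_idem[of "Suc ?n"] le_numeral_extra One_nat_def Suc_le_mono le0)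
  then have "idem T * ?L * idem T = ?L * (idem T * idem T)" by (simp only: mult.assoc)
  then have "idem T * ?L * idem T = idem (m # T)"
    by (simp only: idem_idem[OF T] idem_Cons')
  then have "Tr (Suc ?n) (idem (m # T)) = idem T * Tr (Suc ?n) ?L * idem T"
    using Tr_bimodule[OF idem_in_alg[of T] idem_in_alg[of T] L] by simp
  moreover have "T \<in> paths ?n" using T by (simp add: paths_def)
  ultimately show ?thesis using corner_algebra[OF _ _ Tr_in_alg[OF L]] by auto
qed

text \<open>The solution in \<open>cauchy_system\<close> with contents as \<open>f\<close> and
  \<open>g\<close>, \<open>k = \<kappa>\<close> and \<open>b = q powr (- 2 * d)\<close>, for which
  \<open>z_param q d\<close> is (1 - b)/k.\<close>

definition weight :: "(nat \<times> nat) set \<Rightarrow> nat \<times> nat \<Rightarrow> complex" where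
  "weight lam m = (1 - q powr (- 2 * d) / ct m) / \<kappa> *
     ((\<Prod>r\<in>removable lam. ct m - ct r) / (\<Prod>m'\<in>addable lam - {m}. ct m - ct m'))"

text \<open>The coefficients \<open>c\<close> depend on the shape only: \<open>Tr\<^bsub>n+1\<^esub>\<close> maps polynomials in \<open>y\<^bsub>n+1\<^esub>\<close> to central
  elements of \<open>H\<^sub>n\<close>.\<close>

lemma Tr_idem_link:
  assumes l: "link T S" "set S = set T" and p: "young_path (m # T)" "young_path (m # S)" and nz: "idem T \<noteq> 0"
    and c: "Tr (Suc (length T)) (idem (m # T)) = c *\<^sub>C idem T"
    and c': "Tr (Suc (length T)) (idem (m # S)) = c' *\<^sub>C idem S"
  shows "idem S \<noteq> 0" "c = c'"
proof -
  let ?n = "length T" let ?L = "poly_apply (lag (set T) m) (y (Suc ?n))"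
  have len: "length S = ?n" using l by (simp add: link_def)
  have pT: "young_path T" "young_path S" using p by auto
  obtain x x' where x: "x \<in> H ?n" "eig S (x * idem T)" "x' * (x * idem T) = idem T"
    using l(1) eig_idem[OF pT(1)] by (auto simp: link_def)
  define v where "v = x * idem T"
  have v: "v \<noteq> 0" using x(3) nz by (auto simp: v_def)
  have Sv: "idem S * v = v" using idem_mult_eig[OF pT(2)] x(2) by (simp add: v_def)
  then show "idem S \<noteq> 0" using v by auto
  have L: "?L \<in> H (Suc ?n)" by (intro hecke_alg_poly_apply jm_in_alg) simp
  define \<tau> where "\<tau> = Tr (Suc ?n) ?L"
  have xL: "?L * x = x * ?L" using jm_commute_alg[OF x(1)] by (intro poly_apply_intertwine) simp
  then have x\<tau>: "\<tau> * x = x * \<tau>" using Tr_left[OF x(1) L] Tr_right[OF x(1) L] by (simp add: \<tau>_def)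
  have "\<tau> * idem T = c *\<^sub>C idem T"
    using Tr_right[OF idem_in_alg L] c by (simp only: idem_Cons' \<tau>_def)
  then have "\<tau> * v = c *\<^sub>C v"
    by (simp add: v_def mult.assoc[symmetric] x\<tau>) (simp add: mult.assoc mult_scaleC_right)
  moreover have "\<tau> * idem S = c' *\<^sub>C idem S"
    using Tr_right[OF idem_in_alg[of S, unfolded len] L] c' by (simp only: idem_Cons' \<tau>_def l(2) len)
  then have "\<tau> * (idem S * v) = c' *\<^sub>C v"
    by (simp only: mult.assoc[symmetric]) (simp only: mult_scaleC_left Sv)
  ultimately have "(c - c') *\<^sub>C v = 0"
    by (simp add: Sv scaleC.scale_left_diff_distrib)
  then show "c = c'" using v by simp
qed

theorem Tr_idem:
  assumes "young_path (m # T)" "idem T \<noteq> 0"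
  shows "Tr (Suc (length T)) (idem (m # T)) = weight (set T) m *\<^sub>C idem T"
proof -
  let ?n = "length T" let ?A = "addable (set T)" let ?R = "removable (set T)"
  have pT: "young_path T" and m: "m \<in> ?A" and yT: "young_diagram (set T)"
    using assms(1) young_path_young by auto
  note fin = finite_addable[OF yT] finite_removable[OF yT]
  have "\<forall>m\<in>?A. \<exists>c. Tr (Suc ?n) (idem (m # T)) = c *\<^sub>C idem T"
    using Tr_idem_multiple pT by simp
  then obtain c where c: "\<And>m. m \<in> ?A \<Longrightarrow> Tr (Suc ?n) (idem (m # T)) = c m *\<^sub>C idem T" by metis
  have eq0: "(\<Sum>m\<in>?A. c m) = z_param q d"
  proof -
    have "z_param q d *\<^sub>C idem T = Tr (Suc ?n) (\<Sum>m\<in>?A. idem (m # T))"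
      unfolding idem_sum_Cons[OF pT] by (rule Tr_base[OF idem_in_alg, symmetric])
    also have "\<dots> = (\<Sum>m\<in>?A. Tr (Suc ?n) (idem (m # T)))"
      by (rule Tr_sum) (rule idem_Cons_in_alg)
    also have "\<dots> = (\<Sum>m\<in>?A. c m) *\<^sub>C idem T" using c by (simp add: scaleC.scale_sum_left)
    finally show ?thesis using assms(2) by simp
  qed
  have eqs: "(\<Sum>m\<in>?A. \<kappa> * ct m / (ct m - ct r) * c m) = 1" if r: "r \<in> ?R" for r
  proof -
    \<comment> \<open>The equation for \<open>r\<close> needs a tableau of the same shape ending in
      \<open>r\<close>; the link carries nonvanishing and the coefficients \<open>c\<close> over to
      it.\<close>
    obtain Q where Q: "young_path (r # Q)" "set (r # Q) = set T" "link T (r # Q)"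
      using corner_link[OF pT r] .
    define S where "S = r # Q"
    have S: "young_path S" "set S = set T" "link T S" "length S = ?n" "?n = Suc (length Q)"
      using Q by (simp_all add: S_def) (simp_all add: link_def)
    have cS: "idem S \<noteq> 0" "Tr (Suc ?n) (idem (m # S)) = c m *\<^sub>C idem S" if m: "m \<in> ?A" for m
    proof -
      have p: "young_path (m # S)" using S m by simp
      obtain c' where c': "Tr (Suc ?n) (idem (m # S)) = c' *\<^sub>C idem S"
        using Tr_idem_multiple[OF p] S by auto
      have "young_path (m # T)" using m pT by simp
      from Tr_idem_link[OF S(3,2) this p assms(2) c[OF m] c']
      show "idem S \<noteq> 0" "Tr (Suc ?n) (idem (m # S)) = c m *\<^sub>C idem S"
        using c' by auto
    qed
    have g: "\<sigma> ?n \<in> H (Suc ?n)" using S(5) by (intro hecke_alg_gen) auto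
    have iS: "idem S \<in> H ?n" using idem_in_alg[of S] S by simp
    have p: "young_path (m # r # Q)" if "m \<in> ?A" for m
      using Q that by simp
    \<comment> \<open>The trace of \<open>\<sigma>\<close> is 1, so the bimodule property leaves
      \<open>idem S * idem S\<close>. Below, the right factor \<open>idem S\<close> is split over
      the addable boxes.\<close>
    have "idem S = Tr (Suc ?n) (idem S * \<sigma> ?n * idem S)"
      using Tr_bimodule[OF iS iS g] Tr_gen[of ?n] S idem_idem by simp
    also have "idem S * \<sigma> ?n * idem S = (\<Sum>m\<in>?A. idem S * \<sigma> ?n * idem (m # S))"
      using idem_sum_Cons[OF S(1)] S(2) by (simp only: sum_distrib_left[symmetric])
    also have "\<dots> = (\<Sum>m\<in>?A. (\<kappa> * ct m / (ct m - ct r)) *\<^sub>C idem (m # S))"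
      using idem_gen_idem[OF p] S(5) by (intro sum.cong) (simp_all add: S_def del: idem.simps)
    also have "Tr (Suc ?n) \<dots> = (\<Sum>m\<in>?A. Tr (Suc ?n) ((\<kappa> * ct m / (ct m - ct r)) *\<^sub>C idem (m # S)))"
      using idem_Cons_in_alg[of _ S] S by (intro Tr_sum hecke_alg_scaleC) auto
    also have "\<dots> = (\<Sum>m\<in>?A. (\<kappa> * ct m / (ct m - ct r) * c m) *\<^sub>C idem S)"
      using idem_Cons_in_alg[of _ S] S cS by (intro sum.cong) (simp_all add: Tr_scaleC scaleC_scaleC del: idem.simps)
    also have "\<dots> = (\<Sum>m\<in>?A. \<kappa> * ct m / (ct m - ct r) * c m) *\<^sub>C idem S"
      by (simp add: scaleC.scale_sum_left)
    finally have "(\<Sum>m\<in>?A. \<kappa> * ct m / (ct m - ct r) * c m) *\<^sub>C idem S = idem S"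
      by (rule sym)
    then have "(\<Sum>m\<in>?A. \<kappa> * ct m / (ct m - ct r) * c m) *\<^sub>C idem S = 1 *\<^sub>C idem S"
      by (simp only: scaleC_one)
    then show ?thesis using cS(1)[OF m] by (simp only: scaleC.scale_cancel_right) blast
  qed
  have "c m = weight (set T) m"
    unfolding weight_def
  proof (rule cauchy_system)
    show "card ?A = card ?R + 1" by (rule corner_counts[OF yT])
    show "inj_on ct ?A" by (rule inj_on_ct_addable[OF yT])
    \<comment> \<open>Of two boxes on one diagonal, the lower one forces the box below the upper one
      into the diagram.\<close>
    show "inj_on ct ?R"
    proof (rule inj_onI)
      fix a b assume ab: "a \<in> ?R" "b \<in> ?R" "ct a = ct b"
      obtain i j i' j' where e: "a = (i, j)" "b = (i', j')" by (cases a, cases b)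
      have *: "(i, j) \<in> set T" "(i + 1, j) \<notin> set T" "(i, j + 1) \<notin> set T"
        "(i', j') \<in> set T" "(i' + 1, j') \<notin> set T" "(i', j' + 1) \<notin> set T"
        using ab e removable_iff[OF yT] by auto
      have pos: "1 \<le> i" "1 \<le> j" "1 \<le> i'" "1 \<le> j'" using young_pos[OF yT] * by auto
      have dg: "int j - int i = int j' - int i'" using ab(3) e by (simp add: ct_eq_iff)
      show "a = b"
      proof (cases i i' rule: linorder_cases)
        case less
        then show ?thesis using young_down[OF yT *(4), of "i + 1" j] * pos dg by auto
      next
        case greater
        then show ?thesis using young_down[OF yT *(1), of "i' + 1" j'] * pos dg by auto
      qed (use dg e in auto)
    qed
    show "ct m \<noteq> ct r" if "m \<in> ?A" "r \<in> ?R" for m r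
      using removable_addable_diag[OF yT that(2,1)] by (auto simp: ct_eq_iff)
    have "(\<Prod>x\<in>?A. q powi (2 * diag x)) = q powi (2 * 0) * (\<Prod>x\<in>?R. q powi (2 * diag x))"
    proof (rule corner_product_eq[OF yT])
      fix k :: int
      have "2 * (k + 1) + 2 * (k - 1) = 2 * k + 2 * k" by simp
      then show "q powi (2 * (k + 1)) * q powi (2 * (k - 1)) = q powi (2 * k) * q powi (2 * k)"
        by (simp only: power_int_add[symmetric] q_nonzero not_False_eq_True simp_thms disjI1)
    qed simp
    then show "prod ct ?A = prod ct ?R" by (simp add: node_content_diag)
    show "\<kappa> * (\<Sum>m\<in>?A. c m) = 1 - q powr (- 2 * d)"
      using kappa_nonzero by (simp only: eq0 z_param_def) simp
  qed (use fin m eqs kappa_nonzero in auto)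
  then show ?thesis using c[OF m] by simp
qed

lemma ocneanu_trace_scaleC: "X \<in> H n \<Longrightarrow> ocneanu_trace Tr n (a *\<^sub>C X) = a *\<^sub>C ocneanu_trace Tr n X"
  by (induction n arbitrary: X) (simp_all add: Tr_scaleC Tr_in_alg)

primrec path_weight :: "(nat \<times> nat) list \<Rightarrow> complex" where
  "path_weight [] = 1"
| "path_weight (m # T) = weight (set T) m * path_weight T"

lemma ocneanu_trace_idem:
  "young_path T \<Longrightarrow> idem T \<noteq> 0 \<Longrightarrow> ocneanu_trace Tr (length T) (idem T) = path_weight T *\<^sub>C 1"
proof (induction T)
  case (Cons m T)
  \<comment> \<open>\<open>idem T\<close> is a factor of \<open>idem (m # T)\<close>, so
    nonvanishing descends along the path.\<close>
  then have nz: "idem T \<noteq> 0" by auto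
  show ?case
    using Tr_idem[OF Cons.prems(1) nz] Cons nz idem_in_alg[of T]
    by (simp add: ocneanu_trace_scaleC scaleC_scaleC del: idem.simps)
qed (simp add: scaleC_one)

end

section \<open>Hook lengths\<close>

lemma hook_length_insert:
  assumes y: "young_diagram lam" and k: "(r1, c1) \<in> addable lam" and x: "(r, c) \<in> lam"
  shows "hook_length (insert (r1, c1) lam) (r, c) = hook_length lam (r, c) + (if r = r1 \<or> c = c1 then 1 else 0)"
proof -
  let ?h = "\<lambda>l. {(r', c'). (r', c') \<in> l \<and> (r' = r \<and> c \<le> c' \<or> c' = c \<and> r \<le> r')}"
  have n: "(r1, c1) \<notin> lam" "r1 \<ge> 1" "c1 \<ge> 1" using k by (auto simp: addable_iff[OF y])
  have fin: "finite (?h lam)" by (rule finite_subset[OF _ young_finite[OF y]]) auto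
  have "r = r1 \<Longrightarrow> c \<le> c1" "c = c1 \<Longrightarrow> r \<le> r1"
    using young_down[OF y x, of r1 c1] n by (meson nat_le_linear order_refl)+
  then have "?h (insert (r1, c1) lam) = (if r = r1 \<or> c = c1 then insert (r1, c1) (?h lam) else ?h lam)"
    by auto
  moreover have "(r1, c1) \<notin> ?h lam" using n by simp
  ultimately show ?thesis using fin by (simp add: hook_length_def)
qed

lemma hook_length_new:
  assumes y: "young_diagram lam" and k: "k \<in> addable lam"
  shows "hook_length (insert k lam) k = 1"
proof -
  obtain r c where rc: "k = (r, c)" by (cases k)
  have n: "(r, c) \<notin> lam" "r \<ge> 1" "c \<ge> 1" using k by (auto simp: rc addable_iff[OF y])
  have "{(r', c'). (r', c') \<in> insert k lam \<and> (r' = r \<and> c \<le> c' \<or> c' = c \<and> r \<le> r')} = {k}"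
    using young_down[OF y, of _ _ r c] n by (auto simp: rc)
  then show ?thesis by (simp add: hook_length_def rc)
qed

text \<open>\<open>C\<close> and \<open>R\<close> are the first free column in row r and the first
  free row in column c; the box itself is counted with its arm.\<close>

lemma hook_length_card:
  assumes "(r, c) \<in> lam" "1 \<le> r" "1 \<le> c"
    and row: "\<And>j. (r, j) \<in> lam \<longleftrightarrow> 1 \<le> j \<and> j < C" and col: "\<And>i. (i, c) \<in> lam \<longleftrightarrow> 1 \<le> i \<and> i < R"
  shows "hook_length lam (r, c) = (C - c) + (R - Suc r)"
proof -
  have "{(r', c'). (r', c') \<in> lam \<and> (r' = r \<and> c \<le> c' \<or> c' = c \<and> r \<le> r')} =
      {r} \<times> {c..<C} \<union> {Suc r..<R} \<times> {c}"
  proof (rule set_eqI)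
    fix x :: "nat \<times> nat" obtain a b where x: "x = (a, b)" by (cases x)
    show "x \<in> {(r', c'). (r', c') \<in> lam \<and> (r' = r \<and> c \<le> c' \<or> c' = c \<and> r \<le> r')} \<longleftrightarrow>
        x \<in> {r} \<times> {c..<C} \<union> {Suc r..<R} \<times> {c}"
      using row[of b] col[of a] assms(1-3) by (cases "a = r") (auto simp: x)
  qed
  moreover have "card ({r} \<times> {c..<C} \<union> {Suc r..<R} \<times> {c}) = (C - c) + (R - Suc r)"
    by (subst card_Un_disjoint) (auto simp: card_cartesian_product)
  ultimately show ?thesis by (simp add: hook_length_def)
qed

section \<open>Hook products under adding boxes\<close>

definition hook_prod :: "(nat \<Rightarrow> 'b::comm_monoid_mult) \<Rightarrow> (nat \<times> nat) set \<Rightarrow> 'b" where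
  "hook_prod g lam = (\<Prod>x\<in>lam. g (hook_length lam x))"

text \<open>The amount by which the hook of a box \<open>x\<close> of the diagram grows when
  \<open>k\<close> is added.\<close>

definition aligned :: "nat \<times> nat \<Rightarrow> nat \<times> nat \<Rightarrow> nat" where
  "aligned k x = (if fst x = fst k \<or> snd x = snd k then 1 else 0)"

lemma hook_length_insert':
  assumes "young_diagram lam" "k \<in> addable lam" "x \<in> lam"
  shows "hook_length (insert k lam) x = hook_length lam x + aligned k x"
  using hook_length_insert[OF assms(1), of "fst k" "snd k" "fst x" "snd x"] assms(2,3)
  by (simp add: aligned_def)

lemma hook_prod_insert:
  assumes "young_diagram lam" "k \<in> addable lam"
  shows "hook_prod g (insert k lam) = g 1 * (\<Prod>x\<in>lam. g (hook_length lam x + aligned k x))"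
proof -
  have "k \<notin> lam" using assms(2) by (simp add: addable_def)
  then show ?thesis
    using young_finite[OF assms(1)] hook_length_new[OF assms]
    by (simp add: hook_prod_def hook_length_insert'[OF assms])
qed

text \<open>Only the box in the row of the upper and the column of the lower addable box has its
  hook lengthened by both, and that hook has length \<open>\<Delta> - 1\<close>. For every other box
  the contributions on the two sides agree.\<close>

lemma hook_prod_exchange:
  fixes g :: "nat \<Rightarrow> 'b::comm_monoid_mult"
  assumes y: "young_diagram lam" and k: "k \<in> addable lam" and m: "m \<in> addable lam" and ne: "k \<noteq> m"
  defines "\<Delta> \<equiv> nat \<bar>diag k - diag m\<bar>"
  shows "hook_prod g (insert k lam) * hook_prod g (insert m lam) * (g (\<Delta> + 1) * g (\<Delta> - 1)) =
    hook_prod g (insert k (insert m lam)) * hook_prod g lam * (g \<Delta> * g \<Delta>)"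
proof -
  have *: "hook_prod g (insert k lam) * hook_prod g (insert m lam) * (g (\<Delta> + 1) * g (\<Delta> - 1)) =
    hook_prod g (insert k (insert m lam)) * hook_prod g lam * (g \<Delta> * g \<Delta>)"
    if km: "k = (r, c)" "m = (r', c')" "r < r'" "c' < c" and k: "k \<in> addable lam" and m: "m \<in> addable lam"
      and \<Delta>: "\<Delta> = nat \<bar>diag k - diag m\<bar>"
    for k m r c r' c' \<Delta>
  proof -
    let ?h = "hook_length lam"
    have ne: "k \<noteq> m" using km by auto
    have K: "(r, c) \<notin> lam" "r \<ge> 1" "c \<ge> 1" "(r, c - 1) \<in> lam"
      and M: "(r', c') \<notin> lam" "r' \<ge> 1" "c' \<ge> 1" "(r' - 1, c') \<in> lam"
      using k m km by (auto simp: addable_iff[OF y])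
    have row: "(r, j) \<in> lam \<longleftrightarrow> 1 \<le> j \<and> j < c" for j
    proof
      assume j: "(r, j) \<in> lam"
      then have "j < c" using young_down[OF y j, of r c] K by (meson linorder_not_less order_refl)
      then show "1 \<le> j \<and> j < c" using young_pos[OF y j] by simp
    next
      assume "1 \<le> j \<and> j < c"
      moreover from this have "j \<le> c - 1" by linarith
      ultimately show "(r, j) \<in> lam" using young_down[OF y K(4), of r j] K by simp
    qed
    have col: "(i, c') \<in> lam \<longleftrightarrow> 1 \<le> i \<and> i < r'" for i
    proof
      assume i: "(i, c') \<in> lam"
      then have "i < r'" using young_down[OF y i, of r' c'] M by (meson linorder_not_less order_refl)
      then show "1 \<le> i \<and> i < r'" using young_pos[OF y i] by simp
    next
      assume "1 \<le> i \<and> i < r'"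
      moreover from this have "i \<le> r' - 1" by linarith
      ultimately show "(i, c') \<in> lam" using young_down[OF y M(4), of i c'] M by simp
    qed
    define x0 where "x0 = (r, c')"
    have x0: "x0 \<in> lam" using row[of c'] M km by (simp add: x0_def)
    have "?h x0 = (c - c') + (r' - Suc r)"
      unfolding x0_def using x0 K M row col by (intro hook_length_card) (auto simp: x0_def)
    then have h0: "?h x0 + 1 = \<Delta>" "?h x0 = \<Delta> - 1" using km \<Delta> by auto
    have a0: "aligned k x0 = 1" "aligned m x0 = 1" "aligned k m = 0"
      using km by (auto simp: aligned_def x0_def)
    have other: "g (?h x + aligned k x) * g (?h x + aligned m x) = g (?h x + aligned m x + aligned k x) * g (?h x)"
      if "x \<in> lam - {x0}" for x
    proof -
      have "\<not> (aligned k x = 1 \<and> aligned m x = 1)"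
      proof
        assume "aligned k x = 1 \<and> aligned m x = 1"
        \<comment> \<open>The other crossing point; if it were in the diagram, so would be the
          addable box \<open>m\<close> to its left.\<close>
        then have "x = (r', c)" using that km by (cases x) (auto simp: aligned_def x0_def split: if_splits)
        then show False using that young_down[OF y, of r' c r' c'] M km by auto
      qed
      then show ?thesis by (auto simp: aligned_def mult.commute)
    qed
    note fin = young_finite[OF y]
    have "(\<Prod>x\<in>lam. g (?h x + aligned k x)) * (\<Prod>x\<in>lam. g (?h x + aligned m x)) * (g (\<Delta> + 1) * g (\<Delta> - 1)) =
        g \<Delta> * g \<Delta> * ((\<Prod>x\<in>lam - {x0}. g (?h x + aligned k x) * g (?h x + aligned m x))) * (g (\<Delta> + 1) * g (\<Delta> - 1))"
      using prod.remove[OF fin x0, of "\<lambda>x. g (?h x + aligned k x)"] prod.remove[OF fin x0, of "\<lambda>x. g (?h x + aligned m x)"] a0 h0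
      by (simp add: prod.distrib ac_simps)
    also have "(\<Prod>x\<in>lam - {x0}. g (?h x + aligned k x) * g (?h x + aligned m x)) =
        (\<Prod>x\<in>lam - {x0}. g (?h x + aligned m x + aligned k x)) * (\<Prod>x\<in>lam - {x0}. g (?h x))"
      using other by (simp add: prod.distrib[symmetric])
    also have "g \<Delta> * g \<Delta> * \<dots> * (g (\<Delta> + 1) * g (\<Delta> - 1)) =
        (\<Prod>x\<in>lam. g (?h x + aligned m x + aligned k x)) * (\<Prod>x\<in>lam. g (?h x)) * (g \<Delta> * g \<Delta>)"
      using prod.remove[OF fin x0, of "\<lambda>x. g (?h x + aligned m x + aligned k x)"] prod.remove[OF fin x0, of "\<lambda>x. g (?h x)"] a0 h0
      by (simp add: ac_simps)
    finally have main: "(\<Prod>x\<in>lam. g (?h x + aligned k x)) * (\<Prod>x\<in>lam. g (?h x + aligned m x)) * (g (\<Delta> + 1) * g (\<Delta> - 1)) =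
        (\<Prod>x\<in>lam. g (?h x + aligned m x + aligned k x)) * (\<Prod>x\<in>lam. g (?h x)) * (g \<Delta> * g \<Delta>)" .
    have "m \<notin> lam" using m by (simp add: addable_def)
    then have "hook_prod g (insert k (insert m lam)) = g 1 * (g 1 * (\<Prod>x\<in>lam. g (?h x + aligned m x + aligned k x)))"
      using hook_prod_insert[OF addable_young[OF m] addable_insert[OF k m ne], of g] fin a0 hook_length_new[OF y m]
      by (simp add: hook_length_insert'[OF y m])
    then show ?thesis
      using main by (simp add: hook_prod_insert[OF y k] hook_prod_insert[OF y m] hook_prod_def[of g lam] ac_simps)
  qed
  obtain r c r' c' where km: "k = (r, c)" "m = (r', c')" by (cases k, cases m)
  have "r < r' \<and> c' < c \<or> r' < r \<and> c < c'"
    using addable_order[OF y] k m ne km by blast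
  then show ?thesis
  proof
    assume "r < r' \<and> c' < c"
    then show ?thesis using *[OF km _ _ k m] by (simp add: \<Delta>_def)
  next
    assume "r' < r \<and> c < c'"
    moreover have "\<Delta> = nat \<bar>diag m - diag k\<bar>" by (simp add: \<Delta>_def)
    ultimately show ?thesis
      using *[OF km(2,1) _ _ m k] by (simp add: insert_commute mult.commute[of "hook_prod g (insert k lam)"])
  qed
qed

text \<open>Hooks of lengths 1 to M - 1 become hooks of lengths 2 to M, so the product
  telescopes.\<close>

lemma prod_shift:
  fixes g :: "nat \<Rightarrow> 'b::comm_monoid_mult"
  assumes "M \<ge> 1"
  shows "(\<Prod>j\<in>{1..<M}. g (M - j + 1)) * g 1 = g M * (\<Prod>j\<in>{1..<M}. g (M - j))"
proof -
  have 1: "(\<Prod>j\<in>{1..<M}. g' (M - j)) = (\<Prod>i\<in>{1..<M}. g' i)" for g' :: "nat \<Rightarrow> 'b"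
    by (rule prod.reindex_bij_witness[of _ "\<lambda>i. M - i" "\<lambda>i. M - i"]) auto
  have "(\<Prod>i\<in>{1..<M}. g (i + 1)) * g 1 = g M * (\<Prod>i\<in>{1..<M}. g i)"
    using assms by (induction M rule: dec_induct) (simp_all add: ac_simps)
  then show ?thesis using 1[of g] 1[of "\<lambda>i. g (i + 1)"] by simp
qed

lemma removable_beyond:
  assumes y: "young_diagram lam" and x: "(r, c) \<in> lam"
  obtains r' c' where "(r', c') \<in> removable lam" "r \<le> r'" "c \<le> c'"
proof -
  define A where "A = {x \<in> lam. r \<le> fst x \<and> c \<le> snd x}"
  define f :: "nat \<times> nat \<Rightarrow> nat" where "f = (\<lambda>x. fst x + snd x)"
  have fin: "finite (f ` A)" "f ` A \<noteq> {}" using young_finite[OF y] x by (auto simp: A_def)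
  obtain m where m: "m \<in> A" "f m = Max (f ` A)" using Max_in[OF fin] by (metis imageE)
  have max: "f x \<le> f m" if "x \<in> A" for x using that Max_ge[OF fin(1)] m(2) by auto
  obtain r' c' where rc: "m = (r', c')" by (cases m)
  have "(r' + 1, c') \<notin> lam" "(r', c' + 1) \<notin> lam"
    using max[of "(r' + 1, c')"] max[of "(r', c' + 1)"] m(1) by (auto simp: A_def f_def rc)
  then have "(r', c') \<in> removable lam" using m(1) by (simp add: A_def rc removable_iff[OF y])
  then show ?thesis using that m(1) by (auto simp: A_def rc)
qed

text \<open>Every box lies up-left of some removable box, so the diagram stays inside the rectangle
  with corner (n, l); the boxes above and left of that corner fill the rest.\<close>

lemma near_rectangle:
  assumes y: "young_diagram lam" and m: "(n, l) \<in> addable lam"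
    and rem: "removable lam \<subseteq> {(n - 1, l), (n, l - 1)}"
  shows "lam = {1..n} \<times> {1..l} - {(n, l)}"
proof -
  have M: "(n, l) \<notin> lam" "n \<ge> 1" "l \<ge> 1" "n = 1 \<or> (n - 1, l) \<in> lam" "l = 1 \<or> (n, l - 1) \<in> lam"
    using m by (auto simp: addable_iff[OF y])
  have "(r, c) \<in> lam \<longleftrightarrow> (r, c) \<in> {1..n} \<times> {1..l} - {(n, l)}" for r c
  proof
    assume x: "(r, c) \<in> lam"
    obtain r' c' where "(r', c') \<in> removable lam" "r \<le> r'" "c \<le> c'" using removable_beyond[OF y x] .
    then have "r \<le> n" "c \<le> l" using rem by auto
    then show "(r, c) \<in> {1..n} \<times> {1..l} - {(n, l)}" using x M(1) young_pos[OF y x] by auto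
  next
    assume x: "(r, c) \<in> {1..n} \<times> {1..l} - {(n, l)}"
    show "(r, c) \<in> lam"
    proof (cases "r = n")
      case True
      then have "(n, l - 1) \<in> lam" "c \<le> l - 1" using x M by auto
      then show ?thesis using young_down[OF y, of n "l - 1" r c] x by auto
    next
      case False
      then have "(n - 1, l) \<in> lam" "r \<le> n - 1" using x M by auto
      then show ?thesis using young_down[OF y, of "n - 1" l r c] x by auto
    qed
  qed
  then show ?thesis by auto
qed

text \<open>Filling the corner lengthens only the hooks in the last row and the last column, which
  have lengths l - j and n - i; \<open>prod_shift\<close> applies to each.\<close>

lemma hook_prod_near_rectangle:
  fixes g :: "nat \<Rightarrow> 'b::comm_monoid_mult"
  assumes y: "young_diagram lam" and m: "(n, l) \<in> addable lam" and nl: "n \<ge> 1" "l \<ge> 1"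
    and lam: "lam = {1..n} \<times> {1..l} - {(n, l)}"
  shows "hook_prod g (insert (n, l) lam) * g 1 = g n * g l * hook_prod g lam"
proof -
  let ?h = "hook_length lam"
  define A where "A = {1..<n} \<times> {1..<l}"
  define B where "B = {n} \<times> {1..<l}"
  define C where "C = {1..<n} \<times> {l}"
  have split: "lam = A \<union> (B \<union> C)" using nl by (auto simp: lam A_def B_def C_def)
  have P: "(\<Prod>x\<in>lam. f x) = (\<Prod>x\<in>A. f x) * ((\<Prod>j\<in>{1..<l}. f (n, j)) * (\<Prod>i\<in>{1..<n}. f (i, l)))"
    for f :: "nat \<times> nat \<Rightarrow> 'b"
  proof -
    have "(\<Prod>x\<in>lam. f x) = (\<Prod>x\<in>A. f x) * ((\<Prod>x\<in>B. f x) * (\<Prod>x\<in>C. f x))"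
      unfolding split by (subst prod.union_disjoint; auto simp: A_def B_def C_def)+
    moreover have "(\<Prod>x\<in>B. f x) = (\<Prod>j\<in>{1..<l}. f (n, j))"
      unfolding B_def by (rule prod.reindex_bij_witness[of _ "\<lambda>j. (n, j)" snd]) auto
    moreover have "(\<Prod>x\<in>C. f x) = (\<Prod>i\<in>{1..<n}. f (i, l))"
      unfolding C_def by (rule prod.reindex_bij_witness[of _ "\<lambda>i. (i, l)" fst]) auto
    ultimately show ?thesis by simp
  qed
  have hB: "?h (n, j) = l - j" if "j \<in> {1..<l}" for j
  proof -
    have "?h (n, j) = (l - j) + (Suc n - Suc n)"
      using that nl by (intro hook_length_card) (auto simp: lam)
    then show ?thesis by simp
  qed
  have hC: "?h (i, l) = n - i" if "i \<in> {1..<n}" for i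
  proof -
    have "?h (i, l) = (Suc l - l) + (n - Suc i)"
      using that nl by (intro hook_length_card) (auto simp: lam)
    moreover have "1 + (n - Suc i) = n - i" using that by auto
    ultimately show ?thesis by simp
  qed
  have H: "hook_prod g lam = (\<Prod>x\<in>A. g (?h x)) * ((\<Prod>j\<in>{1..<l}. g (l - j)) * (\<Prod>i\<in>{1..<n}. g (n - i)))"
    unfolding hook_prod_def P using hB hC by simp
  have "(\<Prod>x\<in>lam. g (?h x + aligned (n, l) x)) =
      (\<Prod>x\<in>A. g (?h x)) * ((\<Prod>j\<in>{1..<l}. g (l - j + 1)) * (\<Prod>i\<in>{1..<n}. g (n - i + 1)))"
    unfolding P using hB hC by (auto simp: aligned_def A_def intro!: arg_cong2[where f = times] prod.cong)
  then have "hook_prod g (insert (n, l) lam) * g 1 =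
      (\<Prod>x\<in>A. g (?h x)) * (((\<Prod>j\<in>{1..<l}. g (l - j + 1)) * g 1) * ((\<Prod>i\<in>{1..<n}. g (n - i + 1)) * g 1))"
    using hook_prod_insert[OF y m, of g] by (simp add: ac_simps)
  then show ?thesis
    unfolding prod_shift[OF nl(1)] prod_shift[OF nl(2)] H by (simp add: ac_simps)
qed


lemma near_rectangle_corners:
  assumes y: "young_diagram lam" and nl: "n \<ge> 1" "l \<ge> 1" and lam: "lam = {1..n} \<times> {1..l} - {(n, l)}"
  shows "addable lam - {(n, l)} = {x. x = (n + 1, 1) \<and> l > 1} \<union> {x. x = (1, l + 1) \<and> n > 1}"
    and "removable lam = {x. x = (n, l - 1) \<and> l > 1} \<union> {x. x = (n - 1, l) \<and> n > 1}"
proof -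
  have "(i, j) \<in> addable lam - {(n, l)} \<longleftrightarrow>
      (i, j) = (n + 1, 1) \<and> l > 1 \<or> (i, j) = (1, l + 1) \<and> n > 1" for i j
    unfolding Diff_iff addable_iff[OF y] using nl by (auto simp: lam)
  then show "addable lam - {(n, l)} = {x. x = (n + 1, 1) \<and> l > 1} \<union> {x. x = (1, l + 1) \<and> n > 1}"
    by auto
  have "(i, j) \<in> removable lam \<longleftrightarrow>
      (i, j) = (n, l - 1) \<and> l > 1 \<or> (i, j) = (n - 1, l) \<and> n > 1" for i j
    unfolding removable_iff[OF y] using nl by (auto simp: lam)
  then show "removable lam = {x. x = (n, l - 1) \<and> l > 1} \<union> {x. x = (n - 1, l) \<and> n > 1}"
    by auto
qed

section \<open>Quantum integers and the quotient of two hook products\<close>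

context hecke
begin

definition qint :: "nat \<Rightarrow> complex" where
  "qint n = (q ^ n - inverse q ^ n) / \<kappa>"

lemma qint_1 [simp]: "qint (Suc 0) = 1"
  using kappa_nonzero by (simp add: qint_def)

lemma qint_nonzero: "n > 0 \<Longrightarrow> qint n \<noteq> 0"
proof -
  assume "n > 0"
  then have "q powi int n \<noteq> q powi (- int n)" unfolding generic_powi_inj[OF generic] by simp
  then show ?thesis using kappa_nonzero by (simp add: qint_def power_int_minus power_inverse)
qed

text \<open>Each difference of contents is a power of q times q^(m - j) - q^(j - m). In a product of
  two of them the signs cancel, so only the distance matters, and both products carry the same power
  of q.\<close>

lemma content_difference_square:
  assumes "\<bar>k - m\<bar> \<ge> 2"
  defines "D \<equiv> nat \<bar>k - m\<bar>" and "g \<equiv> \<lambda>j. q powi (2 * m) - q powi (2 * j)"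
  shows "g (k + 1) * g (k - 1) = q powi (2 * (m + k)) * \<kappa>\<^sup>2 * (qint (D + 1) * qint (D - 1))"
    and "g k * g k = q powi (2 * (m + k)) * \<kappa>\<^sup>2 * (qint D * qint D)"
proof -
  have g: "g j = q powi (m + j) * (q powi (m - j) - q powi (j - m))" for j
  proof -
    have e: "2 * m = (m + j) + (m - j)" "2 * j = (m + j) + (j - m)" by simp_all
    show ?thesis unfolding g_def by (subst e(1), subst e(2)) (simp only: power_int_add q_nonzero simp_thms right_diff_distrib not_False_eq_True)
  qed
  have qn: "qint n * \<kappa> = q powi int n - q powi (- int n)" for n
    using kappa_nonzero by (simp add: qint_def power_int_minus power_inverse)
  have pw: "q powi (m + (k + 1)) * q powi (m + (k - 1)) = q powi (2 * (m + k))"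
    "q powi (m + k) * q powi (m + k) = q powi (2 * (m + k))"
  proof -
    have "m + (k + 1) + (m + (k - 1)) = 2 * (m + k)" "m + k + (m + k) = 2 * (m + k)" by simp_all
    then show "q powi (m + (k + 1)) * q powi (m + (k - 1)) = q powi (2 * (m + k))"
      "q powi (m + k) * q powi (m + k) = q powi (2 * (m + k))"
      by (metis power_int_add q_nonzero)+
  qed
  define u where "u = (\<lambda>j. q powi (m - j) - q powi (j - m))"
  have u: "u (k + 1) * u (k - 1) = (qint (D + 1) * \<kappa>) * (qint (D - 1) * \<kappa>)"
    "u k * u k = (qint D * \<kappa>) * (qint D * \<kappa>)"
  proof -
    consider "k \<ge> m + 2" | "m \<ge> k + 2" using assms(1) by linarith
    then have "u (k + 1) * u (k - 1) = (qint (D + 1) * \<kappa>) * (qint (D - 1) * \<kappa>) \<and> u k * u k = (qint D * \<kappa>) * (qint D * \<kappa>)"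
    proof cases
      case 1
      then have D: "int (D + 1) = k + 1 - m" "int (D - 1) = k - 1 - m" "int D = k - m" by (auto simp: D_def)
      show ?thesis unfolding qn D u_def by (simp add: algebra_simps)
    next
      case 2
      then have D: "int (D - 1) = m - (k + 1)" "int (D + 1) = m - (k - 1)" "int D = m - k" by (auto simp: D_def)
      show ?thesis unfolding qn D u_def by (simp add: algebra_simps)
    qed
    then show "u (k + 1) * u (k - 1) = (qint (D + 1) * \<kappa>) * (qint (D - 1) * \<kappa>)"
      "u k * u k = (qint D * \<kappa>) * (qint D * \<kappa>)" by auto
  qed
  have "g (k + 1) * g (k - 1) = (q powi (m + (k + 1)) * q powi (m + (k - 1))) * (u (k + 1) * u (k - 1))"
    by (simp only: g u_def mult_ac)
  then show "g (k + 1) * g (k - 1) = q powi (2 * (m + k)) * \<kappa>\<^sup>2 * (qint (D + 1) * qint (D - 1))"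
    unfolding pw u by (simp only: power2_eq_square mult_ac)
  have "g k * g k = (q powi (m + k) * q powi (m + k)) * (u k * u k)"
    by (simp only: g u_def mult_ac)
  then show "g k * g k = q powi (2 * (m + k)) * \<kappa>\<^sup>2 * (qint D * qint D)"
    unfolding pw u by (simp only: power2_eq_square mult_ac)
qed

lemma hook_prod_nonzero:
  assumes "young_diagram lam"
  shows "hook_prod qint lam \<noteq> 0"
proof -
  have "hook_length lam x > 0" if "x \<in> lam" for x
  proof -
    obtain r c where rc: "x = (r, c)" by (cases x)
    have "finite {(r', c'). (r', c') \<in> lam \<and> (r' = r \<and> c \<le> c' \<or> c' = c \<and> r \<le> r')}"
      by (rule finite_subset[OF _ young_finite[OF assms]]) auto
    then show ?thesis using that by (auto simp: hook_length_def rc card_gt_0_iff)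
  qed
  then show ?thesis using qint_nonzero young_finite[OF assms] by (simp add: hook_prod_def)
qed

definition corner_ratio :: "(nat \<times> nat) set \<Rightarrow> nat \<times> nat \<Rightarrow> complex" where
  "corner_ratio lam m = (\<Prod>r\<in>removable lam. ct m - ct r) / (\<Prod>m'\<in>addable lam - {m}. ct m - ct m')"

lemma corner_ratio_insert:
  assumes y: "young_diagram lam" and k: "k \<in> addable lam" and m: "m \<in> addable lam" and ne: "k \<noteq> m"
  defines "D \<equiv> nat \<bar>diag k - diag m\<bar>"
  shows "corner_ratio (insert k lam) m * (qint (D + 1) * qint (D - 1)) = corner_ratio lam m * (qint D * qint D)"
proof -
  \<comment> \<open>The value 1 on the diagonal of \<open>m\<close> drops the factor of
    \<open>m\<close> from the addable product. No other addable and no removable box lies there, and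
    the gap keeps \<open>diag k\<close> and its two neighbours away from it.\<close>
  define g where "g = (\<lambda>j. if j = diag m then 1 else q powi (2 * diag m) - q powi (2 * j))"
  have m': "m \<in> addable (insert k lam)" using addable_insert[OF m k] ne by simp
  have add: "(\<Prod>x\<in>addable l. g (diag x)) = (\<Prod>x\<in>addable l - {m}. ct m - ct x)"
    and rem: "(\<Prod>x\<in>removable l. g (diag x)) = (\<Prod>x\<in>removable l. ct m - ct x)"
    if l: "young_diagram l" "m \<in> addable l" for l
  proof -
    have "(\<Prod>x\<in>addable l. g (diag x)) = g (diag m) * (\<Prod>x\<in>addable l - {m}. g (diag x))"
      by (rule prod.remove[OF finite_addable[OF l(1)] l(2)])
    also have "g (diag m) = 1" by (simp add: g_def)
    also have "(\<Prod>x\<in>addable l - {m}. g (diag x)) = (\<Prod>x\<in>addable l - {m}. ct m - ct x)"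
    proof (intro prod.cong refl)
      fix x assume "x \<in> addable l - {m}"
      then have "diag x \<noteq> diag m" using addable_diag_gap[OF l(1) _ l(2), of x] by auto
      then show "g (diag x) = ct m - ct x" by (simp add: g_def node_content_diag)
    qed
    finally show "(\<Prod>x\<in>addable l. g (diag x)) = (\<Prod>x\<in>addable l - {m}. ct m - ct x)" by simp
    show "(\<Prod>x\<in>removable l. g (diag x)) = (\<Prod>x\<in>removable l. ct m - ct x)"
      using removable_addable_diag[OF l(1) _ l(2)]
      by (intro prod.cong) (auto simp: g_def node_content_diag)
  qed
  have yk: "young_diagram (insert k lam)" by (rule addable_young[OF k])
  have gap: "\<bar>diag k - diag m\<bar> \<ge> 2" by (rule addable_diag_gap[OF y k m ne])
  define E where "E = qint (D + 1) * qint (D - 1)"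
  define F where "F = qint D * qint D"
  define s where "s = q powi (2 * (diag m + diag k)) * \<kappa>\<^sup>2"
  have s: "s \<noteq> 0" unfolding s_def using kappa_nonzero by (simp only: mult_eq_0_iff power_int_eq_0_iff power_eq_0_iff q_nonzero) simp
  have gs: "g (diag k + 1) * g (diag k - 1) = s * E" "g (diag k) * g (diag k) = s * F"
    using content_difference_square[OF gap] gap by (auto simp: g_def D_def E_def F_def s_def)
  let ?R = "\<lambda>l. \<Prod>x\<in>removable l. ct m - ct x" and ?A = "\<lambda>l. \<Prod>x\<in>addable l - {m}. ct m - ct x"
  have "?R (insert k lam) * ?A lam * (s * E) = ?R lam * ?A (insert k lam) * (s * F)"
    using corner_product[OF y k, of g] unfolding add[OF y m] add[OF yk m'] rem[OF y m] rem[OF yk m'] gs .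
  then have eq: "?R (insert k lam) * ?A lam * E = ?R lam * ?A (insert k lam) * F"
    using s by (simp add: mult.left_commute[of _ s])
  have nz: "?A l \<noteq> 0" if l: "young_diagram l" "m \<in> addable l" for l
    using inj_on_ct_addable[OF l(1)] l(2) finite_addable[OF l(1)] by (auto simp: inj_on_def)
  show ?thesis
    using eq nz[OF y m] nz[OF yk m'] unfolding corner_ratio_def E_def[symmetric] F_def[symmetric]
    by (simp add: divide_simps) (simp add: mult_ac)
qed

lemma corner_ratio_near_rectangle:
  assumes y: "young_diagram lam" and m: "m = (n, l)" "n \<ge> 1" "l \<ge> 1"
    and lam: "lam = {1..n} \<times> {1..l} - {(n, l)}"
  shows "qint n * qint l * corner_ratio lam m = q powi (diag m)"
proof -
  note S = near_rectangle_corners[OF y m(2,3) lam]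
  have "ct (i, j) = q ^ (2 * j) / q ^ (2 * i)" for i j
  proof -
    have "2 * (int j - int i) = int (2 * j) - int (2 * i)" by simp
    then show ?thesis unfolding node_content_diag diag_pair using power_int_diff[of q "int (2 * j)" "int (2 * i)"]
      by (simp only: power_int_of_nat q_nonzero simp_thms not_False_eq_True)
  qed
  then have ctp: "ct (i, j) = (q ^ j * q ^ j) / (q ^ i * q ^ i)" for i j
    by (simp only: mult_2 power_add)
  define R1 where "R1 = (if l > 1 then ct m - ct (n, l - 1) else 1)"
  define R2 where "R2 = (if n > 1 then ct m - ct (n - 1, l) else 1)"
  define A1 where "A1 = (if l > 1 then ct m - ct (n + 1, 1) else 1)"
  define A2 where "A2 = (if n > 1 then ct m - ct (1, l + 1) else 1)"
  have "(\<Prod>r\<in>removable lam. ct m - ct r) = R1 * R2"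
    unfolding S(2) R1_def R2_def using m by (subst prod.union_disjoint) auto
  moreover have "(\<Prod>r\<in>addable lam - {m}. ct m - ct r) = A1 * A2"
    unfolding m S(1) A1_def A2_def using m by (subst prod.union_disjoint) auto
  ultimately have cr: "corner_ratio lam m = (R1 * R2) / (A1 * A2)" by (simp add: corner_ratio_def)
  \<comment> \<open>Addable and removable corners are matched at the bottom row here and at the last
    column in \<open>c2\<close>. For \<open>l = 1\<close> both corners are absent, and the identity
    reduces to q = q.\<close>
  have c1: "A1 * q ^ l = R1 * (q * qint l)"
  proof (cases "l > 1")
    case True
    then obtain j where j: "l = Suc j" "j \<ge> 1" by (cases l) auto
    show ?thesis using kappa_nonzero
      by (simp add: A1_def R1_def True m ctp qint_def j divide_simps power_add) (simp add: field_simps power2_eq_square)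
  next
    case False
    then have "l = 1" using m by simp
    then show ?thesis by (simp add: A1_def R1_def)
  qed
  have c2: "A2 * q = R2 * (q ^ n * qint n)"
  proof (cases "n > 1")
    case True
    then obtain j where j: "n = Suc j" "j \<ge> 1" by (cases n) auto
    show ?thesis using kappa_nonzero
      by (simp add: A2_def R2_def True m ctp qint_def j divide_simps power_add) (simp add: field_simps power2_eq_square)
  next
    case False
    then have "n = 1" using m by simp
    then show ?thesis by (simp add: A2_def R2_def)
  qed
  have "A1 \<noteq> 0 \<and> A2 \<noteq> 0" unfolding A1_def A2_def m using m by (auto simp: ct_eq_iff)
  then have nz: "A1 \<noteq> 0" "A2 \<noteq> 0" by auto
  have "R1 * (q * qint l) * (R2 * (q ^ n * qint n)) = A1 * q ^ l * (A2 * q)" using c1 c2 by simp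
  then have "(R1 * R2) * (qint n * qint l) * q ^ n * q = (A1 * A2) * q ^ l * q" by (simp add: mult_ac)
  then have e: "(R1 * R2) * (qint n * qint l) * q ^ n = (A1 * A2) * q ^ l" by simp
  have "q powi (diag m) = q ^ l / q ^ n" by (simp add: m power_int_diff)
  moreover have "qint n * qint l * ((R1 * R2) / (A1 * A2)) = q ^ l / q ^ n"
    using e nz by (simp add: divide_simps) (simp add: mult_ac)
  ultimately show ?thesis by (simp add: cr)
qed

text \<open>Adding a box \<open>k\<close> far from \<open>m\<close> changes both sides by the same factor, determined by the
  one hook that meets both \<open>k\<close> and \<open>m\<close>; this reduces to a rectangle with corner \<open>m\<close>.\<close>

lemma hook_ratio:
  assumes "young_diagram lam" "m \<in> addable lam"
  shows "hook_prod qint lam * q powi (diag m) = corner_ratio lam m * hook_prod qint (insert m lam)"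
  using assms
proof (induction "card lam" arbitrary: lam rule: less_induct)
  case less
  note y = less.prems(1) and m = less.prems(2)
  obtain n l where nl: "m = (n, l)" by (cases m)
  have M: "(n, l) \<notin> lam" "n \<ge> 1" "l \<ge> 1" "n = 1 \<or> (n - 1, l) \<in> lam" "l = 1 \<or> (n, l - 1) \<in> lam"
    using m by (auto simp: nl addable_iff[OF y])
  show ?case
  proof (cases "removable lam \<subseteq> {(n - 1, l), (n, l - 1)}")
    case True
    have lam: "lam = {1..n} \<times> {1..l} - {(n, l)}"
      using near_rectangle[OF y _ True] m nl by simp
    have "hook_prod qint (insert m lam) = qint n * qint l * hook_prod qint lam"
      using hook_prod_near_rectangle[OF y m[unfolded nl] M(2,3) lam, of qint] nl by simp
    then have "corner_ratio lam m * hook_prod qint (insert m lam) =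
        (qint n * qint l * corner_ratio lam m) * hook_prod qint lam" by simp
    then show ?thesis unfolding corner_ratio_near_rectangle[OF y nl M(2,3) lam] by simp
  next
    case False
    then obtain k where k: "k \<in> removable lam" "k \<noteq> (n - 1, l)" "k \<noteq> (n, l - 1)" by blast
    define lam0 where "lam0 = lam - {k}"
    have y0: "young_diagram lam0" and k0: "k \<in> addable lam0" and lam: "lam = insert k lam0" and kin: "k \<in> lam"
      using removable_young[OF k(1)] removable_as_addable[OF y k(1)] k(1) by (auto simp: lam0_def removable_def)
    \<comment> \<open>\<open>k\<close> is neither the box above \<open>m\<close> nor the one to its
      left, so \<open>m\<close> stays addable.\<close>
    have m0: "m \<in> addable lam0"
      unfolding nl addable_iff[OF y0] using M k by (auto simp: lam0_def)
    have ne: "k \<noteq> m" using kin M nl by auto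
    have "card lam0 < card lam" unfolding lam0_def using young_finite[OF y] kin by (rule card_Diff1_less)
    from less.hyps[OF this y0 m0]
    have IH: "hook_prod qint lam0 * q powi (diag m) = corner_ratio lam0 m * hook_prod qint (insert m lam0)" .
    define D where "D = nat \<bar>diag k - diag m\<bar>"
    have D: "D \<ge> 2" using addable_diag_gap[OF y0 k0 m0 ne] by (simp add: D_def)
    define E where "E = qint (D + 1) * qint (D - 1)"
    define F where "F = qint D * qint D"
    have EF: "E \<noteq> 0" "F \<noteq> 0" using D qint_nonzero by (auto simp: E_def F_def)
    have ex: "hook_prod qint lam * hook_prod qint (insert m lam0) * E = hook_prod qint (insert m lam) * hook_prod qint lam0 * F"
      using hook_prod_exchange[OF y0 k0 m0 ne, of qint] lam by (simp add: E_def F_def D_def insert_commute)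
    have cr: "corner_ratio lam m * E = corner_ratio lam0 m * F"
      using corner_ratio_insert[OF y0 k0 m0 ne] by (simp add: E_def F_def D_def lam)
    have nz: "hook_prod qint (insert m lam0) \<noteq> 0" by (rule hook_prod_nonzero[OF addable_young[OF m0]])
    have "(hook_prod qint lam * q powi (diag m)) * (hook_prod qint (insert m lam0) * E) =
        hook_prod qint (insert m lam) * F * (hook_prod qint lam0 * q powi (diag m))"
      using ex by (simp add: mult_ac)
    also have "\<dots> = hook_prod qint (insert m lam) * (corner_ratio lam0 m * F) * hook_prod qint (insert m lam0)"
      unfolding IH by (simp only: mult_ac)
    also have "\<dots> = (corner_ratio lam m * hook_prod qint (insert m lam)) * (hook_prod qint (insert m lam0) * E)"
      unfolding cr[symmetric] by (simp only: mult_ac)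
    finally show ?thesis using nz EF by simp
  qed
qed

end

section \<open>The hook formula for the product of the weights\<close>

context ocneanu
begin

text \<open>By \<open>hook_ratio\<close> each new corner ratio is a quotient of consecutive hook
  products times a power of q, so the product along the path telescopes.\<close>

lemma path_weight_hooks:
  "young_path T \<Longrightarrow> path_weight T * hook_prod qint (set T) =
    (\<Prod>m\<in>set T. (1 - q powr (- 2 * d) / ct m) / \<kappa> * q powi (diag m))"
proof (induction T)
  case (Cons m T)
  then have pT: "young_path T" and m: "m \<in> addable (set T)" and y: "young_diagram (set T)"
    using young_path_young by auto
  have mT: "m \<notin> set T" using m by (simp add: addable_def)
  define x where "x = (1 - q powr (- 2 * d) / ct m) / \<kappa>"
  have w: "weight (set T) m = x * corner_ratio (set T) m" by (simp add: weight_def corner_ratio_def x_def)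
  have "path_weight (m # T) * hook_prod qint (set (m # T)) =
      x * (corner_ratio (set T) m * hook_prod qint (insert m (set T))) * path_weight T"
    by (simp add: w)
  also have "\<dots> = x * q powi (diag m) * (path_weight T * hook_prod qint (set T))"
    by (simp add: hook_ratio[OF y m, symmetric])
  also have "\<dots> = (\<Prod>m\<in>set (m # T). (1 - q powr (- 2 * d) / ct m) / \<kappa> * q powi (diag m))"
    using mT by (simp add: Cons.IH[OF pT] x_def)
  finally show ?case .
qed (simp add: hook_prod_def)

text \<open>Extracting q^(-d) symmetrises the exponents: (1 - q^(-2d-2k)) q^k = q^(-d) (q^(d+k) -
  q^(-d-k)), where k is the diagonal of the box.\<close>

lemma weight_factor:
  "(1 - q powr (- 2 * d) / ct (r, c)) / \<kappa> * q powi (diag (r, c)) = q powr (- d) * qnum q (d + of_nat c - of_nat r)"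
proof -
  define k where "k = diag (r, c)"
  have k: "d + of_nat c - of_nat r = d + of_int k" by (simp add: k_def)
  have p: "q powr (of_int k) = q powi k" "q powr (- of_int k) = q powi (- k)"
    using complex_powr_of_int[of q k] complex_powr_of_int[of q "- k"] by simp_all
  have dd: "q powr (- d) * q powr d = 1" "q powr (- d) * q powr (- d) = q powr (- 2 * d)"
    by (simp_all flip: powr_add)
  have "q powr (- d) * (q powr (d + of_int k) - q powr (- (d + of_int k))) =
      (q powr (- d) * q powr d) * q powr (of_int k) - (q powr (- d) * q powr (- d)) * q powr (- of_int k)"
    by (simp add: powr_add[of q d] powr_add[of q "- d" "- of_int k", simplified] right_diff_distrib)
  also have "\<dots> = q powi k - q powr (- 2 * d) * q powi (- k)"
    unfolding dd p by simp
  also have "\<dots> = (1 - q powr (- 2 * d) / ct (r, c)) * q powi k"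
  proof -
    have "q powi (2 * k) = q powi k * q powi k" by (metis mult_2 power_int_add q_nonzero)
    then have "ct (r, c) = q powi k * q powi k" unfolding node_content_diag k_def .
    then show ?thesis by (simp add: left_diff_distrib power_int_minus divide_inverse)
  qed
  finally show ?thesis by (simp add: qnum_def k k_def)
qed

lemma path_weight_qdim:
  assumes "young_path T"
  shows "path_weight T = q powr (- d * of_nat (length T)) *
    (\<Prod>(n, m)\<in>set T. qnum q (d + of_nat m - of_nat n) / qnum q (of_nat (hook_length (set T) (n, m))))"
proof -
  have y: "young_diagram (set T)" by (rule young_path_young[OF assms])
  have qn: "qnum q (of_nat n) = qint n" for n
    using complex_powr_of_int[of q "int n"] complex_powr_of_int[of q "- int n"]
    by (simp add: qnum_def qint_def power_int_minus power_inverse)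
  have hp: "hook_prod qint (set T) = (\<Prod>(n, m)\<in>set T. qnum q (of_nat (hook_length (set T) (n, m))))"
    by (simp add: hook_prod_def qn case_prod_beta)
  have pw: "(q powr (- d)) ^ n = q powr (- d * of_nat n)" for n
    by (induction n) (simp_all add: powr_add[symmetric] algebra_simps)
  have "path_weight T * hook_prod qint (set T) =
      (\<Prod>(n, m)\<in>set T. q powr (- d) * qnum q (d + of_nat m - of_nat n))"
    unfolding path_weight_hooks[OF assms] using weight_factor by (intro prod.cong) auto
  also have "\<dots> = (q powr (- d)) ^ card (set T) * (\<Prod>(n, m)\<in>set T. qnum q (d + of_nat m - of_nat n))"
    by (simp add: case_prod_beta prod.distrib)
  finally have "path_weight T = q powr (- d * of_nat (length T)) * (\<Prod>(n, m)\<in>set T. qnum q (d + of_nat m - of_nat n)) / hook_prod qint (set T)"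
    using hook_prod_nonzero[OF y] by (simp add: pw young_path_card[OF assms] field_simps)
  then show ?thesis unfolding hp by (simp add: case_prod_beta prod_dividef)
qed

end

section \<open>Standard tableaux as paths\<close>

definition tableau_path :: "(nat \<times> nat) set \<Rightarrow> (nat \<times> nat \<Rightarrow> nat) \<Rightarrow> nat \<Rightarrow> (nat \<times> nat) list" where
  "tableau_path lam \<nu> k = map (inv_into lam \<nu>) (rev [1..<Suc k])"

lemma tableau_path_Suc: "tableau_path lam \<nu> (Suc k) = inv_into lam \<nu> (Suc k) # tableau_path lam \<nu> k"
  by (simp add: tableau_path_def)

lemma length_tableau_path [simp]: "length (tableau_path lam \<nu> k) = k"
  by (simp add: tableau_path_def)

text \<open>From (r', c') go right to (r', c) and then down to (r, c): the entries never decrease,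
  and the intermediate box belongs to the diagram.\<close>

lemma standard_tableau_sub_young:
  assumes y: "young_diagram lam" and \<nu>: "standard_tableau lam \<nu>"
  shows "young_diagram {x \<in> lam. \<nu> x \<le> k}"
proof (rule youngI)
  show "finite {x \<in> lam. \<nu> x \<le> k}" using young_finite[OF y] by simp
  show "1 \<le> r \<and> 1 \<le> c" if "(r, c) \<in> {x \<in> lam. \<nu> x \<le> k}" for r c
    using young_pos[OF y, of r c] that by simp
  show "(r', c') \<in> {x \<in> lam. \<nu> x \<le> k}"
    if x: "(r, c) \<in> {x \<in> lam. \<nu> x \<le> k}" and b: "1 \<le> r'" "r' \<le> r" "1 \<le> c'" "c' \<le> c" for r c r' c'
  proof -
    have l: "(r', c') \<in> lam" "(r', c) \<in> lam"
      using young_down[OF y, of r c] x b by auto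
    have "\<nu> (r', c') \<le> \<nu> (r', c)"
      using \<nu> l b by (cases "c' = c") (auto simp: standard_tableau_def less_imp_le)
    also have "\<dots> \<le> \<nu> (r, c)"
      using \<nu> l x b by (cases "r' = r") (auto simp: standard_tableau_def less_imp_le)
    finally show ?thesis using l x by simp
  qed
qed

lemma tableau_path:
  assumes y: "young_diagram lam" and \<nu>: "standard_tableau lam \<nu>" and "k \<le> card lam"
  shows "young_path (tableau_path lam \<nu> k) \<and> set (tableau_path lam \<nu> k) = {x \<in> lam. \<nu> x \<le> k}"
  using assms(3)
proof (induction k)
  case 0
  have "\<nu> x \<ge> 1" if "x \<in> lam" for x
    using \<nu> that by (auto simp: standard_tableau_def bij_betw_def)
  then show ?case by (force simp: tableau_path_def)
next
  case (Suc k)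
  have b: "bij_betw \<nu> lam {1..card lam}" using \<nu> by (simp add: standard_tableau_def)
  define x where "x = inv_into lam \<nu> (Suc k)"
  have "Suc k \<in> \<nu> ` lam" using b Suc.prems by (auto simp: bij_betw_def)
  then have x: "x \<in> lam" "\<nu> x = Suc k"
    unfolding x_def by (simp_all add: inv_into_into f_inv_into_f)
  have eq: "{z \<in> lam. \<nu> z \<le> Suc k} = insert x {z \<in> lam. \<nu> z \<le> k}"
    using b x by (auto simp: bij_betw_def inj_on_def le_Suc_eq)
  have "x \<in> addable {z \<in> lam. \<nu> z \<le> k}"
    using standard_tableau_sub_young[OF y \<nu>, of "Suc k"] x(2) unfolding eq addable_def by simp
  then show ?case using Suc eq by (simp add: tableau_path_Suc x_def[symmetric])
qed

theorem mainTheorem7: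
  fixes q d :: complex
    and \<sigma> :: "nat \<Rightarrow> 'a::complex_algebra_1"
    and Tr :: "nat \<Rightarrow> 'a \<Rightarrow> 'a"
    and lam :: "(nat \<times> nat) set"
    and \<nu> :: "nat \<times> nat \<Rightarrow> nat"
    and e :: 'a
  assumes "generic q"
    and "hecke_tower q \<sigma>"
    and "ocneanu_maps q d \<sigma> Tr"
    and "young_diagram lam"
    and "card lam \<ge> 1"
    and "standard_tableau lam \<nu>"
    and "tableau_idempotent q \<sigma> lam \<nu> e"
  shows "ocneanu_trace Tr (card lam) e =
    (q powr (- d * of_nat (card lam)) *
      (\<Prod>(n, m)\<in>lam. qnum q (d + of_nat m - of_nat n) / qnum q (of_nat (hook_length lam (n, m))))) *\<^sub>C 1"
proof -
  interpret ocneanu q \<sigma> d Tr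
    using assms(1-3) by unfold_locales
  define T where "T = tableau_path lam \<nu> (card lam)"
  have "{x \<in> lam. \<nu> x \<le> card lam} = lam"
    using assms(6) by (auto simp: standard_tableau_def bij_betw_def)
  then have T: "young_path T" "set T = lam" "length T = card lam"
    using tableau_path[OF assms(4,6), of "card lam"] by (auto simp: T_def)
  have e: "e \<in> hecke_alg \<sigma> (card lam)" "e \<noteq> 0" "e * e = e"
    and jm: "\<And>i. i \<in> {1..card lam} \<Longrightarrow> jucys_murphy \<sigma> i * e = node_content q (inv_into lam \<nu> i) *\<^sub>C e"
      "\<And>i. i \<in> {1..card lam} \<Longrightarrow> e * jucys_murphy \<sigma> i = node_content q (inv_into lam \<nu> i) *\<^sub>C e"
    using assms(7) by (auto simp: tableau_idempotent_def primitive_idempotent_def entry_content_def)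
  have "eig (tableau_path lam \<nu> k) e" if "k \<le> card lam" for k
    using that
  proof (induction k)
    case (Suc k)
    then show ?case using jm(1)[of "Suc k"] by (simp add: tableau_path_Suc del: jucys_murphy.simps)
  qed (simp add: tableau_path_def)
  then have "eig T e" by (simp add: T_def)
  moreover have "e * jucys_murphy \<sigma> (Suc i) = node_content q (rev T ! i) *\<^sub>C e" if "i < length T" for i
    using jm(2)[of "Suc i"] that T(3) by (simp add: T_def tableau_path_def rev_map del: jucys_murphy.simps upt_Suc)
  ultimately have "e = idem T"
    using eigen_idempotent_unique[OF T(1)] e T(3) by simp
  \<comment> \<open>The hypothesis that \<open>e\<close> is nonzero supplies the nonvanishing of
    \<open>idem T\<close> required by the trace computation.\<close>
  then show ?thesis
    using ocneanu_trace_idem[OF T(1)] e(2) path_weight_qdim[OF T(1)] T(2,3) by simp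
qed

end
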